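(* Let $\nu>0$, $T>0$, and let $\alpha,\beta$ satisfy $\frac12<\beta<\frac54$ and $\alpha+\beta=\frac54$. Given $v_0\in V^\beta$ and $\theta_0\in H^0$, any weak solution $(v,\theta)$ on $[0,T]$ of the system \[ \partial_t v+B(u,v)+\nu\Lambda^{2\beta}v=\Pi(\theta e_3),\qquad \partial_t\theta+u\cdot\nabla\theta=0,\qquad v=\Lambda^{2\alpha}u \] obtained as a limit of the Galerkin approximations described in the context satisfies \[ v\in C([0,T];V^\beta)\cap L^2(0,T;V^{2\beta}). \]
   Context: Let $\mathbb T=[0,2\pi]^3$ with periodic boundary conditions and $L_p=L^p(\mathbb T)$. For $s\in\mathbb R$, $H^s$ is the space of real periodic functions/distributions $f=\sum_{k\in\mathbb Z^3\setminus\{0\}}f_ke^{ik\cdot x}$ (zero mean) with $f_{-k}=\overline{f_k}$ and $\|f\|_{H^s}^2=\sum_k|f_k|^2|k|^{2s}<\infty$. $V^s$ is the analogous space of vector fields $w=\sum_{k\neq0}w_ke^{ik\cdot x}$, $w_k\in\mathbb C^3$, $w_{-k}=\overline{w_k}$, $w_k\cdot k=0$, with $\|w\|_{V^s}^2=\sum_k|w_k|^2|k|^{2s}$. $\Lambda^s$ is the Fourier multiplier by $|k|^s$. $\langle\cdot,\cdot\rangle$ is the $L^2$ scalar product/duality. $\Pi$ is the Leray projection onto $V^0$; $B(u,v)=\Pi((u\cdot\nabla)v)$. $e_3=(0,0,1)$. A weak solution on $[0,T]$ with data $v_0\in V^0,\theta_0\in H^0$ is a pair $(v,\theta)$ with $v\in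 L^\infty(0,T;V^0)\cap L^2(0,T;V^\beta)\cap C_w([0,T];V^0)$, $\theta\in L^\infty(0,T;H^0)\cap C_w([0,T];H^0)$, such that with $u=\Lambda^{-2\alpha}v$, for all $\psi\in V^{5/2}$, $\phi\in H^{5/2}$, $t\in[0,T]$: $\langle v(t),\psi\rangle-\int_0^t\langle B(u,\psi),v\rangle ds+\nu\int_0^t\langle\Lambda^\beta v,\Lambda^\beta\psi\rangle ds=\langle v_0,\psi\rangle+\int_0^t\langle\theta e_3,\psi\rangle ds$ and $\langle\theta(t),\phi\rangle-\int_0^t\langle u\cdot\nabla\phi,\theta\rangle ds=\langle\theta_0,\phi\rangle$. Galerkin approximation: with $\Pi_n$ the projection onto Fourier modes $0<|k|\le n$ and $B_n=\Pi_nB$, $(v_n,\theta_n,u_n)$ solves $\partial_tv_n+B_n(u_n,v_n)+\nu\Lambda^{2\beta}v_n=\Pi(\theta_ne_3)$, $\partial_t\theta_n+\Pi_n(u_n\cdot\nabla\theta_n)=0$, $v_n=\Lambda^{2\alpha}u_n$, with initial data $\Pi_nv_0,\Pi_n\theta_0$; the weak solution is obtained as a limit (weakly in $L^2(0,T;V^\beta)$, weakly-* in $L^\infty(0,T;V^0)$, strongly in $L^2(0,T;V^0)$ for $v_n$, weakly-* in $L^\infty(0,T;H^0)$ for $\theta_n$) of a subsequence. *)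

theory Defs
  imports "HOL-Analysis.Analysis"
begin

text \<open>Fourier-side model of periodic fields on the torus [0,2pi]^3.
  A (distributional) scalar field is its coefficient map k \<mapsto> f_k on Z^3,
  a vector field is a map k \<mapsto> w_k in C^3.\<close>

type_synonym wvec = "int ^ 3"
type_synonym sfield = "wvec \<Rightarrow> complex"
type_synonym vfield = "wvec \<Rightarrow> complex ^ 3"

definition kn :: "wvec \<Rightarrow> real" where
  "kn k = sqrt (\<Sum>i\<in>UNIV. (real_of_int (k $ i))\<^sup>2)"

definition kvec :: "wvec \<Rightarrow> complex ^ 3" where
  "kvec k = (\<chi> i. complex_of_int (k $ i))"

definition vcnj :: "complex ^ 3 \<Rightarrow> complex ^ 3" where
  "vcnj w = (\<chi> i. cnj (w $ i))"

definition kdot :: "complex ^ 3 \<Rightarrow> wvec \<Rightarrow> complex" where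
  "kdot w k = (\<Sum>i\<in>UNIV. w $ i * complex_of_int (k $ i))"

definition vdot :: "complex ^ 3 \<Rightarrow> complex ^ 3 \<Rightarrow> complex" where
  "vdot a b = (\<Sum>i\<in>UNIV. a $ i * cnj (b $ i))"

text \<open>e_3 (third coordinate vector; index type 3 has elements 0,1,2)\<close>
definition e3 :: "complex ^ 3" where
  "e3 = (\<chi> i. if i = 2 then 1 else 0)"

definition Hs :: "real \<Rightarrow> sfield \<Rightarrow> bool" where
  "Hs s f \<longleftrightarrow> f 0 = 0 \<and> (\<forall>k. f (- k) = cnj (f k)) \<and>
     (\<lambda>k. (cmod (f k))\<^sup>2 * kn k powr (2 * s)) summable_on UNIV"

definition Vs :: "real \<Rightarrow> vfield \<Rightarrow> bool" where
  "Vs s w \<longleftrightarrow> w 0 = 0 \<and> (\<forall>k. w (- k) = vcnj (w k)) \<and> (\<forall>k. kdot (w k) k = 0) \<and>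
     (\<lambda>k. (norm (w k))\<^sup>2 * kn k powr (2 * s)) summable_on UNIV"

definition HsNorm :: "real \<Rightarrow> sfield \<Rightarrow> real" where
  "HsNorm s f = sqrt (infsum (\<lambda>k. (cmod (f k))\<^sup>2 * kn k powr (2 * s)) UNIV)"

definition VsNorm :: "real \<Rightarrow> vfield \<Rightarrow> real" where
  "VsNorm s w = sqrt (infsum (\<lambda>k. (norm (w k))\<^sup>2 * kn k powr (2 * s)) UNIV)"

definition Hinner :: "real \<Rightarrow> sfield \<Rightarrow> sfield \<Rightarrow> real" where
  "Hinner s f g = Re (infsum (\<lambda>k. complex_of_real (kn k powr (2 * s)) * f k * cnj (g k)) UNIV)"

definition Vinner :: "real \<Rightarrow> vfield \<Rightarrow> vfield \<Rightarrow> real" where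
  "Vinner s f g = Re (infsum (\<lambda>k. complex_of_real (kn k powr (2 * s)) * vdot (f k) (g k)) UNIV)"

text \<open>L^2(T) scalar product / duality: <f,g> = (2pi)^3 sum_k f_k conj(g_k)\<close>
definition l2s :: "sfield \<Rightarrow> sfield \<Rightarrow> real" where
  "l2s f g = (2 * pi) ^ 3 * Re (infsum (\<lambda>k. f k * cnj (g k)) UNIV)"

definition l2v :: "vfield \<Rightarrow> vfield \<Rightarrow> real" where
  "l2v f g = (2 * pi) ^ 3 * Re (infsum (\<lambda>k. vdot (f k) (g k)) UNIV)"

definition LamS :: "real \<Rightarrow> sfield \<Rightarrow> sfield" where
  "LamS s f = (\<lambda>k. complex_of_real (kn k powr s) * f k)"

definition LamV :: "real \<Rightarrow> vfield \<Rightarrow> vfield" where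
  "LamV s f = (\<lambda>k. kn k powr s *\<^sub>R f k)"

definition leray :: "vfield \<Rightarrow> vfield" where
  "leray f = (\<lambda>k. if k = 0 then 0
      else f k - (kdot (f k) k / complex_of_real ((kn k)\<^sup>2)) *s kvec k)"

definition projS :: "nat \<Rightarrow> sfield \<Rightarrow> sfield" where
  "projS n f = (\<lambda>k. if 0 < kn k \<and> kn k \<le> real n then f k else 0)"

definition projV :: "nat \<Rightarrow> vfield \<Rightarrow> vfield" where
  "projV n f = (\<lambda>k. if 0 < kn k \<and> kn k \<le> real n then f k else 0)"

text \<open>Fourier coefficients of u.grad(phi) (scalar) and (u.grad)psi (vector):
  (fg)_k = sum_j f_j g_{k-j}, and d_i e^{il.x} = i l_i e^{il.x}\<close>
definition advS :: "vfield \<Rightarrow> sfield \<Rightarrow> sfield" where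
  "advS u \<phi> = (\<lambda>k. infsum (\<lambda>j. kdot (u j) (k - j) * \<i> * \<phi> (k - j)) UNIV)"

definition advV :: "vfield \<Rightarrow> vfield \<Rightarrow> vfield" where
  "advV u \<psi> = (\<lambda>k. \<chi> m. infsum (\<lambda>j. kdot (u j) (k - j) * \<i> * (\<psi> (k - j) $ m)) UNIV)"

definition Bop :: "vfield \<Rightarrow> vfield \<Rightarrow> vfield" where
  "Bop u \<psi> = leray (advV u \<psi>)"

definition theta_e3 :: "sfield \<Rightarrow> vfield" where
  "theta_e3 \<theta> = (\<lambda>k. \<theta> k *s e3)"

definition measV :: "real \<Rightarrow> (real \<Rightarrow> vfield) \<Rightarrow> bool" where
  "measV T v \<longleftrightarrow> (\<forall>k. (\<lambda>t. v t k) \<in> borel_measurable (lebesgue_on {0..T}))"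

definition measS :: "real \<Rightarrow> (real \<Rightarrow> sfield) \<Rightarrow> bool" where
  "measS T f \<longleftrightarrow> (\<forall>k. (\<lambda>t. f t k) \<in> borel_measurable (lebesgue_on {0..T}))"

definition L1V :: "real \<Rightarrow> real \<Rightarrow> (real \<Rightarrow> vfield) \<Rightarrow> bool" where
  "L1V s T v \<longleftrightarrow> measV T v \<and> (AE t in lebesgue_on {0..T}. Vs s (v t)) \<and>
     (\<integral>\<^sup>+ t. ennreal (VsNorm s (v t)) \<partial>lebesgue_on {0..T}) < \<infinity>"

definition L2V :: "real \<Rightarrow> real \<Rightarrow> (real \<Rightarrow> vfield) \<Rightarrow> bool" where
  "L2V s T v \<longleftrightarrow> measV T v \<and> (AE t in lebesgue_on {0..T}. Vs s (v t)) \<and>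
     (\<integral>\<^sup>+ t. ennreal ((VsNorm s (v t))\<^sup>2) \<partial>lebesgue_on {0..T}) < \<infinity>"

definition LinfV :: "real \<Rightarrow> real \<Rightarrow> (real \<Rightarrow> vfield) \<Rightarrow> bool" where
  "LinfV s T v \<longleftrightarrow> measV T v \<and> (AE t in lebesgue_on {0..T}. Vs s (v t)) \<and>
     (\<exists>M. AE t in lebesgue_on {0..T}. VsNorm s (v t) \<le> M)"

definition L1H :: "real \<Rightarrow> real \<Rightarrow> (real \<Rightarrow> sfield) \<Rightarrow> bool" where
  "L1H s T f \<longleftrightarrow> measS T f \<and> (AE t in lebesgue_on {0..T}. Hs s (f t)) \<and>
     (\<integral>\<^sup>+ t. ennreal (HsNorm s (f t)) \<partial>lebesgue_on {0..T}) < \<infinity>"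

definition LinfH :: "real \<Rightarrow> real \<Rightarrow> (real \<Rightarrow> sfield) \<Rightarrow> bool" where
  "LinfH s T f \<longleftrightarrow> measS T f \<and> (AE t in lebesgue_on {0..T}. Hs s (f t)) \<and>
     (\<exists>M. AE t in lebesgue_on {0..T}. HsNorm s (f t) \<le> M)"

definition CV :: "real \<Rightarrow> real \<Rightarrow> (real \<Rightarrow> vfield) \<Rightarrow> bool" where
  "CV s T v \<longleftrightarrow> (\<forall>t\<in>{0..T}. Vs s (v t)) \<and>
     (\<forall>t\<in>{0..T}. ((\<lambda>\<tau>. VsNorm s (v \<tau> - v t)) \<longlongrightarrow> 0) (at t within {0..T}))"

definition CwV :: "real \<Rightarrow> (real \<Rightarrow> vfield) \<Rightarrow> bool" where
  "CwV T v \<longleftrightarrow> (\<forall>t\<in>{0..T}. Vs 0 (v t)) \<and>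
     (\<forall>w. Vs 0 w \<longrightarrow> continuous_on {0..T} (\<lambda>t. l2v (v t) w))"

definition CwH :: "real \<Rightarrow> (real \<Rightarrow> sfield) \<Rightarrow> bool" where
  "CwH T f \<longleftrightarrow> (\<forall>t\<in>{0..T}. Hs 0 (f t)) \<and>
     (\<forall>g. Hs 0 g \<longrightarrow> continuous_on {0..T} (\<lambda>t. l2s (f t) g))"

definition weak_solution ::
  "real \<Rightarrow> real \<Rightarrow> real \<Rightarrow> real \<Rightarrow> vfield \<Rightarrow> sfield \<Rightarrow> (real \<Rightarrow> vfield) \<Rightarrow> (real \<Rightarrow> sfield) \<Rightarrow> bool"
where
  "weak_solution \<nu> \<alpha> \<beta> T v0 \<theta>0 v \<theta> \<longleftrightarrow>
     LinfV 0 T v \<and> L2V \<beta> T v \<and> CwV T v \<and> LinfH 0 T \<theta> \<and> CwH T \<theta> \<and>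
     (\<forall>\<psi>. Vs (5/2) \<psi> \<longrightarrow> (\<forall>t\<in>{0..T}.
        l2v (v t) \<psi>
        - (LBINT s=0..t. l2v (Bop (LamV (-2 * \<alpha>) (v s)) \<psi>) (v s))
        + \<nu> * (LBINT s=0..t. l2v (LamV \<beta> (v s)) (LamV \<beta> \<psi>))
        = l2v v0 \<psi> + (LBINT s=0..t. l2v (theta_e3 (\<theta> s)) \<psi>))) \<and>
     (\<forall>\<phi>. Hs (5/2) \<phi> \<longrightarrow> (\<forall>t\<in>{0..T}.
        l2s (\<theta> t) \<phi>
        - (LBINT s=0..t. l2s (advS (LamV (-2 * \<alpha>) (v s)) \<phi>) (\<theta> s))
        = l2s \<theta>0 \<phi>))"

definition galerkin_solution ::
  "real \<Rightarrow> real \<Rightarrow> real \<Rightarrow> real \<Rightarrow> vfield \<Rightarrow> sfield \<Rightarrow> nat \<Rightarrow> (real \<Rightarrow> vfield) \<Rightarrow> (real \<Rightarrow> sfield) \<Rightarrow> bool"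
where
  "galerkin_solution \<nu> \<alpha> \<beta> T v0 \<theta>0 n vn \<theta>n \<longleftrightarrow>
     vn 0 = projV n v0 \<and> \<theta>n 0 = projS n \<theta>0 \<and>
     (\<forall>t\<in>{0..T}. projV n (vn t) = vn t \<and> projS n (\<theta>n t) = \<theta>n t) \<and>
     (\<forall>t\<in>{0..T}. \<forall>k.
        ((\<lambda>s. vn s k) has_vector_derivative
           (leray (theta_e3 (\<theta>n t)) k
            - projV n (Bop (LamV (-2 * \<alpha>) (vn t)) (vn t)) k
            - \<nu> *\<^sub>R LamV (2 * \<beta>) (vn t) k)) (at t within {0..T})) \<and>
     (\<forall>t\<in>{0..T}. \<forall>k.
        ((\<lambda>s. \<theta>n s k) has_vector_derivative
           (- projS n (advS (LamV (-2 * \<alpha>) (vn t)) (\<theta>n t)) k)) (at t within {0..T}))"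

end

theory Submission
  imports Defs
begin

text \<open>
  Write \<open>x\<^sub>k = |v\<^sub>k|\<close>. Testing the weak formulation with single Fourier modes shows that each
  coefficient \<open>v\<^sub>k\<close> is continuously differentiable, so that the energy identity for \<open>|v\<^sub>k|\<^sup>2\<close> holds
  exactly for the weak solution itself. Multiply it by \<open>\<mu>\<^sub>k\<^sup>2\<close> with \<open>\<mu>\<^sub>k = min(|k|, n)\<close> to the power
  \<open>\<beta>\<close> and sum: the energy \<open>E\<close> and the dissipation \<open>D\<close> are then finite for almost every time because
  \<open>v \<in> L\<^sup>2(V\<^sup>\<beta>)\<close>. In the transport term the three frequencies add up to zero, so the two largest are
  comparable; estimating according to which one is smallest, with a single Cauchy--Schwarz inequality
  and the growth of lattice sums, bounds it by
  \<open>\<parallel>v\<parallel>\<close> in \<open>V\<close> of order \<open>\<beta> - 1/2\<close> times \<open>\<parallel>\<mu>v\<parallel>\<close> of order \<open>1/2\<close> times \<open>\<parallel>\<mu>v\<parallel>\<close> of order \<open>\<beta>\<close>.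
  Splitting frequencies turns this into \<open>\<delta> D + C (1 + \<parallel>v\<parallel>\<^sup>2) E\<close>, the norm being that of \<open>V\<^sup>\<beta>\<close>, uniformly
  in \<open>n\<close>. Gronwall's inequality with the integrable kernel \<open>1 + \<parallel>v\<parallel>\<^sup>2\<close> and \<open>n \<rightarrow> \<infinity>\<close> give
  \<open>v \<in> L\<^sup>\<infinity>(V\<^sup>\<beta>)\<close> and \<open>v \<in> L\<^sup>2(V\<^sup>2\<^sup>\<beta>)\<close>. The same identity with \<open>\<mu>\<^sub>k\<close> the \<open>\<beta>\<close>-th power of \<open>|k|\<close>
  dominates the weighted \<open>|v\<^sub>k(t)|\<^sup>2\<close> by a summable sequence independent of \<open>t\<close>, whence continuity
  in \<open>V\<^sup>\<beta>\<close>.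
\<close>

section \<open>Lattice sums\<close>

text \<open>The obstacle is that the energy at level \<open>\<beta>\<close> and its dissipation may
  be infinite for a weak solution, and an infinite dissipation cannot be moved across an inequality.
  Truncating the weights, not the solution, keeps the equation intact: for fixed n the weights are
  bounded, so everything is finite, while their doubling constants do not depend on n. The relation
  \<open>\<alpha> + \<beta> = 5/4\<close> is critical. After the smallest frequency is singled out,
  the negative powers on it and on a larger frequency add up to 3/2, half the dimension, and the
  growth of lattice sums compensates this exactly, with no power to spare. With A0 a bound for the
  squared V^0 norm and B the squared V^\<beta> norm of v, frequency splitting reproduces the
  interpolated bound D^s ((1 + B) E)^(1 - s) with s = 1/2 + 1/(4 \<beta>), up to a factor depending
  on A0. Since s < 1 for \<open>\<beta> > 1/2\<close>, D can be absorbed, and B is left to the first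
  power, which is precisely what is integrable in time. Only the moduli of the coefficients enter
  the estimates, so these are sums of nonnegative terms in \<open>ennreal\<close>, where
  rearrangement needs no convergence proof.\<close>

lemma powr_square: "(x powr y)\<^sup>2 = x powr (2 * y)" for x y :: real
  by (simp add: power2_eq_square powr_add[symmetric])

lemma kn_norm: "kn k = norm (\<chi> i. real_of_int (k $ i))"
  by (simp add: kn_def norm_vec_def L2_set_def)

lemma kn_nonneg [simp]: "0 \<le> kn k"
  by (simp add: kn_norm)

lemma kn_zero_iff [simp]: "kn k = 0 \<longleftrightarrow> k = 0"
  by (simp add: kn_norm vec_eq_iff)

lemma kn_zero [simp]: "kn 0 = 0"
  by (simp add: kn_def)

lemma kn_minus [simp]: "kn (- k) = kn k"
  by (simp add: kn_def)

lemma kn_triangle: "kn (j + l) \<le> kn j + kn l"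
proof -
  have "(\<chi> i. real_of_int ((j + l) $ i)) = (\<chi> i. real_of_int (j $ i)) + (\<chi> i. real_of_int (l $ i))"
    by (simp add: vec_eq_iff)
  then show ?thesis unfolding kn_norm by (metis norm_triangle_ineq)
qed

lemma kn_ge_1: assumes "k \<noteq> 0" shows "1 \<le> kn k"
proof -
  obtain i where i: "k $ i \<noteq> 0" using assms by (auto simp: vec_eq_iff)
  have "1 \<le> \<bar>real_of_int (k $ i)\<bar>" using i by linarith
  also have "\<dots> \<le> kn k"
    using component_le_norm_cart[of "\<chi> i. real_of_int (k $ i)" i] by (simp add: kn_norm)
  finally show ?thesis .
qed

text \<open>The ball lies in a cube with 2 * floor R + 1 points on each side, which is at most 3 R
  for R >= 1; hence 27 = 3^3.\<close>

lemma kn_ball_card: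
  assumes R: "1 \<le> R"
  shows "finite {k. kn k \<le> R}" and "real (card {k. kn k \<le> R}) \<le> 27 * R ^ 3"
proof -
  define S where "S = {-\<lfloor>R\<rfloor>..\<lfloor>R\<rfloor>}"
  define P where "P = PiE (UNIV :: 3 set) (\<lambda>_. S)"
  have sub: "{k. kn k \<le> R} \<subseteq> vec_lambda ` P"
  proof
    fix k assume "k \<in> {k. kn k \<le> R}"
    then have "\<bar>real_of_int (k $ i)\<bar> \<le> R" for i
      using component_le_norm_cart[of "\<chi> i. real_of_int (k $ i)" i] by (simp add: kn_norm)
    then have "k $ i \<in> S" for i
      unfolding S_def by (simp add: abs_le_iff) (smt (verit, best) floor_mono floor_of_int le_floor_iff of_int_minus)
    then have "vec_nth k \<in> P" by (auto simp: P_def)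
    then show "k \<in> vec_lambda ` P" by (metis image_eqI vec_nth_inverse)
  qed
  have finP: "finite P" unfolding P_def S_def by (intro finite_PiE) auto
  show "finite {k. kn k \<le> R}" using finite_subset[OF sub] finP by blast
  have "card {k. kn k \<le> R} \<le> card P"
    using card_mono[OF finite_imageI[OF finP] sub] card_image_le[OF finP] by (meson order_trans)
  also have "card P = card S ^ 3" by (simp add: P_def card_PiE)
  finally have "real (card {k. kn k \<le> R}) \<le> real (card S) ^ 3"
    by (metis of_nat_le_iff of_nat_power)
  also have "real (card S) \<le> 3 * R" using R unfolding S_def by simp linarith
  then have "real (card S) ^ 3 \<le> (3 * R) ^ 3" by (intro power_mono) auto
  finally show "real (card {k. kn k \<le> R}) \<le> 27 * R ^ 3" by (simp add: power_mult_distrib)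
qed

lemma finite_kn_ball [simp]: "finite {k. kn k \<le> R}"
  by (rule finite_subset[OF _ kn_ball_card(1)[of "max 1 R"]]) auto

text \<open>Induction over dyadic scales: the shell between R/2 and R has at most 27 R^3 points of
  weight at most (R/2)^(-q), and the ball of radius R/2 is covered by the induction hypothesis. For
  q < 3 the inherited constant shrinks by the factor 2^(q - 3) < 1, so the recursion closes.\<close>

lemma lattice_sum_bound:
  assumes q: "0 \<le> q" "q < 3"
  obtains C where "0 \<le> C"
    and "\<And>R. (\<Sum>j | j \<noteq> 0 \<and> kn j \<le> R. kn j powr (- q)) \<le> C * R powr (3 - q)"
proof -
  have lt1: "2 powr (q - 3) < (1 :: real)" using q powr_less_mono[of "q - 3" 0 2] by simp
  \<comment> \<open>The fixed point of the recursion for the constant, as recorded in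
    \<open>Ceq\<close>.\<close>
  define C where "C = 27 * 2 powr q / (1 - 2 powr (q - 3))"
  have C0: "0 \<le> C" using lt1 by (simp add: C_def)
  have "1 - 2 powr (q - 3) \<noteq> 0" using lt1 by linarith
  then have "C * (1 - 2 powr (q - 3)) = 27 * 2 powr q"
    using C_def nonzero_divide_eq_eq by metis
  then have Ceq: "C * 2 powr (q - 3) + 27 * 2 powr q = C" by (simp add: right_diff_distrib)
  have step: "(\<Sum>j | j \<noteq> 0 \<and> kn j \<le> R. kn j powr (- q)) \<le> C * R powr (3 - q)"
    if "R < 2 ^ n" for R n
    using that
  proof (induction n arbitrary: R)
    case 0
    then have "\<not> (j \<noteq> 0 \<and> kn j \<le> R)" for j using kn_ge_1[of j] by auto
    then have e: "{j. j \<noteq> 0 \<and> kn j \<le> R} = {}" by blast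
    show ?case unfolding e using C0 by simp
  next
    case (Suc n)
    show ?case
    proof (cases "R < 1")
      case True
      then have "\<not> (j \<noteq> 0 \<and> kn j \<le> R)" for j using kn_ge_1[of j] by auto
      then have e: "{j. j \<noteq> 0 \<and> kn j \<le> R} = {}" by blast
      show ?thesis unfolding e using C0 by simp
    next
      case False
      then have R: "R \<ge> 1" by simp
      let ?A = "{j. j \<noteq> 0 \<and> kn j \<le> R/2}" and ?B = "{j. R/2 < kn j \<and> kn j \<le> R}"
      have fB: "finite ?B" by (rule finite_subset[OF _ finite_kn_ball[of R]]) auto
      have fA: "finite ?A" by (rule finite_subset[OF _ finite_kn_ball[of "R/2"]]) auto
      have eq: "{j. j \<noteq> 0 \<and> kn j \<le> R} = ?A \<union> ?B" using R by auto
      have dis: "?A \<inter> ?B = {}" by (auto simp: not_less)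
      have "(\<Sum>j | j \<noteq> 0 \<and> kn j \<le> R. kn j powr (- q)) =
          (\<Sum>j\<in>?A. kn j powr (- q)) + (\<Sum>j\<in>?B. kn j powr (- q))"
        unfolding eq by (rule sum.union_disjoint[OF fA fB dis])
      also have "(\<Sum>j\<in>?A. kn j powr (- q)) \<le> C * (R/2) powr (3 - q)"
        by (rule Suc.IH) (use Suc.prems in simp)
      also have "(\<Sum>j\<in>?B. kn j powr (- q)) \<le> real (card ?B) * (R/2) powr (- q)"
        using R q by (intro sum_bounded_above) (auto intro!: powr_mono2')
      also have "real (card ?B) \<le> real (card {k. kn k \<le> R})"
        by (intro of_nat_mono card_mono) auto
      also have "\<dots> \<le> 27 * R ^ 3" by (rule kn_ball_card(2)[OF R])
      finally have "(\<Sum>j | j \<noteq> 0 \<and> kn j \<le> R. kn j powr (- q)) \<le>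
          C * (R/2) powr (3 - q) + 27 * R ^ 3 * (R/2) powr (- q)"
        by (simp add: mult_right_mono)
      also have "(R/2) powr (3 - q) = R powr (3 - q) * 2 powr (q - 3)"
        using R by (simp add: powr_divide powr_diff field_simps)
      also have "R ^ 3 = R powr 3" using R by (simp add: powr_numeral)
      also have "(R/2) powr (- q) = R powr (- q) * 2 powr q"
        using R by (simp add: powr_divide powr_minus field_simps)
      also have "27 * R powr 3 * (R powr (- q) * 2 powr q) = 27 * 2 powr q * R powr (3 - q)"
        using R by (simp add: powr_diff powr_minus field_simps)
      finally have "(\<Sum>j | j \<noteq> 0 \<and> kn j \<le> R. kn j powr (- q)) \<le>
         (C * 2 powr (q - 3) + 27 * 2 powr q) * R powr (3 - q)" by (simp add: algebra_simps)
      then show ?thesis by (simp only: Ceq)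
    qed
  qed
  have "(\<Sum>j | j \<noteq> 0 \<and> kn j \<le> R. kn j powr (- q)) \<le> C * R powr (3 - q)" for R
  proof -
    obtain n where "R < 2 ^ n" using real_arch_pow[of 2 R] by auto
    then show ?thesis by (rule step)
  qed
  with C0 that show ?thesis by blast
qed

section \<open>A trilinear estimate\<close>

abbreviation lsum :: "('a \<Rightarrow> real) \<Rightarrow> ennreal" where
  "lsum f \<equiv> (\<integral>\<^sup>+ k. ennreal (f k) \<partial>count_space UNIV)"

lemma nn_integral_count_space_shift:
  fixes f :: "'a::ab_group_add \<Rightarrow> ennreal"
  shows "(\<integral>\<^sup>+ k. f (k + a) \<partial>count_space UNIV) = (\<integral>\<^sup>+ k. f k \<partial>count_space UNIV)"
  by (rule nn_integral_bij_count_space) (rule bij_plus_right)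

lemma nn_integral_count_space_reflect:
  fixes f :: "'a::ab_group_add \<Rightarrow> ennreal"
  shows "(\<integral>\<^sup>+ k. f (a - k) \<partial>count_space UNIV) = (\<integral>\<^sup>+ k. f k \<partial>count_space UNIV)"
  by (rule nn_integral_bij_count_space, rule bij_betw_byWitness[where f' = "\<lambda>k. a - k"]) auto

lemma nn_integral_count_space_swap:
  fixes f :: "'a::countable \<Rightarrow> 'b::countable \<Rightarrow> ennreal"
  shows "(\<integral>\<^sup>+ k. \<integral>\<^sup>+ j. f k j \<partial>count_space UNIV \<partial>count_space UNIV) =
         (\<integral>\<^sup>+ j. \<integral>\<^sup>+ k. f k j \<partial>count_space UNIV \<partial>count_space UNIV)"
  by (rule nn_integral_count_space_nn_integral) auto

text \<open>Cauchy-Schwarz on pairs (l, j): one factor is a_j c_(j+l), whose square sum separates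
  after a shift; the other collects b_l and all powers. There the sum of |j|^(-2p) over |j| <= |l|
  grows at most like |l|^(3-2p), because p < 3/2, and |l|^(-2q) cancels this exactly, because p + q
  = 3/2.\<close>

lemma trilinear_lattice_bound:
  assumes p: "0 \<le> p" "p < 3/2" and pq: "p + q = 3/2"
  obtains C where "0 \<le> C"
    and "\<And>a b c :: wvec \<Rightarrow> real. (\<And>k. 0 \<le> a k) \<Longrightarrow> (\<And>k. 0 \<le> b k) \<Longrightarrow> (\<And>k. 0 \<le> c k) \<Longrightarrow>
      (\<integral>\<^sup>+ l. lsum (\<lambda>j. of_bool (j \<noteq> 0 \<and> kn j \<le> kn l) * (kn j powr (- p) * a j) *
         (kn l powr (- q) * b l) * c (j + l)) \<partial>count_space UNIV)\<^sup>2
      \<le> ennreal C * lsum (\<lambda>k. (a k)\<^sup>2) * lsum (\<lambda>k. (b k)\<^sup>2) * lsum (\<lambda>k. (c k)\<^sup>2)"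
proof -
  obtain C where C0: "0 \<le> C"
    and C: "\<And>R. (\<Sum>j | j \<noteq> 0 \<and> kn j \<le> R. kn j powr (- (2 * p))) \<le> C * R powr (3 - 2 * p)"
    using lattice_sum_bound[of "2 * p"] p by auto
  have main: "(\<integral>\<^sup>+ l. lsum (\<lambda>j. of_bool (j \<noteq> 0 \<and> kn j \<le> kn l) * (kn j powr (- p) * a j) *
         (kn l powr (- q) * b l) * c (j + l)) \<partial>count_space UNIV)\<^sup>2
      \<le> ennreal C * lsum (\<lambda>k. (a k)\<^sup>2) * lsum (\<lambda>k. (b k)\<^sup>2) * lsum (\<lambda>k. (c k)\<^sup>2)"
    if a: "\<And>k. 0 \<le> a k" and b: "\<And>k. 0 \<le> b k" and c: "\<And>k. 0 \<le> c k" for a b c :: "wvec \<Rightarrow> real"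
  proof -
    define f where "f = (\<lambda>(l, j). ennreal (a j * c (j + l)))"
    define g where "g = (\<lambda>(l :: wvec, j).
      ennreal (of_bool (j \<noteq> 0 \<and> kn j \<le> kn l) * kn j powr (- p) * kn l powr (- q) * b l))"
    have fg: "ennreal (of_bool (j \<noteq> 0 \<and> kn j \<le> kn l) * (kn j powr (- p) * a j) *
         (kn l powr (- q) * b l) * c (j + l)) = f (l, j) * g (l, j)" for l j
      unfolding f_def g_def using a b c by (simp add: ennreal_mult'[symmetric] mult_ac)
    have "(\<integral>\<^sup>+ l. lsum (\<lambda>j. of_bool (j \<noteq> 0 \<and> kn j \<le> kn l) * (kn j powr (- p) * a j) *
         (kn l powr (- q) * b l) * c (j + l)) \<partial>count_space UNIV)
       = (\<integral>\<^sup>+ z. f z * g z \<partial>count_space UNIV)"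
      unfolding fg by (rule nn_integral_fst_count_space)
    then have "(\<integral>\<^sup>+ l. lsum (\<lambda>j. of_bool (j \<noteq> 0 \<and> kn j \<le> kn l) * (kn j powr (- p) * a j) *
         (kn l powr (- q) * b l) * c (j + l)) \<partial>count_space UNIV)\<^sup>2
       \<le> (\<integral>\<^sup>+ z. (f z)\<^sup>2 \<partial>count_space UNIV) * (\<integral>\<^sup>+ z. (g z)\<^sup>2 \<partial>count_space UNIV)"
      by (simp add: Cauchy_Schwarz_nn_integral)
    also have "(\<integral>\<^sup>+ z. (f z)\<^sup>2 \<partial>count_space UNIV) =
        (\<integral>\<^sup>+ j. \<integral>\<^sup>+ l. ennreal ((a j)\<^sup>2) * ennreal ((c (l + j))\<^sup>2) \<partial>count_space UNIV \<partial>count_space UNIV)"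
      by (subst nn_integral_snd_count_space[symmetric])
        (simp add: f_def a c ennreal_power ennreal_mult'[symmetric] power_mult_distrib add.commute)
    also have "\<dots> = lsum (\<lambda>k. (a k)\<^sup>2) * lsum (\<lambda>k. (c k)\<^sup>2)"
      by (simp add: nn_integral_cmult nn_integral_multc
        nn_integral_count_space_shift[where f = "\<lambda>k. ennreal ((c k)\<^sup>2)"])
    finally have fstep: "(\<integral>\<^sup>+ l. lsum (\<lambda>j. of_bool (j \<noteq> 0 \<and> kn j \<le> kn l) * (kn j powr (- p) * a j) *
         (kn l powr (- q) * b l) * c (j + l)) \<partial>count_space UNIV)\<^sup>2
       \<le> lsum (\<lambda>k. (a k)\<^sup>2) * lsum (\<lambda>k. (c k)\<^sup>2) * (\<integral>\<^sup>+ z. (g z)\<^sup>2 \<partial>count_space UNIV)" .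
    have "(\<integral>\<^sup>+ z. (g z)\<^sup>2 \<partial>count_space UNIV) =
        (\<integral>\<^sup>+ l. \<integral>\<^sup>+ j. (g (l, j))\<^sup>2 \<partial>count_space UNIV \<partial>count_space UNIV)"
      by (rule nn_integral_fst_count_space[symmetric])
    also have "\<dots> \<le> (\<integral>\<^sup>+ l. ennreal C * ennreal ((b l)\<^sup>2) \<partial>count_space UNIV)"
    proof (rule nn_integral_mono)
      fix l :: wvec
      let ?J = "{j. j \<noteq> 0 \<and> kn j \<le> kn l}"
      have fJ: "finite ?J" by (rule finite_subset[OF _ finite_kn_ball[of "kn l"]]) auto
      have "(\<integral>\<^sup>+ j. (g (l, j))\<^sup>2 \<partial>count_space UNIV) = (\<Sum>j\<in>?J. (g (l, j))\<^sup>2)"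
        using fJ by (rule nn_integral_count_space') (auto simp: g_def)
      also have "\<dots> = (\<Sum>j\<in>?J. ennreal (kn j powr (- (2 * p)) * (kn l powr (- (2 * q)) * (b l)\<^sup>2)))"
        by (rule sum.cong)
          (auto simp: g_def b ennreal_power power_mult_distrib powr_square mult_ac)
      also have "\<dots> = ennreal (\<Sum>j\<in>?J. kn j powr (- (2 * p)) * (kn l powr (- (2 * q)) * (b l)\<^sup>2))"
        by (rule sum_ennreal) auto
      also have "\<dots> = ennreal ((\<Sum>j\<in>?J. kn j powr (- (2 * p))) * (kn l powr (- (2 * q)) * (b l)\<^sup>2))"
        by (simp add: sum_distrib_right)
      also have "\<dots> \<le> ennreal (C * kn l powr (3 - 2 * p) * (kn l powr (- (2 * q)) * (b l)\<^sup>2))"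
        by (intro ennreal_leI mult_right_mono C) auto
      also have "\<dots> \<le> ennreal (C * (b l)\<^sup>2)"
      proof (intro ennreal_leI)
        have e: "3 - 2 * p = 2 * q" using pq by simp
        have "kn l powr (3 - 2 * p) * kn l powr (- (2 * q)) \<le> 1"
          unfolding e by (cases "l = 0") (auto simp: powr_minus)
        then have "C * (b l)\<^sup>2 * (kn l powr (3 - 2 * p) * kn l powr (- (2 * q))) \<le> C * (b l)\<^sup>2 * 1"
          using C0 by (intro mult_left_mono) auto
        then show "C * kn l powr (3 - 2 * p) * (kn l powr (- (2 * q)) * (b l)\<^sup>2) \<le> C * (b l)\<^sup>2"
          by (simp add: mult_ac)
      qed
      finally show "(\<integral>\<^sup>+ j. (g (l, j))\<^sup>2 \<partial>count_space UNIV) \<le> ennreal C * ennreal ((b l)\<^sup>2)"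
        using C0 by (simp add: ennreal_mult')
    qed
    also have "\<dots> = ennreal C * lsum (\<lambda>k. (b k)\<^sup>2)" by (simp add: nn_integral_cmult)
    finally have "lsum (\<lambda>k. (a k)\<^sup>2) * lsum (\<lambda>k. (c k)\<^sup>2) * (\<integral>\<^sup>+ z. (g z)\<^sup>2 \<partial>count_space UNIV)
       \<le> lsum (\<lambda>k. (a k)\<^sup>2) * lsum (\<lambda>k. (c k)\<^sup>2) * (ennreal C * lsum (\<lambda>k. (b k)\<^sup>2))"
      by (rule mult_left_mono) simp
    from order_trans[OF fstep this] show ?thesis by (simp only: mult_ac)
  qed
  show ?thesis using that[OF C0 main] by blast
qed

section \<open>The transport term\<close>

text \<open>A majorant for the k-th coefficient of the transport term, with x_k = |v_k|. The power
  of |j| turns v into u. The derivative costs |k| rather than |k - j| because u is divergence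
  free.\<close>

definition conv_bound :: "real \<Rightarrow> (wvec \<Rightarrow> real) \<Rightarrow> wvec \<Rightarrow> ennreal" where
  "conv_bound \<alpha> x k = lsum (\<lambda>j. kn k * (kn j powr (- 2 * \<alpha>) * x j * x (k - j)))"

text \<open>Covers both the truncated weights min(|k|, n)^\<open>\<beta>\<close> and the weight |k|^\<open>\<beta>\<close> itself.\<close>
definition sobolev_weight :: "real \<Rightarrow> (wvec \<Rightarrow> real) \<Rightarrow> bool" where
  "sobolev_weight \<beta> \<mu> \<longleftrightarrow> (\<forall>k. 0 \<le> \<mu> k) \<and> (\<forall>k. \<mu> (- k) = \<mu> k) \<and>
     (\<forall>k l. kn k \<le> 2 * kn l \<longrightarrow> \<mu> k \<le> 4 * \<mu> l) \<and>
     (\<forall>k. k \<noteq> 0 \<longrightarrow> 1 \<le> \<mu> k) \<and> (\<forall>k. \<mu> k \<le> kn k powr \<beta>)"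

text \<open>Distributes one full derivative over two comparable frequencies as B^(1-\<beta>)
  A^\<beta>. The case distinction is forced by the exponent \<open>1 - \<beta>\<close> changing sign
  at 1; each case uses one of the two comparability hypotheses.\<close>

lemma powr_comparable:
  fixes A B \<beta> :: real
  assumes "0 < A" "0 < B" "A \<le> 2 * B" "B \<le> 2 * A" "1/2 < \<beta>" "\<beta> < 5/4"
  shows "A \<le> 2 * (B powr (1 - \<beta>) * A powr \<beta>)"
proof -
  have "(A / B) powr (1 - \<beta>) \<le> 2"
  proof (cases "\<beta> \<le> 1")
    case True
    have "(A / B) powr (1 - \<beta>) \<le> 2 powr (1 - \<beta>)"
      using assms True by (intro powr_mono2) (auto simp: field_simps)
    also have "\<dots> \<le> 2 powr 1" using assms by (intro powr_mono) auto
    finally show ?thesis by simp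
  next
    case False
    have "(A / B) powr (1 - \<beta>) = (B / A) powr (\<beta> - 1)"
      using assms by (simp add: powr_divide powr_diff field_simps)
    also have "\<dots> \<le> 2 powr (\<beta> - 1)"
      using assms False by (intro powr_mono2) (auto simp: field_simps)
    also have "\<dots> \<le> 2 powr 1" using assms by (intro powr_mono) auto
    finally show ?thesis by simp
  qed
  then have "A powr (1 - \<beta>) \<le> 2 * B powr (1 - \<beta>)"
    using assms by (simp add: powr_divide field_simps)
  then have "A powr (1 - \<beta>) * A powr \<beta> \<le> 2 * B powr (1 - \<beta>) * A powr \<beta>"
    by (intro mult_right_mono) auto
  then show ?thesis using assms by (simp add: powr_add[symmetric] mult_ac)
qed

context
  fixes \<alpha> \<beta> :: real and x \<mu> :: "wvec \<Rightarrow> real"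
  assumes beta: "1/2 < \<beta>" "\<beta> < 5/4" and alpha: "\<alpha> + \<beta> = 5/4"
    and x_nonneg: "\<And>k. 0 \<le> x k" and x_even: "\<And>k. x (- k) = x k" and x_zero: "x 0 = 0"
    and wt: "sobolev_weight \<beta> \<mu>"
begin

private lemma mu: "0 \<le> \<mu> k" "\<mu> (- k) = \<mu> k" "kn k \<le> 2 * kn l \<Longrightarrow> \<mu> k \<le> 4 * \<mu> l"
  "k \<noteq> 0 \<Longrightarrow> 1 \<le> \<mu> k" "\<mu> k \<le> kn k powr \<beta>"
  using wt by (auto simp: sobolev_weight_def)

text \<open>Here m is the smallest of three frequencies that add up to zero up to signs. The factors
  are grouped to fit \<open>trilinear_lattice_bound\<close> with p = 2 - \<beta> and q = \<beta> -
  1/2; the three inner groups become the factors of orders \<beta> - 1/2, 1/2 and \<beta> of the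
  final estimate.\<close>

private definition "Th m M N = of_bool (m \<noteq> 0 \<and> kn m \<le> kn M) *
   (kn m powr (- (2 - \<beta>)) * (kn m powr (\<beta> - 1/2) * x m)) *
   (kn M powr (- (\<beta> - 1/2)) * (kn M powr (1/2) * \<mu> M * x M)) * (kn N powr \<beta> * \<mu> N * x N)"

private lemma Th_nonneg: "0 \<le> Th m M N"
  unfolding Th_def using x_nonneg mu by (intro mult_nonneg_nonneg) auto

text \<open>Criticality enters here: \<open>\<alpha> + \<beta> = 5/4\<close> is what makes -2
  \<alpha> equal to -(2 - \<beta>) + (\<beta> - 1/2).\<close>

private lemma Th_eq: assumes "m \<noteq> 0" "kn m \<le> kn M" "M \<noteq> 0"
  shows "Th m M N = kn m powr (- 2 * \<alpha>) * (kn M powr (1 - \<beta>) * kn N powr \<beta>) *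
    (\<mu> M * \<mu> N) * (x m * x M * x N)"
proof -
  have e: "kn m powr (- 2 * \<alpha>) = kn m powr (- (2 - \<beta>)) * kn m powr (\<beta> - 1/2)"
  proof -
    have "- 2 * \<alpha> = - (2 - \<beta>) + (\<beta> - 1/2)" using alpha by simp
    then show ?thesis by (simp only: powr_add)
  qed
  have e2: "kn M powr (1 - \<beta>) = kn M powr (- (\<beta> - 1/2)) * kn M powr (1/2)"
    by (simp add: powr_add[symmetric])
  show ?thesis unfolding Th_def e e2 using assms by simp
qed

text \<open>The constant is 32 = 16 * 2, with 16 from doubling both weights and 2 from
  \<open>powr_comparable\<close>. The smoothed frequency j need not be the smallest one: since
  \<open>\<alpha>\<close> is positive, passing from |j| to |m| only enlarges the negative
  power.\<close>

private lemma pointwise_aux: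
  assumes m: "m \<noteq> 0" "M \<noteq> 0" "N \<noteq> 0" and mM: "kn m \<le> kn M" "kn m \<le> kn N" "kn N \<le> 2 * kn M" "kn M \<le> 2 * kn N"
    and P: "P \<le> kn N" "0 \<le> P" and j: "kn m \<le> kn j" and nu: "(\<mu> k)\<^sup>2 \<le> 16 * (\<mu> M * \<mu> N)"
    and X: "X = x m * x M * x N"
  shows "(\<mu> k)\<^sup>2 * P * kn j powr (- 2 * \<alpha>) * X \<le> 32 * Th m M N"
proof -
  have pos: "0 < kn m" "0 < kn M" "0 < kn N" using m kn_ge_1 by (smt (verit))+
  have a: "kn j powr (- 2 * \<alpha>) \<le> kn m powr (- 2 * \<alpha>)"
    using alpha beta pos j by (intro powr_mono2') auto
  have "P \<le> 2 * (kn M powr (1 - \<beta>) * kn N powr \<beta>)"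
    using powr_comparable[of "kn N" "kn M" \<beta>] pos mM beta P by auto
  then have "(\<mu> k)\<^sup>2 * P * kn j powr (- 2 * \<alpha>) * X \<le>
     (16 * (\<mu> M * \<mu> N)) * (2 * (kn M powr (1 - \<beta>) * kn N powr \<beta>)) * kn m powr (- 2 * \<alpha>) * X"
    using x_nonneg mu P a nu unfolding X by (intro mult_mono mult_nonneg_nonneg) auto
  also have "\<dots> = 32 * Th m M N" using m mM by (simp add: Th_eq X)
  finally show ?thesis .
qed

text \<open>By the triangle inequality the largest of |j|, |l|, |k| is at most twice the middle one,
  so the two that are not minimal are comparable. The summands on the right are the cases of the
  minimum at j, at l and at k; adding all three spares a case distinction in the sums.\<close>

private lemma pointwise:
  assumes k: "k = j + l"
  shows "(\<mu> k)\<^sup>2 * x k * (kn k * (kn j powr (- 2 * \<alpha>) * x j * x l))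
    \<le> 32 * (Th j l k + Th l j k + Th k j l)"
proof (cases "j = 0 \<or> l = 0 \<or> k = 0")
  case True
  then have "(\<mu> k)\<^sup>2 * x k * (kn k * (kn j powr (- 2 * \<alpha>) * x j * x l)) = 0" using x_zero by auto
  then show ?thesis using Th_nonneg by (metis add_nonneg_nonneg mult_nonneg_nonneg zero_le_numeral)
next
  case False
  have t: "kn k \<le> kn j + kn l" unfolding k by (rule kn_triangle)
  have t2: "kn j \<le> kn k + kn l" using kn_triangle[of k "- l"] by (simp add: k)
  have t3: "kn l \<le> kn k + kn j" using kn_triangle[of k "- j"] by (simp add: k)
  have mm: "(\<mu> k)\<^sup>2 \<le> 16 * (\<mu> a * \<mu> b)" if "kn k \<le> 2 * kn a" "kn k \<le> 2 * kn b" for a b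
  proof -
    have "\<mu> k * \<mu> k \<le> (4 * \<mu> a) * (4 * \<mu> b)"
      using mu that by (intro mult_mono) auto
    then show ?thesis by (simp add: power2_eq_square)
  qed
  have eq: "(\<mu> k)\<^sup>2 * x k * (kn k * (kn j powr (- 2 * \<alpha>) * x j * x l)) =
      (\<mu> k)\<^sup>2 * kn k * kn j powr (- 2 * \<alpha>) * (x j * x l * x k)" by simp
  consider "kn j \<le> kn l" "kn j \<le> kn k" | "kn l \<le> kn j" "kn l \<le> kn k" | "kn k \<le> kn j" "kn k \<le> kn l"
    by linarith
  then show ?thesis
  proof cases
    case 1
    have "(\<mu> k)\<^sup>2 * kn k * kn j powr (- 2 * \<alpha>) * (x j * x l * x k) \<le> 32 * Th j l k"
      by (rule pointwise_aux) (use False 1 t t2 t3 in \<open>auto intro!: mm\<close>)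
    then show ?thesis unfolding eq using Th_nonneg[of l j k] Th_nonneg[of k j l] by simp
  next
    case 2
    have "(\<mu> k)\<^sup>2 * kn k * kn j powr (- 2 * \<alpha>) * (x j * x l * x k) \<le> 32 * Th l j k"
      by (rule pointwise_aux) (use False 2 t t2 t3 in \<open>auto intro!: mm\<close>)
    then show ?thesis unfolding eq using Th_nonneg[of j l k] Th_nonneg[of k j l] by simp
  next
    case 3
    have "(\<mu> k)\<^sup>2 * kn k * kn j powr (- 2 * \<alpha>) * (x j * x l * x k) \<le> 32 * Th k j l"
      by (rule pointwise_aux) (use False 3 t t2 t3 in \<open>auto intro!: mm\<close>)
    then show ?thesis unfolding eq using Th_nonneg[of j l k] Th_nonneg[of l j k] by simp
  qed
qed

private definition "Q = (\<integral>\<^sup>+ l. lsum (\<lambda>j. Th j l (j + l)) \<partial>count_space UNIV)"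

private lemma Th1: "(\<integral>\<^sup>+ k. lsum (\<lambda>j. Th j (k - j) k) \<partial>count_space UNIV) = Q"
proof -
  have "(\<integral>\<^sup>+ k. lsum (\<lambda>j. Th j (k - j) k) \<partial>count_space UNIV) =
     (\<integral>\<^sup>+ j. lsum (\<lambda>k. Th j (k - j) k) \<partial>count_space UNIV)"
    by (rule nn_integral_count_space_swap)
  also have "\<dots> = (\<integral>\<^sup>+ j. lsum (\<lambda>k. Th j k (j + k)) \<partial>count_space UNIV)"
  proof (rule nn_integral_cong)
    fix j
    show "lsum (\<lambda>k. Th j (k - j) k) = lsum (\<lambda>k. Th j k (j + k))"
      using nn_integral_count_space_shift[where f = "\<lambda>k. ennreal (Th j (k - j) k)" and a = j]
      by (simp add: add.commute)
  qed
  finally show ?thesis unfolding Q_def by (subst nn_integral_count_space_swap)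
qed

private lemma Th2: "(\<integral>\<^sup>+ k. lsum (\<lambda>j. Th (k - j) j k) \<partial>count_space UNIV) = Q"
proof -
  have "lsum (\<lambda>j. Th (k - j) j k) = lsum (\<lambda>j. Th j (k - j) k)" for k
    using nn_integral_count_space_reflect[where f = "\<lambda>j. ennreal (Th (k - j) j k)" and a = k] by simp
  then show ?thesis using Th1 by simp
qed

text \<open>With the minimum at the output frequency k, the relation k = j + l has to be read as k +
  (-j) = l. Reflecting j brings this to the form of \<open>Q\<close>; the summand is even in its
  middle argument since the moduli of a real field and the weights are even.\<close>

private lemma Th3: "(\<integral>\<^sup>+ k. lsum (\<lambda>j. Th k j (k - j)) \<partial>count_space UNIV) = Q"
proof -
  have ev: "Th k (- j) N = Th k j N" for k j N by (simp add: Th_def x_even mu)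
  have "lsum (\<lambda>j. Th k j (k - j)) = lsum (\<lambda>j. Th k j (k + j))" for k
    using nn_integral_count_space_reflect[where f = "\<lambda>j. ennreal (Th k j (k - j))" and a = 0]
    by (simp add: ev)
  then show ?thesis unfolding Q_def by (subst nn_integral_count_space_swap) simp
qed

private lemma transport_le_Q:
  "(\<integral>\<^sup>+ k. ennreal ((\<mu> k)\<^sup>2 * x k) * conv_bound \<alpha> x k \<partial>count_space UNIV) \<le> 96 * Q"
proof -
  have "(\<integral>\<^sup>+ k. ennreal ((\<mu> k)\<^sup>2 * x k) * conv_bound \<alpha> x k \<partial>count_space UNIV) =
    (\<integral>\<^sup>+ k. lsum (\<lambda>j. (\<mu> k)\<^sup>2 * x k * (kn k * (kn j powr (- 2 * \<alpha>) * x j * x (k - j)))) \<partial>count_space UNIV)"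
    unfolding conv_bound_def
    by (subst nn_integral_cmult[symmetric]) (auto simp: ennreal_mult' x_nonneg)
  also have "\<dots> \<le> (\<integral>\<^sup>+ k. lsum (\<lambda>j. 32 * (Th j (k - j) k + Th (k - j) j k + Th k j (k - j))) \<partial>count_space UNIV)"
    by (intro nn_integral_mono ennreal_leI pointwise) auto
  also have "\<dots> = (\<integral>\<^sup>+ k. 32 * (lsum (\<lambda>j. Th j (k - j) k) + lsum (\<lambda>j. Th (k - j) j k) +
       lsum (\<lambda>j. Th k j (k - j))) \<partial>count_space UNIV)"
    by (simp add: ennreal_mult' nn_integral_cmult nn_integral_add Th_nonneg)
  also have "\<dots> = 32 * (Q + Q + Q)"
    by (simp add: nn_integral_cmult nn_integral_add Th1 Th2 Th3)
  also have "\<dots> = (32 + 32 + 32) * Q" by (simp only: distrib_left distrib_right)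
  also have "\<dots> = 96 * Q" by simp
  finally show ?thesis .
qed

lemma transport_le_trilinear:
  "(\<integral>\<^sup>+ k. ennreal ((\<mu> k)\<^sup>2 * x k) * conv_bound \<alpha> x k \<partial>count_space UNIV) \<le>
   96 * (\<integral>\<^sup>+ l. lsum (\<lambda>j. of_bool (j \<noteq> 0 \<and> kn j \<le> kn l) *
     (kn j powr (- (2 - \<beta>)) * (kn j powr (\<beta> - 1/2) * x j)) *
     (kn l powr (- (\<beta> - 1/2)) * (kn l powr (1/2) * \<mu> l * x l)) *
     (kn (j + l) powr \<beta> * \<mu> (j + l) * x (j + l))) \<partial>count_space UNIV)"
  using transport_le_Q unfolding Q_def Th_def .

end

text \<open>The lattice bound is used with p = 2 - \<beta>, and p < 3/2 is exactly
  \<open>\<beta> > 1/2\<close>. Keeping the square on the left avoids roots of possibly infinite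
  sums.\<close>

lemma transport_square_le:
  fixes \<alpha> \<beta> :: real
  assumes beta: "1/2 < \<beta>" "\<beta> < 5/4" and alpha: "\<alpha> + \<beta> = 5/4"
  obtains C where "0 \<le> C"
    and "\<And>x \<mu>. (\<And>k. 0 \<le> x k) \<Longrightarrow> (\<And>k. x (- k) = x k) \<Longrightarrow> x 0 = 0 \<Longrightarrow> sobolev_weight \<beta> \<mu> \<Longrightarrow>
      (\<integral>\<^sup>+ k. ennreal ((\<mu> k)\<^sup>2 * x k) * conv_bound \<alpha> x k \<partial>count_space UNIV)\<^sup>2 \<le>
        ennreal C * lsum (\<lambda>k. kn k powr (2 * \<beta> - 1) * (x k)\<^sup>2) * lsum (\<lambda>k. kn k * (\<mu> k * x k)\<^sup>2)
          * lsum (\<lambda>k. kn k powr (2 * \<beta>) * (\<mu> k * x k)\<^sup>2)"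
proof -
  obtain C where C0: "0 \<le> C"
    and C: "\<And>a b c :: wvec \<Rightarrow> real. (\<And>k. 0 \<le> a k) \<Longrightarrow> (\<And>k. 0 \<le> b k) \<Longrightarrow> (\<And>k. 0 \<le> c k) \<Longrightarrow>
      (\<integral>\<^sup>+ l. lsum (\<lambda>j. of_bool (j \<noteq> 0 \<and> kn j \<le> kn l) * (kn j powr (- (2 - \<beta>)) * a j) *
         (kn l powr (- (\<beta> - 1/2)) * b l) * c (j + l)) \<partial>count_space UNIV)\<^sup>2
      \<le> ennreal C * lsum (\<lambda>k. (a k)\<^sup>2) * lsum (\<lambda>k. (b k)\<^sup>2) * lsum (\<lambda>k. (c k)\<^sup>2)"
    by (rule trilinear_lattice_bound[of "2 - \<beta>" "\<beta> - 1/2"]) (use beta in auto)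
  have "(\<integral>\<^sup>+ k. ennreal ((\<mu> k)\<^sup>2 * x k) * conv_bound \<alpha> x k \<partial>count_space UNIV)\<^sup>2 \<le>
        ennreal (9216 * C) * lsum (\<lambda>k. kn k powr (2 * \<beta> - 1) * (x k)\<^sup>2) * lsum (\<lambda>k. kn k * (\<mu> k * x k)\<^sup>2)
          * lsum (\<lambda>k. kn k powr (2 * \<beta>) * (\<mu> k * x k)\<^sup>2)"
    if x: "\<And>k. 0 \<le> x k" "\<And>k. x (- k) = x k" "x 0 = 0" and wt: "sobolev_weight \<beta> \<mu>" for x \<mu>
  proof -
    have mu: "0 \<le> \<mu> k" for k using wt by (simp add: sobolev_weight_def)
    let ?Q = "\<integral>\<^sup>+ l. lsum (\<lambda>j. of_bool (j \<noteq> 0 \<and> kn j \<le> kn l) *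
     (kn j powr (- (2 - \<beta>)) * (kn j powr (\<beta> - 1/2) * x j)) *
     (kn l powr (- (\<beta> - 1/2)) * (kn l powr (1/2) * \<mu> l * x l)) *
     (kn (j + l) powr \<beta> * \<mu> (j + l) * x (j + l))) \<partial>count_space UNIV"
    have 1: "(kn k powr (\<beta> - 1/2) * x k)\<^sup>2 = kn k powr (2 * \<beta> - 1) * (x k)\<^sup>2" for k
      by (simp add: power_mult_distrib powr_square algebra_simps)
    have 2: "(kn k powr (1/2) * \<mu> k * x k)\<^sup>2 = kn k * (\<mu> k * x k)\<^sup>2" for k
      by (simp add: power_mult_distrib powr_square)
    have 3: "(kn k powr \<beta> * \<mu> k * x k)\<^sup>2 = kn k powr (2 * \<beta>) * (\<mu> k * x k)\<^sup>2" for k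
      by (simp add: power_mult_distrib powr_square)
    have "?Q\<^sup>2 \<le> ennreal C * lsum (\<lambda>k. (kn k powr (\<beta> - 1/2) * x k)\<^sup>2) *
        lsum (\<lambda>k. (kn k powr (1/2) * \<mu> k * x k)\<^sup>2) * lsum (\<lambda>k. (kn k powr \<beta> * \<mu> k * x k)\<^sup>2)"
      by (rule C) (use x mu in auto)
    then have Q: "?Q\<^sup>2 \<le> ennreal C * lsum (\<lambda>k. kn k powr (2 * \<beta> - 1) * (x k)\<^sup>2) *
        lsum (\<lambda>k. kn k * (\<mu> k * x k)\<^sup>2) * lsum (\<lambda>k. kn k powr (2 * \<beta>) * (\<mu> k * x k)\<^sup>2)"
      unfolding 1 2 3 .
    have "(\<integral>\<^sup>+ k. ennreal ((\<mu> k)\<^sup>2 * x k) * conv_bound \<alpha> x k \<partial>count_space UNIV)\<^sup>2 \<le> (96 * ?Q)\<^sup>2"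
      by (intro power_mono transport_le_trilinear beta alpha x wt) auto
    also have "\<dots> = 9216 * ?Q\<^sup>2" by (simp add: power_mult_distrib)
    also have "\<dots> \<le> 9216 * (ennreal C * lsum (\<lambda>k. kn k powr (2 * \<beta> - 1) * (x k)\<^sup>2) *
        lsum (\<lambda>k. kn k * (\<mu> k * x k)\<^sup>2) * lsum (\<lambda>k. kn k powr (2 * \<beta>) * (\<mu> k * x k)\<^sup>2))"
      by (rule mult_left_mono[OF Q]) simp
    finally show ?thesis using C0 by (simp add: ennreal_mult' mult.assoc)
  qed
  then show ?thesis using that[of "9216 * C"] C0 by auto
qed

section \<open>Absorbing the transport term into the dissipation\<close>

lemma lsum_le_add:
  assumes "\<And>k. f k \<le> a * g k + b * h k" "0 \<le> a" "0 \<le> b" "\<And>k. 0 \<le> g k" "\<And>k. 0 \<le> h k"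
  shows "lsum f \<le> ennreal a * lsum g + ennreal b * lsum h"
proof -
  have "lsum f \<le> lsum (\<lambda>k. a * g k + b * h k)"
    by (intro nn_integral_mono ennreal_leI assms)
  also have "\<dots> = ennreal a * lsum g + ennreal b * lsum h"
    using assms by (simp add: ennreal_mult' nn_integral_add nn_integral_cmult)
  finally show ?thesis .
qed

text \<open>Splitting the frequencies at \<open>K\<close> replaces the interpolation inequalities between Sobolev norms.\<close>
lemma powr_split:
  fixes y K :: real
  assumes "0 < y" "0 < K" "0 \<le> p" "p \<le> q"
  shows "y powr p \<le> K powr p + K powr (p - q) * y powr q"
proof (cases "y \<le> K")
  case True
  then have "y powr p \<le> K powr p" using assms by (intro powr_mono2) auto
  then show ?thesis by (simp add: add_increasing2)
next
  case False
  have "y powr p = y powr (p - q) * y powr q" by (simp add: powr_add[symmetric])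
  also have "\<dots> \<le> K powr (p - q) * y powr q"
    using assms False by (intro mult_right_mono powr_mono2') auto
  finally show ?thesis by (simp add: add_increasing)
qed

text \<open>Replaces Young's inequality with fractional exponents. A and B are the squared norms of
  v in V^0 and V^\<beta>. The choice K^(2\<beta>) = 1 + B makes both parts of the first factor at
  most a constant times K^(2\<beta>-1). Cutting the second factor at \<open>\<rho> * K\<close>
  instead of \<open>K\<close> puts \<rho>^(1-2\<beta>) in front of D, which is small for large
  \<rho> because \<open>\<beta> > 1/2\<close>; the price is a factor \<rho> in front of E.\<close>

lemma absorb_quadratic:
  fixes T A B E D C A0 \<delta> s \<beta> K \<rho> :: real
  assumes nn: "0 \<le> T" "0 \<le> A" "A \<le> A0" "0 \<le> B" "0 \<le> E" "0 \<le> D" "0 \<le> C" "0 < \<delta>" "0 < \<rho>"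
    and \<beta>: "1/2 < \<beta>"
    and K: "K = (1 + B) powr (1 / (2 * \<beta>))"
    and \<rho>: "C * (A0 + 1) * \<rho> powr (1 - 2 * \<beta>) \<le> \<delta>\<^sup>2"
    and T: "T\<^sup>2 \<le> C * (K powr (2 * \<beta> - 1) * A + K powr (- 1) * B) *
        (\<rho> * K * E + (\<rho> * K) powr (1 - 2 * \<beta>) * D) * D"
  shows "T \<le> \<delta> * D + C * (A0 + 1) * \<rho> / \<delta> * (1 + B) * E"
proof -
  have K1: "1 \<le> K" unfolding K using nn \<beta> by (intro ge_one_powr_ge_zero) auto
  have KB: "K powr (2 * \<beta>) = 1 + B" unfolding K using nn \<beta> by (simp add: powr_powr)
  have A0: "0 \<le> A0" using nn by simp
  have k1: "K powr (2 * \<beta> - 1) * K = 1 + B"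
    using K1 KB powr_add[of K "2 * \<beta> - 1" 1] by simp
  have k2: "K powr (2 * \<beta> - 1) * (\<rho> * K) powr (1 - 2 * \<beta>) = \<rho> powr (1 - 2 * \<beta>)"
    using K1 nn powr_add[of K "2 * \<beta> - 1" "1 - 2 * \<beta>"] by (simp add: powr_mult)
  have k3: "K powr (- 1) * K = 1" using K1 by (simp add: powr_minus)
  let ?r = "\<rho> powr (1 - 2 * \<beta>)"
  \<comment> \<open>The quotient B / (1 + B) is at most 1; the summand 1 in \<open>K\<close> also
    keeps \<open>K\<close> positive when B = 0.\<close>
  have k4: "K powr (- 1) * (\<rho> * K) powr (1 - 2 * \<beta>) * B \<le> \<rho> powr (1 - 2 * \<beta>)"
  proof -
    have "K powr (- 1) * (\<rho> * K) powr (1 - 2 * \<beta>) = \<rho> powr (1 - 2 * \<beta>) / K powr (2 * \<beta>)"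
    proof -
      have "K powr (- 1) * K powr (1 - 2 * \<beta>) = 1 / K powr (2 * \<beta>)"
        by (simp only: powr_add[symmetric] powr_minus_divide[symmetric]) simp
      moreover have "(\<rho> * K) powr (1 - 2 * \<beta>) = ?r * K powr (1 - 2 * \<beta>)"
        using K1 nn by (simp add: powr_mult)
      ultimately show ?thesis by (simp only: mult_ac) (simp add: mult.assoc[symmetric])
    qed
    then have "K powr (- 1) * (\<rho> * K) powr (1 - 2 * \<beta>) * B = ?r * (B / (1 + B))"
      unfolding KB by simp
    also have "\<dots> \<le> ?r * 1" using nn by (intro mult_left_mono) auto
    finally show ?thesis by simp
  qed
  have "(K powr (2 * \<beta> - 1) * A + K powr (- 1) * B) * (\<rho> * K * E + (\<rho> * K) powr (1 - 2 * \<beta>) * D) =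
     \<rho> * (K powr (2 * \<beta> - 1) * K) * A * E + (K powr (2 * \<beta> - 1) * (\<rho> * K) powr (1 - 2 * \<beta>)) * A * D
     + \<rho> * (K powr (- 1) * K) * B * E + K powr (- 1) * (\<rho> * K) powr (1 - 2 * \<beta>) * B * D"
    by (simp add: algebra_simps)
  also have "\<dots> = \<rho> * (1 + B) * A * E + ?r * A * D + \<rho> * B * E
      + K powr (- 1) * (\<rho> * K) powr (1 - 2 * \<beta>) * B * D"
    unfolding k1 k2 k3 by simp
  also have "\<dots> \<le> \<rho> * (1 + B) * A0 * E + ?r * A0 * D + \<rho> * (1 + B) * E + ?r * D"
    using nn A0 by (intro add_mono mult_right_mono[OF k4] mult_right_mono mult_left_mono) auto
  also have "\<dots> = (A0 + 1) * (\<rho> * (1 + B) * E + ?r * D)" by (simp add: algebra_simps)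
  finally have prod: "(K powr (2 * \<beta> - 1) * A + K powr (- 1) * B) *
      (\<rho> * K * E + (\<rho> * K) powr (1 - 2 * \<beta>) * D) \<le> (A0 + 1) * (\<rho> * (1 + B) * E + ?r * D)" .
  have "T\<^sup>2 \<le> C * ((A0 + 1) * (\<rho> * (1 + B) * E + ?r * D)) * D"
    using order_trans[OF T] mult_right_mono[OF mult_left_mono[OF prod nn(7)] nn(6)]
    by (simp only: mult.assoc)
  also have "\<dots> = (C * (A0 + 1) * ?r) * D\<^sup>2 + C * (A0 + 1) * \<rho> * (1 + B) * E * D"
    by (simp add: algebra_simps power2_eq_square)
  also have "\<dots> \<le> \<delta>\<^sup>2 * D\<^sup>2 + C * (A0 + 1) * \<rho> * (1 + B) * E * D"
    by (intro add_right_mono mult_right_mono[OF \<rho>]) auto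
  \<comment> \<open>Completing the square: the division by \<open>\<delta>\<close> in the second
    term makes the cross product exactly the mixed term E * D, and the square needs it
    twice.\<close>
  also have "\<dots> \<le> (\<delta> * D)\<^sup>2 + 2 * (C * (A0 + 1) * \<rho> * (1 + B) * E * D) + (C * (A0 + 1) * \<rho> / \<delta> * (1 + B) * E)\<^sup>2"
    using nn A0 by (simp add: power_mult_distrib)
  also have "\<dots> = (\<delta> * D + C * (A0 + 1) * \<rho> / \<delta> * (1 + B) * E)\<^sup>2"
    using nn by (simp add: power2_sum field_simps power2_eq_square)
  finally show ?thesis by (rule power2_le_imp_le) (use nn A0 in auto)
qed


lemma ennreal_poly:
  assumes "0 \<le> C" "0 \<le> a" "0 \<le> A" "0 \<le> b" "0 \<le> B" "0 \<le> c" "0 \<le> E" "0 \<le> d" "0 \<le> D"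
  shows "ennreal C * (ennreal a * ennreal A + ennreal b * ennreal B) *
    (ennreal c * ennreal E + ennreal d * ennreal D) * ennreal D =
    ennreal (C * (a * A + b * B) * (c * E + d * D) * D)"
  using assms by (simp add: ennreal_mult' ennreal_plus)

lemma nonlinear_estimate:
  fixes \<alpha> \<beta> \<delta> A0 :: real
  assumes beta: "1/2 < \<beta>" "\<beta> < 5/4" and alpha: "\<alpha> + \<beta> = 5/4" and pos: "0 < \<delta>" "0 \<le> A0"
  obtains M where "0 \<le> M"
    and "\<And>x \<mu>. (\<And>k. 0 \<le> x k) \<Longrightarrow> (\<And>k. x (- k) = x k) \<Longrightarrow> x 0 = 0 \<Longrightarrow> sobolev_weight \<beta> \<mu> \<Longrightarrow>
      lsum (\<lambda>k. (x k)\<^sup>2) \<le> ennreal A0 \<Longrightarrow>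
      (\<integral>\<^sup>+ k. ennreal ((\<mu> k)\<^sup>2 * x k) * conv_bound \<alpha> x k \<partial>count_space UNIV) \<le>
        ennreal \<delta> * lsum (\<lambda>k. kn k powr (2 * \<beta>) * (\<mu> k * x k)\<^sup>2) +
        ennreal M * (1 + lsum (\<lambda>k. kn k powr (2 * \<beta>) * (x k)\<^sup>2)) * lsum (\<lambda>k. (\<mu> k * x k)\<^sup>2)"
proof -
  obtain C where C0: "0 \<le> C" and C: "\<And>x \<mu>. (\<And>k. 0 \<le> x k) \<Longrightarrow> (\<And>k. x (- k) = x k) \<Longrightarrow> x 0 = 0 \<Longrightarrow>
      sobolev_weight \<beta> \<mu> \<Longrightarrow>
      (\<integral>\<^sup>+ k. ennreal ((\<mu> k)\<^sup>2 * x k) * conv_bound \<alpha> x k \<partial>count_space UNIV)\<^sup>2 \<le>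
        ennreal C * lsum (\<lambda>k. kn k powr (2 * \<beta> - 1) * (x k)\<^sup>2) * lsum (\<lambda>k. kn k * (\<mu> k * x k)\<^sup>2)
          * lsum (\<lambda>k. kn k powr (2 * \<beta>) * (\<mu> k * x k)\<^sup>2)"
    using transport_square_le[OF beta alpha] by blast
  define c where "c = C * (A0 + 1)"
  have c0: "0 \<le> c" using C0 pos by (simp add: c_def)
  \<comment> \<open>Solves (c + \<delta>^2) \<rho>^(1-2\<beta>) = \<delta>^2, so that c
    \<rho>^(1-2\<beta>) stays below \<delta>^2.\<close>
  define \<rho> where "\<rho> = (c / \<delta>\<^sup>2 + 1) powr (1 / (2 * \<beta> - 1))"
  have b1: "0 < c / \<delta>\<^sup>2 + 1" using c0 by (simp add: add_nonneg_pos)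
  have \<rho>0: "0 < \<rho>" unfolding \<rho>_def using b1 by simp
  have "\<rho> powr (1 - 2 * \<beta>) = (c / \<delta>\<^sup>2 + 1) powr (- 1)"
    unfolding \<rho>_def powr_powr using beta by (intro arg_cong2[where f = "(powr)"]) (auto simp: field_simps)
  then have "\<rho> powr (1 - 2 * \<beta>) = 1 / (c / \<delta>\<^sup>2 + 1)" using b1 by (simp add: powr_minus_divide)
  then have "c * \<rho> powr (1 - 2 * \<beta>) + \<delta>\<^sup>2 * \<rho> powr (1 - 2 * \<beta>) = \<delta>\<^sup>2"
    using pos b1 by (simp add: field_simps)
  moreover have "0 \<le> \<delta>\<^sup>2 * \<rho> powr (1 - 2 * \<beta>)" by simp
  ultimately have \<rho>: "c * \<rho> powr (1 - 2 * \<beta>) \<le> \<delta>\<^sup>2" by linarith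
  define M where "M = c * \<rho> / \<delta>"
  have M0: "0 \<le> M" using c0 \<rho>0 pos by (simp add: M_def)
  have "(\<integral>\<^sup>+ k. ennreal ((\<mu> k)\<^sup>2 * x k) * conv_bound \<alpha> x k \<partial>count_space UNIV) \<le>
        ennreal \<delta> * lsum (\<lambda>k. kn k powr (2 * \<beta>) * (\<mu> k * x k)\<^sup>2) +
        ennreal M * (1 + lsum (\<lambda>k. kn k powr (2 * \<beta>) * (x k)\<^sup>2)) * lsum (\<lambda>k. (\<mu> k * x k)\<^sup>2)"
    (is "?T \<le> ennreal \<delta> * ?D + ennreal M * (1 + ?B) * ?E")
    if x: "\<And>k. 0 \<le> x k" "\<And>k. x (- k) = x k" "x 0 = 0" and wt: "sobolev_weight \<beta> \<mu>"
      and A: "lsum (\<lambda>k. (x k)\<^sup>2) \<le> ennreal A0" (is "?A \<le> _") for x \<mu>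
  \<comment> \<open>An infinite dissipation makes the claim trivial, as \<open>\<delta> > 0\<close>.
    Otherwise |k| >= 1 and \<open>\<mu> k\<close> >= 1 away from zero bound \<open>?B\<close> and
    \<open>?E\<close> by \<open>?D\<close>, so all quantities are finite and real arithmetic
    applies.\<close>
  proof (cases "?D = \<infinity>")
    case True
    then show ?thesis using pos by (simp add: ennreal_mult_eq_top_iff)
  next
    case False
    have mu: "0 \<le> \<mu> k" "k \<noteq> 0 \<Longrightarrow> 1 \<le> \<mu> k" for k using wt by (auto simp: sobolev_weight_def)
    have "?B \<le> ?D"
    proof (intro nn_integral_mono ennreal_leI mult_left_mono)
      fix k
      show "(x k)\<^sup>2 \<le> (\<mu> k * x k)\<^sup>2"
      proof (cases "k = 0")
        case False
        then have "1 * x k \<le> \<mu> k * x k" using mu x by (intro mult_right_mono) auto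
        then show ?thesis using x by (intro power_mono) auto
      qed (simp add: x)
    qed simp
    moreover have "?E \<le> ?D"
    proof (intro nn_integral_mono ennreal_leI)
      fix k
      show "(\<mu> k * x k)\<^sup>2 \<le> kn k powr (2 * \<beta>) * (\<mu> k * x k)\<^sup>2"
      proof (cases "k = 0")
        case False
        then have "1 \<le> kn k powr (2 * \<beta>)" using kn_ge_1 beta by (intro ge_one_powr_ge_zero) auto
        then have "1 * (\<mu> k * x k)\<^sup>2 \<le> kn k powr (2 * \<beta>) * (\<mu> k * x k)\<^sup>2" by (intro mult_right_mono) auto
        then show ?thesis by simp
      qed (simp add: x)
    qed
    moreover have "?A < \<infinity>" using A by (simp add: le_less_trans)
    moreover obtain D where D: "?D = ennreal D" "0 \<le> D" using False by (cases ?D) auto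
    ultimately obtain A' B E where ABE: "?A = ennreal A'" "?B = ennreal B" "?E = ennreal E"
      "0 \<le> A'" "0 \<le> B" "0 \<le> E"
      by (cases ?A; cases ?B; cases ?E) (auto simp: top_unique)
    have A': "A' \<le> A0" using A ABE pos by simp
    define K where "K = (1 + B) powr (1 / (2 * \<beta>))"
    have K0: "0 < K" unfolding K_def using ABE by simp
    have s1: "lsum (\<lambda>k. kn k powr (2 * \<beta> - 1) * (x k)\<^sup>2) \<le>
        ennreal (K powr (2 * \<beta> - 1)) * ?A + ennreal (K powr (- 1)) * ?B"
    proof (rule lsum_le_add)
      fix k
      show "kn k powr (2 * \<beta> - 1) * (x k)\<^sup>2 \<le>
          K powr (2 * \<beta> - 1) * (x k)\<^sup>2 + K powr (- 1) * (kn k powr (2 * \<beta>) * (x k)\<^sup>2)"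
      proof (cases "k = 0")
        case False
        then have "0 < kn k" using kn_ge_1[of k] by simp
        then have "kn k powr (2 * \<beta> - 1) \<le> K powr (2 * \<beta> - 1) + K powr (- 1) * kn k powr (2 * \<beta>)"
          using powr_split[of "kn k" K "2 * \<beta> - 1" "2 * \<beta>"] K0 beta by simp
        then have "kn k powr (2 * \<beta> - 1) * (x k)\<^sup>2 \<le>
           (K powr (2 * \<beta> - 1) + K powr (- 1) * kn k powr (2 * \<beta>)) * (x k)\<^sup>2"
          by (rule mult_right_mono) simp
        then show ?thesis by (simp only: distrib_right mult.assoc)
      qed simp
    qed auto
    have s2: "lsum (\<lambda>k. kn k * (\<mu> k * x k)\<^sup>2) \<le>
        ennreal (\<rho> * K) * ?E + ennreal ((\<rho> * K) powr (1 - 2 * \<beta>)) * ?D"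
    proof (rule lsum_le_add)
      fix k
      show "kn k * (\<mu> k * x k)\<^sup>2 \<le>
          (\<rho> * K) * (\<mu> k * x k)\<^sup>2 + (\<rho> * K) powr (1 - 2 * \<beta>) * (kn k powr (2 * \<beta>) * (\<mu> k * x k)\<^sup>2)"
      proof (cases "k = 0")
        case False
        then have "0 < kn k" using kn_ge_1[of k] by simp
        then have "kn k \<le> \<rho> * K + (\<rho> * K) powr (1 - 2 * \<beta>) * kn k powr (2 * \<beta>)"
          using powr_split[of "kn k" "\<rho> * K" 1 "2 * \<beta>"] K0 \<rho>0 beta by simp
        then have "kn k * (\<mu> k * x k)\<^sup>2 \<le>
           (\<rho> * K + (\<rho> * K) powr (1 - 2 * \<beta>) * kn k powr (2 * \<beta>)) * (\<mu> k * x k)\<^sup>2"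
          by (rule mult_right_mono) simp
        then show ?thesis by (simp only: distrib_right mult.assoc)
      qed (simp add: x)
    qed (use K0 \<rho>0 in auto)
    let ?rhs = "C * (K powr (2 * \<beta> - 1) * A' + K powr (- 1) * B) *
        (\<rho> * K * E + (\<rho> * K) powr (1 - 2 * \<beta>) * D) * D"
    have rn: "0 \<le> ?rhs" using C0 ABE D K0 \<rho>0 by (intro mult_nonneg_nonneg add_nonneg_nonneg) auto
    have "?T\<^sup>2 \<le> ennreal C * lsum (\<lambda>k. kn k powr (2 * \<beta> - 1) * (x k)\<^sup>2) *
        lsum (\<lambda>k. kn k * (\<mu> k * x k)\<^sup>2) * ?D"
      by (rule C) (use x wt in auto)
    also have "\<dots> \<le> ennreal C * (ennreal (K powr (2 * \<beta> - 1)) * ?A + ennreal (K powr (- 1)) * ?B) *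
        (ennreal (\<rho> * K) * ?E + ennreal ((\<rho> * K) powr (1 - 2 * \<beta>)) * ?D) * ?D"
      by (intro mult_mono order_refl s1 s2) auto
    also have "\<dots> = ennreal ?rhs"
      unfolding ABE D using ABE D C0 K0 \<rho>0 by (intro ennreal_poly) auto
    finally have T2: "?T\<^sup>2 \<le> ennreal ?rhs" .
    then have "?T\<^sup>2 < \<infinity>" by (simp add: le_less_trans)
    then have "?T < \<infinity>" by (simp add: power_less_top_ennreal)
    then obtain t where t: "?T = ennreal t" "0 \<le> t" by (cases ?T) auto
    have t2: "t\<^sup>2 \<le> ?rhs" using T2 t rn by (simp add: ennreal_power)
    have "t \<le> \<delta> * D + C * (A0 + 1) * \<rho> / \<delta> * (1 + B) * E"
      by (rule absorb_quadratic[where A = A' and \<beta> = \<beta> and K = K])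
        (use t ABE A' D C0 pos \<rho>0 beta K_def \<rho> t2 in \<open>auto simp: c_def\<close>)
    then have "ennreal t \<le> ennreal (\<delta> * D + M * (1 + B) * E)"
      by (simp add: M_def c_def ennreal_leI)
    also have "\<dots> = ennreal \<delta> * ?D + ennreal M * (1 + ?B) * ?E"
      unfolding ABE D using ABE D pos M0
      by (simp add: ennreal_mult' ennreal_plus flip: ennreal_1)
    finally show ?thesis using t by simp
  qed
  then show ?thesis using that M0 by blast
qed

section \<open>Gronwall's inequality with an integrable kernel\<close>

text \<open>Doubling costs 2^\<beta> <= 4, and taking the minimum with n preserves a <= 2 b, so the
  constants are the same for every n. The condition n >= 1 is what keeps the truncated weight at
  least 1 away from zero.\<close>

lemma sobolev_weight_powr:
  assumes "1/2 < \<beta>" "\<beta> < 5/4"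
  shows "sobolev_weight \<beta> (\<lambda>k. kn k powr \<beta>)"
    and "1 \<le> n \<Longrightarrow> sobolev_weight \<beta> (\<lambda>k. min (kn k) n powr \<beta>)"
proof -
  have "2 powr \<beta> \<le> 2 powr 2" using assms by (intro powr_mono) auto
  then have four: "2 powr \<beta> \<le> (4 :: real)" by (simp add: powr_numeral)
  have dbl: "a powr \<beta> \<le> 4 * b powr \<beta>" if "a \<le> 2 * b" "0 \<le> a" "0 \<le> b" for a b :: real
  proof -
    have "a powr \<beta> \<le> (2 * b) powr \<beta>" using that assms by (intro powr_mono2) auto
    also have "\<dots> = 2 powr \<beta> * b powr \<beta>" using that by (simp add: powr_mult)
    also have "\<dots> \<le> 4 * b powr \<beta>" using four by (intro mult_right_mono) auto
    finally show ?thesis .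
  qed
  show "sobolev_weight \<beta> (\<lambda>k. kn k powr \<beta>)"
    unfolding sobolev_weight_def using assms
    by (auto intro!: dbl ge_one_powr_ge_zero kn_ge_1)
  show "sobolev_weight \<beta> (\<lambda>k. min (kn k) n powr \<beta>)" if "1 \<le> n"
    unfolding sobolev_weight_def using assms that
    by (auto intro!: dbl ge_one_powr_ge_zero kn_ge_1 powr_mono2)
qed

lemma nn_integral_lebesgue_on_indicator:
  fixes f :: "real \<Rightarrow> real"
  assumes t: "0 \<le> t" "t \<le> T" and f: "continuous_on {0..t} f" "\<And>s. s \<in> {0..t} \<Longrightarrow> 0 \<le> f s"
  shows "(\<integral>\<^sup>+ s. indicator {0..t} s * ennreal (f s) \<partial>lebesgue_on {0..T}) = ennreal (integral {0..t} f)"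
proof -
  have "(\<integral>\<^sup>+ s. indicator {0..t} s * ennreal (f s) \<partial>lebesgue_on {0..T}) =
     (\<integral>\<^sup>+ s. indicator {0..t} s * ennreal (f s) * indicator {0..T} s \<partial>lebesgue)"
    by (subst nn_integral_restrict_space) auto
  also have "\<dots> = (\<integral>\<^sup>+ s. ennreal (indicator {0..t} s * f s) \<partial>lebesgue)"
    using t by (intro nn_integral_cong) (auto simp: indicator_def)
  also have "\<dots> = (\<integral>\<^sup>+ s. ennreal (indicator {0..t} s * f s) \<partial>lborel)"
    by (rule nn_integral_completion)
  also have "\<dots> = ennreal (integral {0..t} f)"
    using integrable_integral[OF integrable_continuous_real[OF f(1)]] f(2)
    by (intro nn_integral_has_integral_lebesgue) auto
  finally show ?thesis .
qed

lemma nn_integral_exp_kernel: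
  fixes \<kappa> t T :: real
  assumes "0 < \<kappa>" "0 \<le> t" "t \<le> T"
  shows "(\<integral>\<^sup>+ s. indicator {0..t} s * ennreal (exp (\<kappa> * (s - t))) \<partial>lebesgue_on {0..T}) \<le> ennreal (1 / \<kappa>)"
proof -
  have "((\<lambda>s. exp (\<kappa> * (s - t))) has_integral (exp (\<kappa> * (t - t)) / \<kappa> - exp (\<kappa> * (0 - t)) / \<kappa>)) {0..t}"
    using assms
    by (intro fundamental_theorem_of_calculus)
      (auto intro!: derivative_eq_intros simp flip: has_real_derivative_iff_has_vector_derivative)
  then have "integral {0..t} (\<lambda>s. exp (\<kappa> * (s - t))) = exp (\<kappa> * (t - t)) / \<kappa> - exp (\<kappa> * (0 - t)) / \<kappa>"
    by (rule integral_unique)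
  also have "\<dots> \<le> 1 / \<kappa>" using assms by simp
  finally show ?thesis using assms
    by (subst nn_integral_lebesgue_on_indicator) (auto intro!: continuous_intros ennreal_leI)
qed

text \<open>An integrable kernel need not be bounded. The part where b exceeds a level n has
  integral below 1/4 by dominated convergence. The remaining part is at most n and contributes at
  most n / \<kappa>, which is below 1/4 for \<kappa> = 4 (n + 1).\<close>

lemma integrable_kernel_small:
  fixes b :: "real \<Rightarrow> ennreal" and T :: real
  assumes [measurable]: "b \<in> borel_measurable (lebesgue_on {0..T})"
    and fin: "(\<integral>\<^sup>+ s. b s \<partial>lebesgue_on {0..T}) < \<infinity>"
  obtains \<kappa> where "0 < \<kappa>" and "\<And>t. t \<in> {0..T} \<Longrightarrow>
    (\<integral>\<^sup>+ s. indicator {0..t} s * b s * ennreal (exp (\<kappa> * (s - t))) \<partial>lebesgue_on {0..T}) \<le> 1/2"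
proof -
  let ?L = "lebesgue_on {0..T}"
  have ae: "AE s in ?L. b s \<noteq> \<infinity>"
    using nn_integral_PInf_AE[OF assms(1)] fin by (auto simp: less_top)
  have "(\<lambda>n. \<integral>\<^sup>+ s. (if b s > of_nat n then b s else 0) \<partial>?L) \<longlonglongrightarrow> (\<integral>\<^sup>+ s. 0 \<partial>?L)"
  proof (rule nn_integral_dominated_convergence[where w = b])
    show "AE s in ?L. (\<lambda>n. if b s > of_nat n then b s else 0) \<longlonglongrightarrow> 0"
      using ae
    proof eventually_elim
      case (elim s)
      then obtain r where r: "b s = ennreal r" "0 \<le> r" by (cases "b s") auto
      obtain N where N: "r \<le> of_nat N" using real_arch_simple by blast
      have "\<forall>n\<ge>N. (if b s > of_nat n then b s else 0) = 0"
      proof (intro allI impI)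
        fix n assume "N \<le> n"
        then have "r \<le> real n" using N by (meson of_nat_mono order_trans)
        then have "b s \<le> of_nat n" using r by (simp add: ennreal_of_nat_eq_real_of_nat ennreal_leI)
        then show "(if b s > of_nat n then b s else 0) = 0" by (simp add: not_less)
      qed
      then have "eventually (\<lambda>n. (if b s > of_nat n then b s else 0) = 0) sequentially"
        unfolding eventually_sequentially by blast
      then show ?case by (rule tendsto_eventually)
    qed
  qed (use fin in auto)
  then have "(\<lambda>n. \<integral>\<^sup>+ s. (if b s > of_nat n then b s else 0) \<partial>?L) \<longlonglongrightarrow> 0" by simp
  then have "eventually (\<lambda>n. (\<integral>\<^sup>+ s. (if b s > of_nat n then b s else 0) \<partial>?L) < 1/4) sequentially"
  proof (rule order_tendstoD)
    have "(1/4 :: ennreal) = ennreal (1/4)" using divide_ennreal[of 1 4] by simp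
    also have "0 < \<dots>" by (simp only: ennreal_less_zero_iff)
    finally show "0 < (1/4 :: ennreal)" .
  qed
  then obtain n where n: "(\<integral>\<^sup>+ s. (if b s > of_nat n then b s else 0) \<partial>?L) < 1/4"
    by (auto simp: eventually_sequentially)
  define \<kappa> where "\<kappa> = 4 * (real n + 1)"
  have l0: "0 < \<kappa>" by (simp add: \<kappa>_def)
  have "(\<integral>\<^sup>+ s. indicator {0..t} s * b s * ennreal (exp (\<kappa> * (s - t))) \<partial>?L) \<le> 1/2"
    if t: "t \<in> {0..T}" for t
  proof -
    have "(\<integral>\<^sup>+ s. indicator {0..t} s * b s * ennreal (exp (\<kappa> * (s - t))) \<partial>?L) \<le>
      (\<integral>\<^sup>+ s. of_nat n * (indicator {0..t} s * ennreal (exp (\<kappa> * (s - t)))) +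
        (if b s > of_nat n then b s else 0) \<partial>?L)"
    proof (rule nn_integral_mono)
      fix s
      show "indicator {0..t} s * b s * ennreal (exp (\<kappa> * (s - t))) \<le>
        of_nat n * (indicator {0..t} s * ennreal (exp (\<kappa> * (s - t)))) + (if b s > of_nat n then b s else 0)"
      proof (cases "s \<in> {0..t}")
        case True
        have "ennreal (exp (\<kappa> * (s - t))) \<le> 1"
          using True l0 by (simp add: mult_nonneg_nonpos)
        then have "b s * ennreal (exp (\<kappa> * (s - t))) \<le> b s"
          using mult_left_mono[of "ennreal (exp (\<kappa> * (s - t)))" 1 "b s"] by simp
        moreover have "b s * ennreal (exp (\<kappa> * (s - t))) \<le> of_nat n * ennreal (exp (\<kappa> * (s - t)))"
          if "\<not> b s > of_nat n" using that by (intro mult_right_mono) auto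
        ultimately show ?thesis using True by (auto intro: add_increasing)
      qed simp
    qed
    also have "\<dots> = of_nat n * (\<integral>\<^sup>+ s. indicator {0..t} s * ennreal (exp (\<kappa> * (s - t))) \<partial>?L) +
        (\<integral>\<^sup>+ s. (if b s > of_nat n then b s else 0) \<partial>?L)"
    proof -
      have [measurable]: "(\<lambda>s. indicator {0..t} s :: ennreal) \<in> borel_measurable ?L"
        by (rule borel_measurable_indicator) (use t in \<open>auto simp: sets_restrict_space_iff\<close>)
      have [measurable]: "(\<lambda>s. exp (\<kappa> * (s - t))) \<in> borel_measurable ?L"
        by (intro continuous_imp_measurable_on_sets_lebesgue continuous_intros) auto
      show ?thesis by (subst nn_integral_add) (auto simp: nn_integral_cmult)
    qed
    also have "\<dots> \<le> of_nat n * ennreal (1 / \<kappa>) + 1/4"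
      using t l0 n by (intro add_mono mult_left_mono nn_integral_exp_kernel) auto
    also have "\<dots> \<le> 1/4 + 1/4"
    proof (rule add_right_mono)
      have "of_nat n * ennreal (1 / \<kappa>) = ennreal (real n * (1 / \<kappa>))"
        by (simp only: ennreal_mult'[OF of_nat_0_le_iff] ennreal_of_nat_eq_real_of_nat)
      also have "\<dots> \<le> ennreal (1/4)" by (intro ennreal_leI) (simp add: \<kappa>_def field_simps)
      also have "\<dots> = 1/4" using divide_ennreal[of 1 4] by simp
      finally show "of_nat n * ennreal (1 / \<kappa>) \<le> 1/4" .
    qed
    also have "1/4 + 1/4 = (1/2 :: ennreal)"
    proof -
      have "(1/4 :: ennreal) = ennreal (1/4)" using divide_ennreal[of 1 4] by simp
      moreover have "(1/2 :: ennreal) = ennreal (1/2)" using divide_ennreal[of 1 2] by simp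
      moreover have "ennreal (1/4) + ennreal (1/4) = ennreal (1/4 + 1/4)"
        by (rule ennreal_plus[symmetric]) auto
      ultimately show ?thesis by simp
    qed
    finally show ?thesis .
  qed
  then show ?thesis using that l0 by blast
qed

text \<open>The supremum S of E(t) exp(-\<kappa> t) satisfies S <= a + S/2 by the choice of
  \<kappa>, hence S <= 2 a. The bound \<open>K\<close> serves only to make S finite, so that S/2 can
  be subtracted; the constant depends on b and T alone. Thus the lemma tolerates an a priori bound
  that blows up with the truncation.\<close>

lemma gronwall_ennreal:
  fixes b :: "real \<Rightarrow> ennreal" and T :: real
  assumes b[measurable]: "b \<in> borel_measurable (lebesgue_on {0..T})"
    and fin: "(\<integral>\<^sup>+ s. b s \<partial>lebesgue_on {0..T}) < \<infinity>"
  obtains C :: real where "0 \<le> C" and "\<And>E a t K. E \<in> borel_measurable (lebesgue_on {0..T}) \<Longrightarrow>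
     (\<And>t. t \<in> {0..T} \<Longrightarrow> E t \<le> ennreal K) \<Longrightarrow>
     (\<And>t. t \<in> {0..T} \<Longrightarrow> E t \<le> a + (\<integral>\<^sup>+ s. indicator {0..t} s * (b s * E s) \<partial>lebesgue_on {0..T})) \<Longrightarrow>
     t \<in> {0..T} \<Longrightarrow> E t \<le> ennreal C * a"
proof -
  let ?L = "lebesgue_on {0..T}"
  obtain \<kappa> where l0: "0 < \<kappa>" and small: "\<And>t. t \<in> {0..T} \<Longrightarrow>
    (\<integral>\<^sup>+ s. indicator {0..t} s * b s * ennreal (exp (\<kappa> * (s - t))) \<partial>?L) \<le> 1/2"
    using integrable_kernel_small[OF b fin] by blast
  have bound: "E t \<le> ennreal (2 * exp (\<kappa> * T)) * a"
    if E[measurable]: "E \<in> borel_measurable ?L" and K: "\<And>t. t \<in> {0..T} \<Longrightarrow> E t \<le> ennreal K"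
      and le: "\<And>t. t \<in> {0..T} \<Longrightarrow> E t \<le> a + (\<integral>\<^sup>+ s. indicator {0..t} s * (b s * E s) \<partial>?L)"
      and t: "t \<in> {0..T}" for E a t K
  proof -
    define S where "S = (SUP t\<in>{0..T}. E t * ennreal (exp (- \<kappa> * t)))"
    have S_upper: "E t * ennreal (exp (- \<kappa> * t)) \<le> S" if "t \<in> {0..T}" for t
      unfolding S_def using that by (rule SUP_upper)
    have "S \<le> ennreal K"
      unfolding S_def
    proof (rule SUP_least)
      fix t assume t: "t \<in> {0..T}"
      have "ennreal (exp (- \<kappa> * t)) \<le> 1" using t l0 by simp
      then have "E t * ennreal (exp (- \<kappa> * t)) \<le> ennreal K * 1"
        using K[OF t] by (intro mult_mono) auto
      then show "E t * ennreal (exp (- \<kappa> * t)) \<le> ennreal K" by simp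
    qed
    then have Sfin: "S < \<infinity>" by (simp add: le_less_trans)
    have "S \<le> a + S * (1/2)"
      unfolding S_def
    proof (rule SUP_least, fold S_def)
      fix t assume t: "t \<in> {0..T}"
      have ind[measurable]: "(\<lambda>s. indicator {0..t} s :: ennreal) \<in> borel_measurable ?L"
        by (rule borel_measurable_indicator) (use t in \<open>auto simp: sets_restrict_space_iff\<close>)
      have ex[measurable]: "(\<lambda>s. exp (\<kappa> * (s - t))) \<in> borel_measurable ?L"
        by (intro continuous_imp_measurable_on_sets_lebesgue continuous_intros) auto
      have "E t * ennreal (exp (- \<kappa> * t)) \<le>
         (a + (\<integral>\<^sup>+ s. indicator {0..t} s * (b s * E s) \<partial>?L)) * ennreal (exp (- \<kappa> * t))"
        by (rule mult_right_mono[OF le[OF t]]) simp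
      also have "\<dots> = a * ennreal (exp (- \<kappa> * t)) +
          (\<integral>\<^sup>+ s. indicator {0..t} s * (b s * E s) * ennreal (exp (- \<kappa> * t)) \<partial>?L)"
        by (simp add: distrib_right nn_integral_multc)
      also have "\<dots> \<le> a + (\<integral>\<^sup>+ s. S * (indicator {0..t} s * b s * ennreal (exp (\<kappa> * (s - t)))) \<partial>?L)"
      proof (intro add_mono nn_integral_mono)
        have "ennreal (exp (- \<kappa> * t)) \<le> 1" using t l0 by simp
        then show "a * ennreal (exp (- \<kappa> * t)) \<le> a"
          using mult_left_mono[of "ennreal (exp (- \<kappa> * t))" 1 a] by simp
      next
        fix s
        show "indicator {0..t} s * (b s * E s) * ennreal (exp (- \<kappa> * t)) \<le>
            S * (indicator {0..t} s * b s * ennreal (exp (\<kappa> * (s - t))))"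
        proof (cases "s \<in> {0..t}")
          case True
          have e: "exp (- \<kappa> * t) = exp (- \<kappa> * s) * exp (\<kappa> * (s - t))"
            by (simp add: exp_add[symmetric] algebra_simps)
          have "b s * E s * ennreal (exp (- \<kappa> * t)) =
              E s * ennreal (exp (- \<kappa> * s)) * (b s * ennreal (exp (\<kappa> * (s - t))))"
            unfolding e by (simp add: ennreal_mult' mult_ac)
          also have "\<dots> \<le> S * (b s * ennreal (exp (\<kappa> * (s - t))))"
            using True t by (intro mult_right_mono S_upper) auto
          finally show ?thesis using True by simp
        qed simp
      qed
      also have "\<dots> = a + S * (\<integral>\<^sup>+ s. indicator {0..t} s * b s * ennreal (exp (\<kappa> * (s - t))) \<partial>?L)"
        by (subst nn_integral_cmult) auto
      also have "\<dots> \<le> a + S * (1/2)" by (intro add_left_mono mult_left_mono small t) auto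
      finally show "E t * ennreal (exp (- \<kappa> * t)) \<le> a + S * (1/2)" .
    qed
    then have S2: "S \<le> 2 * a"
    proof (cases "a = \<infinity>")
      case False
      then obtain a' s' where as: "a = ennreal a'" "S = ennreal s'" "0 \<le> a'" "0 \<le> s'"
        using Sfin by (cases a; cases S) auto
      have half: "(1/2 :: ennreal) = ennreal (1/2)"
        using divide_ennreal[of 1 2] by simp
      have "ennreal s' \<le> ennreal a' + ennreal s' * ennreal (1/2)"
        using \<open>S \<le> a + S * (1/2)\<close> unfolding as half .
      also have "\<dots> = ennreal (a' + s' * (1/2))"
      proof -
        have "ennreal (s' * (1/2)) = ennreal s' * ennreal (1/2)" using as by (intro ennreal_mult') auto
        moreover have "ennreal (a' + s' * (1/2)) = ennreal a' + ennreal (s' * (1/2))"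
          using as by (intro ennreal_plus) auto
        ultimately show ?thesis by simp
      qed
      finally have "ennreal s' \<le> ennreal (a' + s' * (1/2))" .
      then have "s' \<le> a' + s' * (1/2)" using as by (subst (asm) ennreal_le_iff) auto
      then have "ennreal s' \<le> ennreal (2 * a')" by (intro ennreal_leI) simp
      then show ?thesis using as by (simp add: ennreal_mult')
    qed (simp add: ennreal_mult_eq_top_iff)
    have "E t = E t * ennreal (exp (- \<kappa> * t)) * ennreal (exp (\<kappa> * t))"
      by (simp add: mult.assoc ennreal_mult'[symmetric] exp_add[symmetric])
    also have "\<dots> \<le> (2 * a) * ennreal (exp (\<kappa> * T))"
    proof (rule mult_mono)
      show "E t * ennreal (exp (- \<kappa> * t)) \<le> 2 * a" by (rule order_trans[OF S_upper[OF t] S2])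
      show "ennreal (exp (\<kappa> * t)) \<le> ennreal (exp (\<kappa> * T))"
        using t l0 by (intro ennreal_leI) simp
    qed simp_all
    also have "\<dots> = ennreal (2 * exp (\<kappa> * T)) * a" by (simp add: ennreal_mult' mult_ac)
    finally show ?thesis .
  qed
  show ?thesis
  proof (rule that[of "2 * exp (\<kappa> * T)"])
    fix E a t K
    assume "E \<in> borel_measurable ?L" "\<And>t. t \<in> {0..T} \<Longrightarrow> E t \<le> ennreal K"
      "\<And>t. t \<in> {0..T} \<Longrightarrow> E t \<le> a + (\<integral>\<^sup>+ s. indicator {0..t} s * (b s * E s) \<partial>?L)" "t \<in> {0..T}"
    then show "E t \<le> ennreal (2 * exp (\<kappa> * T)) * a" by (rule bound)
  qed simp
qed

section \<open>Weighted energy estimates\<close>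

text \<open>Through \<open>to_nat\<close> the sum over a countable index type becomes a series over
  the naturals, to which the standard measurability rule applies.\<close>

lemma borel_measurable_nn_integral_count_space [measurable (raw)]:
  fixes f :: "'a \<Rightarrow> 'i::countable \<Rightarrow> ennreal"
  assumes [measurable]: "\<And>j. (\<lambda>s. f s j) \<in> borel_measurable M"
  shows "(\<lambda>s. \<integral>\<^sup>+ j. f s j \<partial>count_space UNIV) \<in> borel_measurable M"
proof -
  have "(\<integral>\<^sup>+ j. f s j \<partial>count_space UNIV) =
      (\<Sum>n. f s (from_nat n) * indicator (range (to_nat :: 'i \<Rightarrow> nat)) n)" for s
  proof -
    have "bij_betw (to_nat :: 'i \<Rightarrow> nat) UNIV (range (to_nat :: 'i \<Rightarrow> nat))" by (simp add: bij_betw_def)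
    from nn_integral_bij_count_space[OF this, of "\<lambda>n. f s (from_nat n)"]
    have "(\<integral>\<^sup>+ j. f s j \<partial>count_space UNIV) =
        (\<integral>\<^sup>+ n. f s (from_nat n) \<partial>count_space (range (to_nat :: 'i \<Rightarrow> nat)))" by simp
    also have "\<dots> = (\<integral>\<^sup>+ n. f s (from_nat n) * indicator (range (to_nat :: 'i \<Rightarrow> nat)) n \<partial>count_space UNIV)"
      by (rule nn_integral_count_space_indicator) simp
    finally show ?thesis by (simp add: nn_integral_count_space_nat)
  qed
  then show ?thesis by simp
qed

text \<open>Fatou's lemma, in the shape needed to remove the truncation: for fixed k the truncated
  weight equals |k|^\<beta> for all large n.\<close>

lemma nn_integral_count_space_le_of_eventually_eq:
  fixes f :: "nat \<Rightarrow> 'i \<Rightarrow> ennreal"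
  assumes "\<And>k. eventually (\<lambda>n. f n k = g k) sequentially"
    and "\<And>n. (\<integral>\<^sup>+ k. f n k \<partial>count_space UNIV) \<le> R"
  shows "(\<integral>\<^sup>+ k. g k \<partial>count_space UNIV) \<le> R"
proof -
  have "g k = liminf (\<lambda>n. f n k)" for k
    using lim_imp_Liminf[OF trivial_limit_sequentially tendsto_eventually[OF assms(1)]] by simp
  then have "(\<integral>\<^sup>+ k. g k \<partial>count_space UNIV) = (\<integral>\<^sup>+ k. liminf (\<lambda>n. f n k) \<partial>count_space UNIV)" by simp
  also have "\<dots> \<le> liminf (\<lambda>n. \<integral>\<^sup>+ k. f n k \<partial>count_space UNIV)"
    by (rule nn_integral_liminf) simp
  also have "\<dots> \<le> R"
    using Liminf_le[of sequentially "\<lambda>n. \<integral>\<^sup>+ k. f n k \<partial>count_space UNIV" R] assms(2)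
    by (meson Liminf_bounded eventually_sequentiallyI le_sequentially Liminf_least Liminf_le always_eventually order.trans trivial_limit_sequentially)
  finally show ?thesis .
qed

text \<open>The forcing is only square summable, so both weights must fall on v: one of them is
  raised to |k|^\<beta> by the last clause of \<open>sobolev_weight\<close>, giving the root of the
  dissipation. The transport term, doubled, takes \<nu>/2 and the forcing another \<nu>/2; together
  this is half of the available 2 \<nu>.\<close>

lemma weighted_forcing_estimate:
  fixes \<alpha> \<beta> \<nu> A0 c :: real
  assumes beta: "1/2 < \<beta>" "\<beta> < 5/4" and alpha: "\<alpha> + \<beta> = 5/4" and pos: "0 < \<nu>" "0 \<le> A0" "0 \<le> c"
  obtains M where "0 \<le> M"
    and "\<And>x h \<mu>. (\<And>k. 0 \<le> x k) \<Longrightarrow> (\<And>k. x (- k) = x k) \<Longrightarrow> x 0 = 0 \<Longrightarrow> (\<And>k. 0 \<le> h k) \<Longrightarrow>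
      sobolev_weight \<beta> \<mu> \<Longrightarrow> lsum (\<lambda>k. (x k)\<^sup>2) \<le> ennreal A0 \<Longrightarrow>
      (\<integral>\<^sup>+ k. ennreal ((\<mu> k)\<^sup>2) * (ennreal (2 * x k) * (conv_bound \<alpha> x k + ennreal (c * h k))) \<partial>count_space UNIV) \<le>
        ennreal \<nu> * lsum (\<lambda>k. kn k powr (2 * \<beta>) * (\<mu> k * x k)\<^sup>2) +
        ennreal M * (1 + lsum (\<lambda>k. kn k powr (2 * \<beta>) * (x k)\<^sup>2)) * lsum (\<lambda>k. (\<mu> k * x k)\<^sup>2) +
        ennreal (2 * c\<^sup>2 / \<nu>) * lsum (\<lambda>k. (h k)\<^sup>2)"
proof -
  obtain M where M0: "0 \<le> M" and M: "\<And>x \<mu>. (\<And>k. 0 \<le> x k) \<Longrightarrow> (\<And>k. x (- k) = x k) \<Longrightarrow> x 0 = 0 \<Longrightarrow>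
      sobolev_weight \<beta> \<mu> \<Longrightarrow> lsum (\<lambda>k. (x k)\<^sup>2) \<le> ennreal A0 \<Longrightarrow>
      (\<integral>\<^sup>+ k. ennreal ((\<mu> k)\<^sup>2 * x k) * conv_bound \<alpha> x k \<partial>count_space UNIV) \<le>
        ennreal (\<nu>/4) * lsum (\<lambda>k. kn k powr (2 * \<beta>) * (\<mu> k * x k)\<^sup>2) +
        ennreal M * (1 + lsum (\<lambda>k. kn k powr (2 * \<beta>) * (x k)\<^sup>2)) * lsum (\<lambda>k. (\<mu> k * x k)\<^sup>2)"
    using nonlinear_estimate[OF beta alpha, of "\<nu>/4" A0] pos by auto
  have young: "2 * w * d \<le> \<nu>/2 * w\<^sup>2 + 2 * d\<^sup>2 / \<nu>" for w d :: real
  proof -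
    have "0 \<le> (\<nu> * w - 2 * d)\<^sup>2 / (2 * \<nu>)" using pos by simp
    also have "\<dots> = \<nu>/2 * w\<^sup>2 + 2 * d\<^sup>2 / \<nu> - 2 * w * d"
      using pos by (simp add: field_simps power2_eq_square)
    finally show ?thesis by simp
  qed
  have "(\<integral>\<^sup>+ k. ennreal ((\<mu> k)\<^sup>2) * (ennreal (2 * x k) * (conv_bound \<alpha> x k + ennreal (c * h k))) \<partial>count_space UNIV) \<le>
        ennreal \<nu> * lsum (\<lambda>k. kn k powr (2 * \<beta>) * (\<mu> k * x k)\<^sup>2) +
        ennreal (2 * M) * (1 + lsum (\<lambda>k. kn k powr (2 * \<beta>) * (x k)\<^sup>2)) * lsum (\<lambda>k. (\<mu> k * x k)\<^sup>2) +
        ennreal (2 * c\<^sup>2 / \<nu>) * lsum (\<lambda>k. (h k)\<^sup>2)"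
    (is "_ \<le> _ + ?N + ?H")
    if x: "\<And>k. 0 \<le> x k" "\<And>k. x (- k) = x k" "x 0 = 0" and h: "\<And>k. 0 \<le> h k"
      and wt: "sobolev_weight \<beta> \<mu>" and A: "lsum (\<lambda>k. (x k)\<^sup>2) \<le> ennreal A0" for x h \<mu>
  proof -
    have mu: "0 \<le> \<mu> k" "\<mu> k \<le> kn k powr \<beta>" for k using wt by (auto simp: sobolev_weight_def)
    have f: "ennreal ((\<mu> k)\<^sup>2) * (ennreal (2 * x k) * ennreal (c * h k)) \<le>
        ennreal (\<nu>/2 * (kn k powr (2 * \<beta>) * (\<mu> k * x k)\<^sup>2) + 2 * c\<^sup>2 / \<nu> * (h k)\<^sup>2)" for k
    proof -
      let ?w = "kn k powr \<beta> * (\<mu> k * x k)"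
      have "(\<mu> k)\<^sup>2 * (2 * x k * (c * h k)) = 2 * (\<mu> k * (\<mu> k * x k)) * (c * h k)"
        by (simp add: power2_eq_square)
      also have "\<dots> \<le> 2 * ?w * (c * h k)"
        using mu x h pos by (intro mult_right_mono mult_left_mono) auto
      also have "\<dots> \<le> \<nu>/2 * ?w\<^sup>2 + 2 * (c * h k)\<^sup>2 / \<nu>" by (rule young)
      also have "2 * (c * h k)\<^sup>2 / \<nu> = 2 * c\<^sup>2 / \<nu> * (h k)\<^sup>2" by (simp add: power_mult_distrib)
      also have "?w\<^sup>2 = kn k powr (2 * \<beta>) * (\<mu> k * x k)\<^sup>2" by (simp add: power_mult_distrib powr_square)
      finally have le: "(\<mu> k)\<^sup>2 * (2 * x k * (c * h k)) \<le>
        \<nu>/2 * (kn k powr (2 * \<beta>) * (\<mu> k * x k)\<^sup>2) + 2 * c\<^sup>2 / \<nu> * (h k)\<^sup>2" by simp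
      have "ennreal ((\<mu> k)\<^sup>2) * (ennreal (2 * x k) * ennreal (c * h k)) =
        ennreal ((\<mu> k)\<^sup>2 * (2 * x k * (c * h k)))"
        using x h pos by (simp add: ennreal_mult'[symmetric])
      then show ?thesis using ennreal_leI[OF le] by (simp only:)
    qed
    have "(\<integral>\<^sup>+ k. ennreal ((\<mu> k)\<^sup>2) * (ennreal (2 * x k) * (conv_bound \<alpha> x k + ennreal (c * h k))) \<partial>count_space UNIV) =
      (\<integral>\<^sup>+ k. 2 * (ennreal ((\<mu> k)\<^sup>2 * x k) * conv_bound \<alpha> x k) +
         ennreal ((\<mu> k)\<^sup>2) * (ennreal (2 * x k) * ennreal (c * h k)) \<partial>count_space UNIV)"
      by (rule nn_integral_cong) (simp add: distrib_left ennreal_mult' x mult_ac)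
    also have "\<dots> = 2 * (\<integral>\<^sup>+ k. ennreal ((\<mu> k)\<^sup>2 * x k) * conv_bound \<alpha> x k \<partial>count_space UNIV) +
       (\<integral>\<^sup>+ k. ennreal ((\<mu> k)\<^sup>2) * (ennreal (2 * x k) * ennreal (c * h k)) \<partial>count_space UNIV)"
      by (simp add: nn_integral_add nn_integral_cmult)
    also have "\<dots> \<le> 2 * (ennreal (\<nu>/4) * lsum (\<lambda>k. kn k powr (2 * \<beta>) * (\<mu> k * x k)\<^sup>2) +
        ennreal M * (1 + lsum (\<lambda>k. kn k powr (2 * \<beta>) * (x k)\<^sup>2)) * lsum (\<lambda>k. (\<mu> k * x k)\<^sup>2)) +
       (ennreal (\<nu>/2) * lsum (\<lambda>k. kn k powr (2 * \<beta>) * (\<mu> k * x k)\<^sup>2) + ?H)"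
    proof (intro add_mono mult_left_mono M x wt A)
      have "(\<integral>\<^sup>+ k. ennreal ((\<mu> k)\<^sup>2) * (ennreal (2 * x k) * ennreal (c * h k)) \<partial>count_space UNIV) \<le>
         lsum (\<lambda>k. \<nu>/2 * (kn k powr (2 * \<beta>) * (\<mu> k * x k)\<^sup>2) + 2 * c\<^sup>2 / \<nu> * (h k)\<^sup>2)"
        by (intro nn_integral_mono f)
      also have "\<dots> \<le> ennreal (\<nu>/2) * lsum (\<lambda>k. kn k powr (2 * \<beta>) * (\<mu> k * x k)\<^sup>2) + ?H"
        by (rule lsum_le_add) (use pos in auto)
      finally show "(\<integral>\<^sup>+ k. ennreal ((\<mu> k)\<^sup>2) * (ennreal (2 * x k) * ennreal (c * h k)) \<partial>count_space UNIV) \<le>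
         ennreal (\<nu>/2) * lsum (\<lambda>k. kn k powr (2 * \<beta>) * (\<mu> k * x k)\<^sup>2) + ?H" .
    qed auto
    also have "\<dots> = (2 * ennreal (\<nu>/4) + ennreal (\<nu>/2)) * lsum (\<lambda>k. kn k powr (2 * \<beta>) * (\<mu> k * x k)\<^sup>2) + ?N + ?H"
      by (simp only: distrib_left distrib_right ennreal_mult'[OF M0] ennreal_mult'[of 2 M])
        (simp add: ac_simps)
    also have "2 * ennreal (\<nu>/4) + ennreal (\<nu>/2) = ennreal \<nu>"
    proof -
      have "2 * ennreal (\<nu>/4) = ennreal (2 * (\<nu>/4))" by (subst ennreal_mult') auto
      then show ?thesis using pos by (simp flip: ennreal_plus)
    qed
    finally show ?thesis .
  qed
  then show ?thesis using that[of "2 * M"] M0 by auto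
qed


text \<open>Here x and h stand for the moduli of the coefficients of v and \<theta>, and the system
  is represented only by the inequality \<open>energy\<close> for single modes. The majorant q is
  independent of time, as dominated convergence will require.\<close>

lemma energy_regularity:
  fixes \<alpha> \<beta> \<nu> A0 c T \<Theta> :: real and x h :: "real \<Rightarrow> wvec \<Rightarrow> real"
  defines "L \<equiv> lebesgue_on {0..T}"
  assumes beta: "1/2 < \<beta>" "\<beta> < 5/4" and alpha: "\<alpha> + \<beta> = 5/4"
    and pos: "0 < \<nu>" "0 \<le> A0" "0 \<le> c" "0 < T"
    and x: "\<And>t k. 0 \<le> x t k" "\<And>t k. t \<in> {0..T} \<Longrightarrow> x t (- k) = x t k" "\<And>t. t \<in> {0..T} \<Longrightarrow> x t 0 = 0"
    and h: "\<And>t k. 0 \<le> h t k"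
    and xm: "\<And>k. (\<lambda>t. x t k) \<in> borel_measurable L" and hm: "\<And>k. (\<lambda>t. h t k) \<in> borel_measurable L"
    and A: "\<And>t. t \<in> {0..T} \<Longrightarrow> lsum (\<lambda>k. (x t k)\<^sup>2) \<le> ennreal A0"
    and hb: "AE t in L. lsum (\<lambda>k. (h t k)\<^sup>2) \<le> ennreal \<Theta>"
    and B: "(\<integral>\<^sup>+ t. lsum (\<lambda>k. kn k powr (2 * \<beta>) * (x t k)\<^sup>2) \<partial>L) < \<infinity>"
    and init: "lsum (\<lambda>k. kn k powr (2 * \<beta>) * (x 0 k)\<^sup>2) < \<infinity>"
    and energy: "\<And>t k. t \<in> {0..T} \<Longrightarrow>
      ennreal ((x t k)\<^sup>2) + ennreal (2 * \<nu> * kn k powr (2 * \<beta>)) * (\<integral>\<^sup>+ s. indicator {0..t} s * ennreal ((x s k)\<^sup>2) \<partial>L)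
      \<le> ennreal ((x 0 k)\<^sup>2) + (\<integral>\<^sup>+ s. indicator {0..t} s *
          (ennreal (2 * x s k) * (conv_bound \<alpha> (x s) k + ennreal (c * h s k))) \<partial>L)"
  obtains q where "(\<integral>\<^sup>+ k. q k \<partial>count_space UNIV) < \<infinity>"
    and "\<And>t k. t \<in> {0..T} \<Longrightarrow> ennreal (kn k powr (2 * \<beta>) * (x t k)\<^sup>2) \<le> q k"
    and "(\<integral>\<^sup>+ t. lsum (\<lambda>k. kn k powr (4 * \<beta>) * (x t k)\<^sup>2) \<partial>L) < \<infinity>"
proof -
  note [measurable] = xm hm
  obtain M where M0: "0 \<le> M" and M: "\<And>x h \<mu>. (\<And>k. 0 \<le> x k) \<Longrightarrow> (\<And>k. x (- k) = x k) \<Longrightarrow> x 0 = 0 \<Longrightarrow> (\<And>k. 0 \<le> h k) \<Longrightarrow>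
      sobolev_weight \<beta> \<mu> \<Longrightarrow> lsum (\<lambda>k. (x k)\<^sup>2) \<le> ennreal A0 \<Longrightarrow>
      (\<integral>\<^sup>+ k. ennreal ((\<mu> k)\<^sup>2) * (ennreal (2 * x k) * (conv_bound \<alpha> x k + ennreal (c * h k))) \<partial>count_space UNIV) \<le>
        ennreal \<nu> * lsum (\<lambda>k. kn k powr (2 * \<beta>) * (\<mu> k * x k)\<^sup>2) +
        ennreal M * (1 + lsum (\<lambda>k. kn k powr (2 * \<beta>) * (x k)\<^sup>2)) * lsum (\<lambda>k. (\<mu> k * x k)\<^sup>2) +
        ennreal (2 * c\<^sup>2 / \<nu>) * lsum (\<lambda>k. (h k)\<^sup>2)"
    using weighted_forcing_estimate[OF beta alpha pos(1-3)] by blast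
  define E where "E \<mu> t = lsum (\<lambda>k. (\<mu> k * x t k)\<^sup>2)" for \<mu> t
  define D where "D \<mu> t = lsum (\<lambda>k. kn k powr (2 * \<beta>) * (\<mu> k * x t k)\<^sup>2)" for \<mu> t
  define b where "b t = ennreal M * (1 + lsum (\<lambda>k. kn k powr (2 * \<beta>) * (x t k)\<^sup>2))" for t
  define H where "H t = ennreal (2 * c\<^sup>2 / \<nu>) * lsum (\<lambda>k. (h t k)\<^sup>2)" for t
  define R where "R t k = ennreal (2 * x t k) * (conv_bound \<alpha> (x t) k + ennreal (c * h t k))" for t k
  have Em[measurable]: "E \<mu> \<in> borel_measurable L" for \<mu> unfolding E_def by measurable
  have Dm[measurable]: "D \<mu> \<in> borel_measurable L" for \<mu> unfolding D_def by measurable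
  have bm[measurable]: "b \<in> borel_measurable L" unfolding b_def by measurable
  have Hm[measurable]: "H \<in> borel_measurable L" unfolding H_def by measurable
  have Rm[measurable]: "(\<lambda>t. R t k) \<in> borel_measurable L" for k
    unfolding R_def conv_bound_def by measurable
  have ind[measurable]: "(\<lambda>s. indicator {0..t} s :: ennreal) \<in> borel_measurable L" if "t \<in> {0..T}" for t
    unfolding L_def by (rule borel_measurable_indicator) (use that in \<open>auto simp: sets_restrict_space_iff\<close>)
  have spL: "space L = {0..T}" by (simp add: L_def)
  have emL: "emeasure L {0..T} = ennreal T"
    unfolding L_def using pos by (subst emeasure_restrict_space) auto
  have const: "(\<integral>\<^sup>+ s. ennreal a \<partial>L) < \<infinity>" for a
    using emL by (simp add: spL ennreal_mult_less_top)
  have bfin: "(\<integral>\<^sup>+ s. b s \<partial>L) < \<infinity>"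
  proof -
    have "(\<integral>\<^sup>+ s. b s \<partial>L) = ennreal M * ((\<integral>\<^sup>+ s. 1 \<partial>L) + (\<integral>\<^sup>+ t. lsum (\<lambda>k. kn k powr (2 * \<beta>) * (x t k)\<^sup>2) \<partial>L))"
      unfolding b_def by (subst nn_integral_cmult) (auto simp: nn_integral_add)
    then show ?thesis using B const[of 1] by (simp add: ennreal_mult_less_top)
  qed
  have Hfin: "(\<integral>\<^sup>+ s. H s \<partial>L) < \<infinity>"
  proof -
    have "(\<integral>\<^sup>+ s. H s \<partial>L) = ennreal (2 * c\<^sup>2 / \<nu>) * (\<integral>\<^sup>+ s. lsum (\<lambda>k. (h s k)\<^sup>2) \<partial>L)"
      unfolding H_def by (rule nn_integral_cmult) measurable
    moreover have "(\<integral>\<^sup>+ s. lsum (\<lambda>k. (h s k)\<^sup>2) \<partial>L) \<le> (\<integral>\<^sup>+ s. ennreal \<Theta> \<partial>L)"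
      by (rule nn_integral_mono_AE[OF hb])
    ultimately show ?thesis using const[of \<Theta>] by (simp add: ennreal_mult_less_top le_less_trans)
  qed
  have R_le: "(\<integral>\<^sup>+ k. ennreal ((\<mu> k)\<^sup>2) * R s k \<partial>count_space UNIV) \<le> ennreal \<nu> * D \<mu> s + b s * E \<mu> s + H s"
    if "s \<in> {0..T}" "sobolev_weight \<beta> \<mu>" for s \<mu>
    unfolding R_def D_def b_def E_def H_def using that x h A by (intro M) auto
  \<comment> \<open>The one-mode inequalities are multiplied by the squared weight and summed, with
    Tonelli's theorem exchanging sum and time integral. The dissipation occurs twice on the left and
    once on the right; it may still be infinite, so nothing is cancelled yet.\<close>
  have master: "E \<mu> t + 2 * (ennreal \<nu> * (\<integral>\<^sup>+ s. indicator {0..t} s * D \<mu> s \<partial>L)) \<le>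
      E \<mu> 0 + (ennreal \<nu> * (\<integral>\<^sup>+ s. indicator {0..t} s * D \<mu> s \<partial>L) +
        (\<integral>\<^sup>+ s. indicator {0..t} s * (b s * E \<mu> s) \<partial>L) + (\<integral>\<^sup>+ s. H s \<partial>L))"
    if t: "t \<in> {0..T}" and wt: "sobolev_weight \<beta> \<mu>" for t \<mu>
  proof -
    note [measurable] = ind[OF t]
    have 1: "(\<integral>\<^sup>+ k. ennreal ((\<mu> k)\<^sup>2) * (ennreal (2 * \<nu> * kn k powr (2 * \<beta>)) *
        (\<integral>\<^sup>+ s. indicator {0..t} s * ennreal ((x s k)\<^sup>2) \<partial>L)) \<partial>count_space UNIV) =
       2 * (ennreal \<nu> * (\<integral>\<^sup>+ s. indicator {0..t} s * D \<mu> s \<partial>L))"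
    proof -
      have "(\<integral>\<^sup>+ k. ennreal ((\<mu> k)\<^sup>2) * (ennreal (2 * \<nu> * kn k powr (2 * \<beta>)) *
        (\<integral>\<^sup>+ s. indicator {0..t} s * ennreal ((x s k)\<^sup>2) \<partial>L)) \<partial>count_space UNIV) =
        (\<integral>\<^sup>+ k. \<integral>\<^sup>+ s. ennreal (2 * \<nu>) * (indicator {0..t} s * ennreal (kn k powr (2 * \<beta>) * (\<mu> k * x s k)\<^sup>2)) \<partial>L \<partial>count_space UNIV)"
      proof (rule nn_integral_cong)
        fix k
        have "ennreal ((\<mu> k)\<^sup>2) * (ennreal (2 * \<nu> * kn k powr (2 * \<beta>)) *
          (\<integral>\<^sup>+ s. indicator {0..t} s * ennreal ((x s k)\<^sup>2) \<partial>L)) =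
          (\<integral>\<^sup>+ s. ennreal ((\<mu> k)\<^sup>2) * (ennreal (2 * \<nu> * kn k powr (2 * \<beta>)) * (indicator {0..t} s * ennreal ((x s k)\<^sup>2))) \<partial>L)"
          by (simp add: nn_integral_cmult)
        also have "\<dots> = (\<integral>\<^sup>+ s. ennreal (2 * \<nu>) * (indicator {0..t} s * ennreal (kn k powr (2 * \<beta>) * (\<mu> k * x s k)\<^sup>2)) \<partial>L)"
          by (rule nn_integral_cong) (use pos in \<open>simp add: ennreal_mult' power_mult_distrib mult_ac\<close>)
        finally show "ennreal ((\<mu> k)\<^sup>2) * (ennreal (2 * \<nu> * kn k powr (2 * \<beta>)) *
          (\<integral>\<^sup>+ s. indicator {0..t} s * ennreal ((x s k)\<^sup>2) \<partial>L)) =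
          (\<integral>\<^sup>+ s. ennreal (2 * \<nu>) * (indicator {0..t} s * ennreal (kn k powr (2 * \<beta>) * (\<mu> k * x s k)\<^sup>2)) \<partial>L)" .
      qed
      also have "\<dots> = (\<integral>\<^sup>+ s. \<integral>\<^sup>+ k. ennreal (2 * \<nu>) * (indicator {0..t} s * ennreal (kn k powr (2 * \<beta>) * (\<mu> k * x s k)\<^sup>2)) \<partial>count_space UNIV \<partial>L)"
        by (rule nn_integral_count_space_nn_integral[symmetric]) auto
      also have "\<dots> = (\<integral>\<^sup>+ s. ennreal (2 * \<nu>) * (indicator {0..t} s * D \<mu> s) \<partial>L)"
        by (simp add: D_def nn_integral_cmult)
      also have "\<dots> = ennreal (2 * \<nu>) * (\<integral>\<^sup>+ s. indicator {0..t} s * D \<mu> s \<partial>L)"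
        by (rule nn_integral_cmult) measurable
      also have "ennreal (2 * \<nu>) = 2 * ennreal \<nu>" by (subst ennreal_mult') auto
      finally show ?thesis by (simp only: mult.assoc)
    qed
    have 2: "(\<integral>\<^sup>+ k. ennreal ((\<mu> k)\<^sup>2) * (\<integral>\<^sup>+ s. indicator {0..t} s * R s k \<partial>L) \<partial>count_space UNIV) \<le>
       ennreal \<nu> * (\<integral>\<^sup>+ s. indicator {0..t} s * D \<mu> s \<partial>L) +
        (\<integral>\<^sup>+ s. indicator {0..t} s * (b s * E \<mu> s) \<partial>L) + (\<integral>\<^sup>+ s. H s \<partial>L)"
    proof -
      have "(\<integral>\<^sup>+ k. ennreal ((\<mu> k)\<^sup>2) * (\<integral>\<^sup>+ s. indicator {0..t} s * R s k \<partial>L) \<partial>count_space UNIV) =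
        (\<integral>\<^sup>+ k. \<integral>\<^sup>+ s. ennreal ((\<mu> k)\<^sup>2) * (indicator {0..t} s * R s k) \<partial>L \<partial>count_space UNIV)"
        by (simp add: nn_integral_cmult)
      also have "\<dots> = (\<integral>\<^sup>+ s. \<integral>\<^sup>+ k. indicator {0..t} s * (ennreal ((\<mu> k)\<^sup>2) * R s k) \<partial>count_space UNIV \<partial>L)"
        by (subst nn_integral_count_space_nn_integral) (auto simp: mult_ac)
      also have "\<dots> = (\<integral>\<^sup>+ s. indicator {0..t} s * (\<integral>\<^sup>+ k. ennreal ((\<mu> k)\<^sup>2) * R s k \<partial>count_space UNIV) \<partial>L)"
        by (simp add: nn_integral_cmult)
      also have "\<dots> \<le> (\<integral>\<^sup>+ s. ennreal \<nu> * (indicator {0..t} s * D \<mu> s) + indicator {0..t} s * (b s * E \<mu> s) + H s \<partial>L)"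
      proof (rule nn_integral_mono)
        fix s assume "s \<in> space L"
        then have "indicator {0..t} s * (\<integral>\<^sup>+ k. ennreal ((\<mu> k)\<^sup>2) * R s k \<partial>count_space UNIV) \<le>
            indicator {0..t} s * (ennreal \<nu> * D \<mu> s + b s * E \<mu> s + H s)"
          using wt spL by (intro mult_left_mono R_le) auto
        also have "\<dots> \<le> ennreal \<nu> * (indicator {0..t} s * D \<mu> s) + indicator {0..t} s * (b s * E \<mu> s) + H s"
          by (cases "s \<in> {0..t}") auto
        finally show "indicator {0..t} s * (\<integral>\<^sup>+ k. ennreal ((\<mu> k)\<^sup>2) * R s k \<partial>count_space UNIV) \<le>
          ennreal \<nu> * (indicator {0..t} s * D \<mu> s) + indicator {0..t} s * (b s * E \<mu> s) + H s" .
      qed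
      also have "\<dots> = ennreal \<nu> * (\<integral>\<^sup>+ s. indicator {0..t} s * D \<mu> s \<partial>L) +
        (\<integral>\<^sup>+ s. indicator {0..t} s * (b s * E \<mu> s) \<partial>L) + (\<integral>\<^sup>+ s. H s \<partial>L)"
        by (simp add: nn_integral_add nn_integral_cmult)
      finally show ?thesis .
    qed
    have "E \<mu> t + 2 * (ennreal \<nu> * (\<integral>\<^sup>+ s. indicator {0..t} s * D \<mu> s \<partial>L)) =
      (\<integral>\<^sup>+ k. ennreal ((\<mu> k)\<^sup>2) * (ennreal ((x t k)\<^sup>2) + ennreal (2 * \<nu> * kn k powr (2 * \<beta>)) *
        (\<integral>\<^sup>+ s. indicator {0..t} s * ennreal ((x s k)\<^sup>2) \<partial>L)) \<partial>count_space UNIV)"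
      by (simp add: distrib_left nn_integral_add 1) (simp add: E_def power_mult_distrib ennreal_mult')
    also have "\<dots> \<le> (\<integral>\<^sup>+ k. ennreal ((\<mu> k)\<^sup>2) * (ennreal ((x 0 k)\<^sup>2) +
        (\<integral>\<^sup>+ s. indicator {0..t} s * R s k \<partial>L)) \<partial>count_space UNIV)"
      unfolding R_def using t by (intro nn_integral_mono mult_left_mono energy) auto
    also have "\<dots> = E \<mu> 0 + (\<integral>\<^sup>+ k. ennreal ((\<mu> k)\<^sup>2) * (\<integral>\<^sup>+ s. indicator {0..t} s * R s k \<partial>L) \<partial>count_space UNIV)"
      by (simp add: distrib_left nn_integral_add) (simp add: E_def power_mult_distrib ennreal_mult')
    finally show ?thesis using 2 by (meson add_left_mono order_trans)
  qed
  \<comment> \<open>The cutoff is n + 1, so that it is at least 1 also for n = 0.\<close>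
  define \<mu>n where "\<mu>n n k = min (kn k) (real n + 1) powr \<beta>" for n k
  define \<mu>i where "\<mu>i k = kn k powr \<beta>" for k
  have wtn: "sobolev_weight \<beta> (\<mu>n n)" for n
    unfolding \<mu>n_def by (rule sobolev_weight_powr(2)[OF beta]) simp
  have wti: "sobolev_weight \<beta> \<mu>i"
    unfolding \<mu>i_def by (rule sobolev_weight_powr(1)[OF beta])
  have mun: "0 \<le> \<mu>n n k" "\<mu>n n k \<le> (real n + 1) powr \<beta>" "\<mu>n n k \<le> \<mu>i k" for n k
    unfolding \<mu>n_def \<mu>i_def using beta by (auto intro!: powr_mono2)
  have mun_ev: "eventually (\<lambda>n. \<mu>n n k = \<mu>i k) sequentially" for k
  proof -
    obtain N where "kn k \<le> real N" using real_arch_simple by blast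
    then have "\<forall>n\<ge>N. \<mu>n n k = \<mu>i k" by (auto simp: \<mu>n_def \<mu>i_def min_def)
    then show ?thesis unfolding eventually_sequentially by blast
  qed
  have mi2: "(\<mu>i k * y)\<^sup>2 = kn k powr (2 * \<beta>) * y\<^sup>2" for k y
    by (simp add: \<mu>i_def power_mult_distrib powr_square)
  define F where "F = E \<mu>i 0 + (\<integral>\<^sup>+ s. H s \<partial>L)"
  have Ei0: "E \<mu>i 0 < \<infinity>" using init by (simp add: E_def mi2)
  have Ffin: "F < \<infinity>" using Ei0 Hfin by (simp add: F_def)
  have scaled: "lsum (\<lambda>k. a k * (\<mu>n n k * x t k)\<^sup>2) \<le> ennreal (((real n + 1) powr \<beta>)\<^sup>2) * lsum (\<lambda>k. a k * (x t k)\<^sup>2)"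
    if "\<And>k. 0 \<le> a k" for a n t
  proof -
    have "lsum (\<lambda>k. a k * (\<mu>n n k * x t k)\<^sup>2) \<le> (\<integral>\<^sup>+ k. ennreal (((real n + 1) powr \<beta>)\<^sup>2) * ennreal (a k * (x t k)\<^sup>2) \<partial>count_space UNIV)"
    proof (rule nn_integral_mono)
      fix k
      have "(\<mu>n n k)\<^sup>2 \<le> ((real n + 1) powr \<beta>)\<^sup>2" using mun by (intro power_mono) auto
      then have "(\<mu>n n k)\<^sup>2 * (a k * (x t k)\<^sup>2) \<le> ((real n + 1) powr \<beta>)\<^sup>2 * (a k * (x t k)\<^sup>2)"
        using that by (intro mult_right_mono) auto
      then have "ennreal (a k * (\<mu>n n k * x t k)\<^sup>2) \<le> ennreal (((real n + 1) powr \<beta>)\<^sup>2 * (a k * (x t k)\<^sup>2))"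
        by (intro ennreal_leI) (simp add: power_mult_distrib mult_ac)
      then show "ennreal (a k * (\<mu>n n k * x t k)\<^sup>2) \<le> ennreal (((real n + 1) powr \<beta>)\<^sup>2) * ennreal (a k * (x t k)\<^sup>2)"
        by (simp add: ennreal_mult')
    qed
    then show ?thesis by (simp add: nn_integral_cmult)
  qed
  \<comment> \<open>A bounded weight reduces the dissipation to a multiple of the squared V^\<beta>
    norm, which is integrable by assumption. This finiteness licenses the cancellation in
    \<open>absorbed\<close>.\<close>
  have Dn_fin: "(\<integral>\<^sup>+ s. indicator {0..t} s * D (\<mu>n n) s \<partial>L) < \<infinity>" for n t
  proof -
    have "(\<integral>\<^sup>+ s. indicator {0..t} s * D (\<mu>n n) s \<partial>L) \<le> (\<integral>\<^sup>+ s. ennreal (((real n + 1) powr \<beta>)\<^sup>2) *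
        lsum (\<lambda>k. kn k powr (2 * \<beta>) * (x s k)\<^sup>2) \<partial>L)"
    proof (rule nn_integral_mono)
      fix s
      have "indicator {0..t} s * D (\<mu>n n) s \<le> D (\<mu>n n) s" by (simp add: indicator_def)
      also have "\<dots> \<le> ennreal (((real n + 1) powr \<beta>)\<^sup>2) * lsum (\<lambda>k. kn k powr (2 * \<beta>) * (x s k)\<^sup>2)"
        unfolding D_def by (rule scaled) simp
      finally show "indicator {0..t} s * D (\<mu>n n) s \<le>
        ennreal (((real n + 1) powr \<beta>)\<^sup>2) * lsum (\<lambda>k. kn k powr (2 * \<beta>) * (x s k)\<^sup>2)" .
    qed
    also have "\<dots> < \<infinity>" using B by (simp add: nn_integral_cmult ennreal_mult_less_top)
    finally show ?thesis .
  qed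
  have En0: "E (\<mu>n n) 0 \<le> E \<mu>i 0" for n
    unfolding E_def using mun x by (intro nn_integral_mono ennreal_leI power_mono mult_right_mono) auto
  have absorbed: "E (\<mu>n n) t + ennreal \<nu> * (\<integral>\<^sup>+ s. indicator {0..t} s * D (\<mu>n n) s \<partial>L) \<le>
      F + (\<integral>\<^sup>+ s. indicator {0..t} s * (b s * E (\<mu>n n) s) \<partial>L)" if t: "t \<in> {0..T}" for n t
  proof -
    let ?X = "ennreal \<nu> * (\<integral>\<^sup>+ s. indicator {0..t} s * D (\<mu>n n) s \<partial>L)"
    let ?Y = "\<integral>\<^sup>+ s. indicator {0..t} s * (b s * E (\<mu>n n) s) \<partial>L"
    have Xfin: "?X < \<infinity>" using Dn_fin by (simp add: ennreal_mult_less_top)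
    have "?X + (E (\<mu>n n) t + ?X) = E (\<mu>n n) t + (?X + ?X)" by (simp only: ac_simps)
    also have "\<dots> = E (\<mu>n n) t + 2 * ?X" by (simp only: mult_2[where z = ?X])
    also have "\<dots> \<le> E (\<mu>n n) 0 + (?X + ?Y + (\<integral>\<^sup>+ s. H s \<partial>L))" by (rule master[OF t wtn])
    also have "\<dots> \<le> E \<mu>i 0 + (?X + ?Y + (\<integral>\<^sup>+ s. H s \<partial>L))" by (rule add_right_mono[OF En0])
    also have "\<dots> = ?X + (F + ?Y)" by (simp add: F_def ac_simps)
    finally show ?thesis using Xfin by (auto simp: ennreal_add_left_cancel_le)
  qed
  obtain G where G0: "0 \<le> G" and G: "\<And>E a t K. E \<in> borel_measurable (lebesgue_on {0..T}) \<Longrightarrow>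
     (\<And>t. t \<in> {0..T} \<Longrightarrow> E t \<le> ennreal K) \<Longrightarrow>
     (\<And>t. t \<in> {0..T} \<Longrightarrow> E t \<le> a + (\<integral>\<^sup>+ s. indicator {0..t} s * (b s * E s) \<partial>lebesgue_on {0..T})) \<Longrightarrow>
     t \<in> {0..T} \<Longrightarrow> E t \<le> ennreal G * a"
    using gronwall_ennreal[OF bm[unfolded L_def] bfin[unfolded L_def]] by blast
  have En: "E (\<mu>n n) t \<le> ennreal G * F" if t: "t \<in> {0..T}" for n t
  proof (rule G[OF _ _ _ t])
    show "E (\<mu>n n) \<in> borel_measurable (lebesgue_on {0..T})" using Em by (simp add: L_def)
    \<comment> \<open>This bound grows with n, but it only supplies the finiteness required by
      Gronwall's inequality; the resulting bound \<open>ennreal G * F\<close> is the same for all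
      n.\<close>
    show "E (\<mu>n n) t \<le> ennreal (((real n + 1) powr \<beta>)\<^sup>2 * A0)" if "t \<in> {0..T}" for t
    proof -
      have "E (\<mu>n n) t \<le> ennreal (((real n + 1) powr \<beta>)\<^sup>2) * lsum (\<lambda>k. (x t k)\<^sup>2)"
        unfolding E_def using scaled[of "\<lambda>_. 1"] by simp
      also have "\<dots> \<le> ennreal (((real n + 1) powr \<beta>)\<^sup>2) * ennreal A0"
        by (rule mult_left_mono[OF A[OF that]]) simp
      finally show ?thesis by (simp add: ennreal_mult')
    qed
    show "E (\<mu>n n) t \<le> F + (\<integral>\<^sup>+ s. indicator {0..t} s * (b s * E (\<mu>n n) s) \<partial>lebesgue_on {0..T})"
      if "t \<in> {0..T}" for t
      using absorbed[OF that, of n] unfolding L_def by (rule order_trans[rotated]) simp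
  qed
  define S where "S = ennreal G * F"
  have Sfin: "S < \<infinity>" using Ffin by (simp add: S_def ennreal_mult_less_top)
  have Ei: "E \<mu>i t \<le> S" if t: "t \<in> {0..T}" for t
    unfolding E_def
  proof (rule nn_integral_count_space_le_of_eventually_eq)
    show "eventually (\<lambda>n. ennreal ((\<mu>n n k * x t k)\<^sup>2) = ennreal ((\<mu>i k * x t k)\<^sup>2)) sequentially" for k
      using mun_ev[of k] by eventually_elim simp
    show "lsum (\<lambda>k. (\<mu>n n k * x t k)\<^sup>2) \<le> S" for n
      using En[OF t, of n] by (simp add: E_def S_def)
  qed
  have bE: "(\<integral>\<^sup>+ s. indicator {0..t} s * (b s * E \<mu> s) \<partial>L) \<le> (\<integral>\<^sup>+ s. b s \<partial>L) * S"
    if "\<And>s. s \<in> {0..T} \<Longrightarrow> E \<mu> s \<le> S" for \<mu> t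
  proof -
    have "(\<integral>\<^sup>+ s. indicator {0..t} s * (b s * E \<mu> s) \<partial>L) \<le> (\<integral>\<^sup>+ s. b s * S \<partial>L)"
    proof (rule nn_integral_mono)
      fix s assume "s \<in> space L"
      then have "b s * E \<mu> s \<le> b s * S" using that spL by (intro mult_left_mono) auto
      then show "indicator {0..t} s * (b s * E \<mu> s) \<le> b s * S" by (simp add: indicator_def)
    qed
    then show ?thesis by (simp add: nn_integral_multc)
  qed
  have TT: "T \<in> {0..T}" using pos by simp
  have indT: "(\<integral>\<^sup>+ s. indicator {0..T} s * f s \<partial>L) = (\<integral>\<^sup>+ s. f s \<partial>L)" for f :: "real \<Rightarrow> ennreal"
    by (rule nn_integral_cong) (simp add: spL)
  define S2 where "S2 = F + (\<integral>\<^sup>+ s. b s \<partial>L) * S"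
  have S2fin: "S2 < \<infinity>" using Ffin bfin Sfin by (simp add: S2_def ennreal_mult_less_top)
  have Dn: "ennreal \<nu> * (\<integral>\<^sup>+ s. D (\<mu>n n) s \<partial>L) \<le> S2" for n
  proof -
    have "ennreal \<nu> * (\<integral>\<^sup>+ s. D (\<mu>n n) s \<partial>L) \<le> F + (\<integral>\<^sup>+ s. indicator {0..T} s * (b s * E (\<mu>n n) s) \<partial>L)"
      using absorbed[OF TT, of n] unfolding indT by (rule order_trans[rotated]) simp
    also have "\<dots> \<le> S2" unfolding S2_def using En by (intro add_left_mono bE) (auto simp: S_def)
    finally show ?thesis .
  qed
  \<comment> \<open>The sum is taken outside the time integral so that the limit in n can again be
    taken mode by mode.\<close>
  have swap: "ennreal \<nu> * (\<integral>\<^sup>+ s. D \<mu> s \<partial>L) =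
     (\<integral>\<^sup>+ k. ennreal \<nu> * (\<integral>\<^sup>+ s. ennreal (kn k powr (2 * \<beta>) * (\<mu> k * x s k)\<^sup>2) \<partial>L) \<partial>count_space UNIV)" for \<mu>
    unfolding D_def by (subst nn_integral_count_space_nn_integral) (auto simp: nn_integral_cmult)
  have "ennreal \<nu> * (\<integral>\<^sup>+ s. D \<mu>i s \<partial>L) \<le> S2"
    unfolding swap
  proof (rule nn_integral_count_space_le_of_eventually_eq)
    show "eventually (\<lambda>n. ennreal \<nu> * (\<integral>\<^sup>+ s. ennreal (kn k powr (2 * \<beta>) * (\<mu>n n k * x s k)\<^sup>2) \<partial>L) =
        ennreal \<nu> * (\<integral>\<^sup>+ s. ennreal (kn k powr (2 * \<beta>) * (\<mu>i k * x s k)\<^sup>2) \<partial>L)) sequentially" for k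
      using mun_ev[of k] by eventually_elim simp
    show "(\<integral>\<^sup>+ k. ennreal \<nu> * (\<integral>\<^sup>+ s. ennreal (kn k powr (2 * \<beta>) * (\<mu>n n k * x s k)\<^sup>2) \<partial>L) \<partial>count_space UNIV) \<le> S2" for n
      using Dn[of n] unfolding swap .
  qed
  then have "ennreal \<nu> * (\<integral>\<^sup>+ s. D \<mu>i s \<partial>L) < \<infinity>" using S2fin by (rule le_less_trans)
  then have Difin: "(\<integral>\<^sup>+ s. D \<mu>i s \<partial>L) < \<infinity>" using pos by (auto simp: ennreal_mult_less_top)
  \<comment> \<open>Initial energy plus the forcing accumulated over the whole interval, the
    dissipation being dropped: this dominates the mode at every time. It is summable by the estimate
    for the full weight, because \<open>E \<mu>i\<close> is already known to be bounded and
    \<open>D \<mu>i\<close> to be integrable.\<close>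
  define q where "q k = ennreal ((\<mu>i k)\<^sup>2) * (ennreal ((x 0 k)\<^sup>2) + (\<integral>\<^sup>+ s. R s k \<partial>L))" for k
  show ?thesis
  proof (rule that)
    show "ennreal (kn k powr (2 * \<beta>) * (x t k)\<^sup>2) \<le> q k" if t: "t \<in> {0..T}" for t k
    proof -
      have "ennreal ((x t k)\<^sup>2) \<le> ennreal ((x t k)\<^sup>2) + ennreal (2 * \<nu> * kn k powr (2 * \<beta>)) *
          (\<integral>\<^sup>+ s. indicator {0..t} s * ennreal ((x s k)\<^sup>2) \<partial>L)" by simp
      also have "\<dots> \<le> ennreal ((x 0 k)\<^sup>2) + (\<integral>\<^sup>+ s. indicator {0..t} s * R s k \<partial>L)"
        unfolding R_def by (rule energy[OF t])
      also have "\<dots> \<le> ennreal ((x 0 k)\<^sup>2) + (\<integral>\<^sup>+ s. R s k \<partial>L)"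
        by (intro add_left_mono nn_integral_mono) (simp add: indicator_def)
      finally have "ennreal ((\<mu>i k)\<^sup>2) * ennreal ((x t k)\<^sup>2) \<le> q k"
        unfolding q_def by (rule mult_left_mono) simp
      then show ?thesis by (simp add: ennreal_mult'[symmetric] mi2 flip: power_mult_distrib)
    qed
    have "(\<integral>\<^sup>+ k. q k \<partial>count_space UNIV) = E \<mu>i 0 +
        (\<integral>\<^sup>+ s. \<integral>\<^sup>+ k. ennreal ((\<mu>i k)\<^sup>2) * R s k \<partial>count_space UNIV \<partial>L)"
    proof -
      have "(\<integral>\<^sup>+ k. q k \<partial>count_space UNIV) = E \<mu>i 0 +
        (\<integral>\<^sup>+ k. \<integral>\<^sup>+ s. ennreal ((\<mu>i k)\<^sup>2) * R s k \<partial>L \<partial>count_space UNIV)"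
        unfolding q_def by (simp add: distrib_left nn_integral_add nn_integral_cmult)
          (simp add: E_def power_mult_distrib ennreal_mult')
      then show ?thesis by (subst nn_integral_count_space_nn_integral) auto
    qed
    also have "\<dots> \<le> E \<mu>i 0 + (\<integral>\<^sup>+ s. ennreal \<nu> * D \<mu>i s + indicator {0..T} s * (b s * E \<mu>i s) + H s \<partial>L)"
    proof (intro add_left_mono nn_integral_mono)
      fix s assume "s \<in> space L"
      then have s: "s \<in> {0..T}" by (simp add: spL)
      then show "(\<integral>\<^sup>+ k. ennreal ((\<mu>i k)\<^sup>2) * R s k \<partial>count_space UNIV) \<le>
         ennreal \<nu> * D \<mu>i s + indicator {0..T} s * (b s * E \<mu>i s) + H s"
        using R_le[OF s wti] by simp
    qed
    also have "\<dots> = E \<mu>i 0 + (ennreal \<nu> * (\<integral>\<^sup>+ s. D \<mu>i s \<partial>L) +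
        (\<integral>\<^sup>+ s. indicator {0..T} s * (b s * E \<mu>i s) \<partial>L) + (\<integral>\<^sup>+ s. H s \<partial>L))"
    proof -
      note [measurable] = ind[OF TT]
      show ?thesis by (simp add: nn_integral_add nn_integral_cmult)
    qed
    also have "\<dots> < \<infinity>"
    proof -
      have "(\<integral>\<^sup>+ s. indicator {0..T} s * (b s * E \<mu>i s) \<partial>L) < \<infinity>"
        using bE[OF Ei, of T] bfin Sfin by (auto simp: ennreal_mult_less_top intro: le_less_trans)
      then show ?thesis using Ei0 Hfin Difin by (simp add: ennreal_mult_less_top)
    qed
    finally show "(\<integral>\<^sup>+ k. q k \<partial>count_space UNIV) < \<infinity>" .
    have "kn k powr (2 * \<beta>) * (\<mu>i k * x t k)\<^sup>2 = kn k powr (4 * \<beta>) * (x t k)\<^sup>2" for k t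
      by (simp add: mi2 mult.assoc[symmetric] powr_add[symmetric])
    then show "(\<integral>\<^sup>+ t. lsum (\<lambda>k. kn k powr (4 * \<beta>) * (x t k)\<^sup>2) \<partial>L) < \<infinity>"
      using Difin by (simp add: D_def)
  qed
qed

section \<open>Single Fourier modes\<close>

text \<open>The real inner product of the library on C^3 is the real part of the Hermitian one. Real
  pairings against all vectors therefore determine a complex coefficient.\<close>

lemma inner_eq_Re_vdot: "inner a b = Re (vdot a b)"
  by (simp add: vdot_def inner_vec_def inner_complex_def)

lemma vdot_simps:
  "vdot (a + b) c = vdot a c + vdot b c" "vdot (a - b) c = vdot a c - vdot b c"
  "vdot (z *s a) c = z * vdot a c" "vdot (r *\<^sub>R a) c = r *\<^sub>R vdot a c"
  "vdot a (r *\<^sub>R c) = r *\<^sub>R vdot a c" "vdot 0 c = 0" "vdot a 0 = 0"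
  "vdot (- a) c = - vdot a c"
  by (simp_all add: vdot_def sum.distrib sum_negf sum_subtractf sum_distrib_left scaleR_sum_right algebra_simps)

lemma cnj_vdot: "cnj (vdot a b) = vdot b a"
  by (simp add: vdot_def mult.commute)

lemma vdot_vcnj: "vdot (vcnj a) (vcnj b) = cnj (vdot a b)"
  by (simp add: vdot_def vcnj_def)

lemma vcnj_simps [simp]: "vcnj (vcnj a) = a" "norm (vcnj a) = norm a" "vcnj 0 = 0"
  by (simp_all add: vcnj_def vec_eq_iff norm_vec_def)

lemma norm_vdot_le: "cmod (vdot a b) \<le> norm a * norm b"
proof -
  have "cmod (vdot a b) \<le> (\<Sum>i\<in>UNIV. \<bar>cmod (a $ i)\<bar> * \<bar>cmod (b $ i)\<bar>)"
    unfolding vdot_def by (rule order_trans[OF norm_sum]) (simp add: norm_mult)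
  also have "\<dots> \<le> L2_set (\<lambda>i. cmod (a $ i)) UNIV * L2_set (\<lambda>i. cmod (b $ i)) UNIV"
    by (rule L2_set_mult_ineq)
  finally show ?thesis by (simp add: norm_vec_def)
qed

lemma norm_vector_scalar_mult: "norm (z *s a) = cmod z * norm a" for a :: "complex ^ 3"
  by (simp add: norm_vec_def norm_mult L2_set_right_distrib)

lemma norm_kvec: "norm (kvec k) = kn k"
  by (simp add: kvec_def norm_vec_def kn_def L2_set_def)

lemma kdot_eq_vdot: "kdot w k = vdot w (kvec k)"
  by (simp add: kdot_def vdot_def kvec_def)

lemma norm_kdot_le: "cmod (kdot w k) \<le> norm w * kn k"
  using norm_vdot_le[of w "kvec k"] by (simp add: kdot_eq_vdot norm_kvec)

lemma kdot_minus [simp]: "kdot w (- k) = - kdot w k"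
  by (simp add: kdot_def sum_negf)

lemma kdot_vcnj: "kdot (vcnj w) k = cnj (kdot w k)"
  by (simp add: kdot_def vcnj_def)

lemma vdot_kvec: "vdot (kvec k) (kvec k) = complex_of_real ((kn k)\<^sup>2)"
proof -
  have "(kn k)\<^sup>2 = (\<Sum>i\<in>UNIV. (real_of_int (k $ i))\<^sup>2)" by (simp add: kn_def sum_nonneg)
  then show ?thesis by (simp add: vdot_def kvec_def power2_eq_square)
qed

text \<open>The symbol of the Leray projection at a single frequency, as a linear map on
  C^3.\<close>

definition perp_proj :: "wvec \<Rightarrow> complex ^ 3 \<Rightarrow> complex ^ 3" where
  "perp_proj k a = a - (kdot a k / complex_of_real ((kn k)\<^sup>2)) *s kvec k"

lemma kdot_perp_proj: "k \<noteq> 0 \<Longrightarrow> kdot (perp_proj k a) k = 0"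
  by (simp add: perp_proj_def kdot_eq_vdot vdot_simps vdot_kvec)

lemma vdot_perp_proj:
  assumes "kdot w k = 0"
  shows "vdot (perp_proj k a) w = vdot a w"
proof -
  have "vdot (kvec k) w = 0" using assms cnj_vdot[of w "kvec k"] by (simp add: kdot_eq_vdot)
  then show ?thesis by (simp add: perp_proj_def vdot_simps)
qed

lemma inner_perp_proj:
  assumes "kdot w k = 0"
  shows "inner w (perp_proj k a) = inner w a" "inner (perp_proj k a) w = inner a w"
proof -
  show "inner (perp_proj k a) w = inner a w"
    using vdot_perp_proj[OF assms] by (simp add: inner_eq_Re_vdot)
  then show "inner w (perp_proj k a) = inner w a" by (simp add: inner_commute)
qed

text \<open>Self-adjointness: a projection imposed on the test vector can be moved to the right-hand
  side of the equation.\<close>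

lemma inner_perp_proj_swap:
  assumes "k \<noteq> 0"
  shows "inner (perp_proj k a) b = inner a (perp_proj k b)"
  using inner_perp_proj(1)[OF kdot_perp_proj[OF assms, of a], of b]
    inner_perp_proj(2)[OF kdot_perp_proj[OF assms, of b], of a] by simp

lemma linear_perp_proj: "bounded_linear (perp_proj k)"
proof -
  have "linear (perp_proj k)"
  proof
    show "perp_proj k (a + b) = perp_proj k a + perp_proj k b" for a b
      by (simp add: perp_proj_def kdot_eq_vdot vdot_simps add_divide_distrib vec_eq_iff algebra_simps)
    show "perp_proj k (r *\<^sub>R a) = r *\<^sub>R perp_proj k a" for r a
      by (simp add: perp_proj_def kdot_eq_vdot vdot_simps vec_eq_iff scaleR_conv_of_real[where 'a = complex] algebra_simps)
  qed
  then show ?thesis by (rule linear_conv_bounded_linear[THEN iffD1])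
qed

lemma leray_eq: "k \<noteq> 0 \<Longrightarrow> leray f k = perp_proj k (f k)"
  by (simp add: leray_def perp_proj_def)

text \<open>Test fields must be real, so a coefficient at k forces its conjugate at -k. In every
  pairing with a real field the two frequencies contribute conjugate values, whence the factor 2 in
  the formulas below.\<close>

definition vmode :: "wvec \<Rightarrow> complex ^ 3 \<Rightarrow> vfield" where
  "vmode k a = (\<lambda>m. if m = k then a else if m = - k then vcnj a else 0)"

definition smode :: "wvec \<Rightarrow> complex \<Rightarrow> sfield" where
  "smode k z = (\<lambda>m. if m = k then z else if m = - k then cnj z else 0)"

lemma wvec_neq_minus: "k \<noteq> 0 \<Longrightarrow> - k \<noteq> (k :: wvec)"
  by (auto simp: vec_eq_iff)

lemma infsum_two_point:
  fixes f :: "wvec \<Rightarrow> 'a::{topological_comm_monoid_add, t2_space}"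
  assumes "p \<noteq> q" "\<And>m. m \<noteq> p \<Longrightarrow> m \<noteq> q \<Longrightarrow> f m = 0"
  shows "infsum f UNIV = f p + f q"
proof -
  have "infsum f UNIV = infsum f {p, q}" by (rule infsum_cong_neutral) (use assms in auto)
  then show ?thesis using assms by simp
qed

lemma summable_two_point:
  fixes f :: "wvec \<Rightarrow> 'a::{topological_comm_monoid_add, t2_space}"
  assumes "\<And>m. m \<noteq> p \<Longrightarrow> m \<noteq> q \<Longrightarrow> f m = 0"
  shows "f summable_on UNIV"
proof -
  have "f summable_on {p, q}" by (rule summable_on_finite) simp
  then show ?thesis by (rule summable_on_cong_neutral[THEN iffD1, rotated -1]) (use assms in auto)
qed

lemma minus_eq_iff_eq_minus: "- m = k \<longleftrightarrow> m = - (k :: wvec)"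
  by auto

lemma Vs_vmode:
  assumes k: "k \<noteq> 0" and a: "kdot a k = 0"
  shows "Vs s (vmode k a)"
  unfolding Vs_def
proof (intro conjI allI)
  show "vmode k a 0 = 0" using k by (auto simp: vmode_def)
  show "vmode k a (- m) = vcnj (vmode k a m)" for m
    using wvec_neq_minus[OF k] by (auto simp: vmode_def minus_eq_iff_eq_minus)
  show "kdot (vmode k a m) m = 0" for m
    using a by (auto simp: vmode_def kdot_vcnj) (simp add: kdot_def)
  show "(\<lambda>m. (norm (vmode k a m))\<^sup>2 * kn m powr (2 * s)) summable_on UNIV"
    by (rule summable_two_point[of k "- k"]) (simp add: vmode_def)
qed

lemma Hs_smode:
  assumes k: "k \<noteq> 0"
  shows "Hs s (smode k z)"
  unfolding Hs_def
proof (intro conjI allI)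
  show "smode k z 0 = 0" using k by (auto simp: smode_def)
  show "smode k z (- m) = cnj (smode k z m)" for m
    using wvec_neq_minus[OF k] by (auto simp: smode_def minus_eq_iff_eq_minus)
  show "(\<lambda>m. (cmod (smode k z m))\<^sup>2 * kn m powr (2 * s)) summable_on UNIV"
    by (rule summable_two_point[of k "- k"]) (simp add: smode_def)
qed

lemma l2v_vmode:
  assumes k: "k \<noteq> 0" and w: "\<And>m. w (- m) = vcnj (w m)"
  shows "l2v w (vmode k a) = (2 * pi) ^ 3 * (2 * inner (w k) a)"
proof -
  have "infsum (\<lambda>m. vdot (w m) (vmode k a m)) UNIV = vdot (w k) a + vdot (w (- k)) (vcnj a)"
    using wvec_neq_minus[OF k]
    by (subst infsum_two_point[of k "- k"]) (auto simp: vmode_def vdot_simps)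
  then show ?thesis by (simp add: l2v_def w vdot_vcnj inner_eq_Re_vdot)
qed

lemma l2s_smode:
  assumes k: "k \<noteq> 0" and f: "\<And>m. f (- m) = cnj (f m)"
  shows "l2s f (smode k z) = (2 * pi) ^ 3 * (2 * inner (f k) z)"
proof -
  have "infsum (\<lambda>m. f m * cnj (smode k z m)) UNIV = f k * cnj z + f (- k) * z"
    using wvec_neq_minus[OF k]
    by (subst infsum_two_point[of k "- k"]) (auto simp: smode_def)
  then show ?thesis by (simp add: l2s_def f inner_complex_def)
qed

lemma l2v_LamV_vmode:
  assumes k: "k \<noteq> 0" and w: "\<And>m. w (- m) = vcnj (w m)"
  shows "l2v (LamV s w) (LamV s (vmode k a)) = (2 * pi) ^ 3 * (2 * (kn k powr (2 * s) * inner (w k) a))"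
proof -
  have "infsum (\<lambda>m. vdot (LamV s w m) (LamV s (vmode k a) m)) UNIV =
     kn k powr s *\<^sub>R kn k powr s *\<^sub>R vdot (w k) a + kn k powr s *\<^sub>R kn k powr s *\<^sub>R vdot (w (- k)) (vcnj a)"
    using wvec_neq_minus[OF k]
    by (subst infsum_two_point[of k "- k"]) (auto simp: vmode_def LamV_def vdot_simps)
  moreover have "kn k powr s * kn k powr s = kn k powr (2 * s)"
    by (simp add: powr_square flip: power2_eq_square)
  ultimately show ?thesis by (simp add: l2v_def w vdot_vcnj inner_eq_Re_vdot)
qed

lemma l2v_theta_e3_vmode:
  assumes k: "k \<noteq> 0" and f: "\<And>m. f (- m) = cnj (f m)"
  shows "l2v (theta_e3 f) (vmode k a) = (2 * pi) ^ 3 * (2 * inner (f k *s e3) a)"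
proof -
  have "vcnj (z *s e3) = cnj z *s e3" for z by (simp add: vcnj_def e3_def vec_eq_iff)
  then show ?thesis using l2v_vmode[OF k, of "theta_e3 f" a] by (simp add: theta_e3_def f)
qed

text \<open>The Fourier coefficients of \<open>-(u \<cdot> \<nabla>) w\<close>, before projection. Since \<open>u\<close> is divergence
  free, \<open>u\<^sub>j \<cdot> (k - j) = u\<^sub>j \<cdot> k\<close>.\<close>
definition convection :: "vfield \<Rightarrow> vfield \<Rightarrow> vfield" where
  "convection u w k = infsum (\<lambda>j. (- \<i> * kdot (u j) k) *s w (k - j)) UNIV"

lemma convection_term_norm:
  fixes u w :: vfield
  shows "norm ((- \<i> * kdot (u j) k) *s w (k - j)) \<le> kn k * (norm (u j) * norm (w (k - j)))"
proof -
  have "norm ((- \<i> * kdot (u j) k) *s w (k - j)) = cmod (kdot (u j) k) * norm (w (k - j))"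
    unfolding norm_vector_scalar_mult by (simp add: norm_mult)
  also have "\<dots> \<le> norm (u j) * kn k * norm (w (k - j))"
    by (intro mult_right_mono norm_kdot_le) auto
  finally show ?thesis by (simp add: mult_ac)
qed

text \<open>The derivative falls on the test field, which has two modes, so each advection
  coefficient has two terms; the projection disappears against the divergence-free w. The term of
  the mode -k at m is the conjugate of the term \<open>X\<close> of the mode k at -m. Both sums are
  thus conjugate to each other, and the substitution m = k - j turns them into the convolution
  defining \<open>convection\<close>.\<close>

lemma l2v_Bop_vmode:
  assumes k: "k \<noteq> 0" and a: "kdot a k = 0"
    and u: "\<And>m. u (- m) = vcnj (u m)" and w: "\<And>m. w (- m) = vcnj (w m)" "w 0 = 0" "\<And>m. kdot (w m) m = 0"
    and sm: "(\<lambda>j. norm (u j) * norm (w (k - j))) summable_on UNIV"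
  shows "l2v (Bop u (vmode k a)) w = (2 * pi) ^ 3 * (2 * inner (convection u w k) a)"
proof -
  have kk: "- k \<noteq> k" by (rule wvec_neq_minus[OF k])
  define X where "X m = \<i> * kdot (u (m - k)) k * vdot a (w m)" for m
  have adv: "advV u (vmode k a) m = (\<i> * kdot (u (m - k)) k) *s a - (\<i> * kdot (u (m + k)) k) *s vcnj a" for m
  proof -
    have "infsum (\<lambda>j. kdot (u j) (m - j) * \<i> * (vmode k a (m - j) $ i)) UNIV =
       \<i> * kdot (u (m - k)) k * a $ i - \<i> * kdot (u (m + k)) k * vcnj a $ i" for i
    proof -
      have "m - k \<noteq> m + k" using kk by (metis add_diff_cancel_left' diff_add_cancel diff_minus_eq_add)
      moreover have "m - j = k \<longleftrightarrow> j = m - k" "m - j = - k \<longleftrightarrow> j = m + k" for j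
        by (auto simp: algebra_simps eq_neg_iff_add_eq_0)
      ultimately show ?thesis
        using kk by (subst infsum_two_point[of "m - k" "m + k"]) (auto simp: vmode_def)
    qed
    then show ?thesis by (simp add: advV_def vec_eq_iff)
  qed
  have Xm: "X (- m) = cnj (- (\<i> * kdot (u (m + k)) k * vdot (vcnj a) (w m)))" for m
  proof -
    have "- m - k = - (m + k)" by simp
    then have "kdot (u (- m - k)) k = cnj (kdot (u (m + k)) k)" by (simp only: u kdot_vcnj)
    moreover have "vdot a (w (- m)) = cnj (vdot (vcnj a) (w m))"
      using vdot_vcnj[of "vcnj a" "w m"] by (simp add: w)
    ultimately show ?thesis by (simp add: X_def)
  qed
  have term_eq: "vdot (Bop u (vmode k a) m) (w m) = X m + cnj (X (- m))" for m
  proof (cases "m = 0")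
    case True
    then show ?thesis using w by (simp add: X_def vdot_simps)
  next
    case False
    then have "vdot (Bop u (vmode k a) m) (w m) = vdot (advV u (vmode k a) m) (w m)"
      by (simp add: Bop_def leray_eq vdot_perp_proj w)
    then show ?thesis by (simp add: Xm adv vdot_simps) (simp add: X_def)
  qed
  have bij: "bij_betw (\<lambda>j. k - j) UNIV (UNIV :: wvec set)"
    by (rule bij_betw_byWitness[where f' = "\<lambda>j. k - j"]) auto
  have bijm: "bij_betw uminus UNIV (UNIV :: wvec set)"
    by (rule bij_betw_byWitness[where f' = uminus]) auto
  have hsum: "(\<lambda>j. (- \<i> * kdot (u j) k) *s w (k - j)) summable_on UNIV"
    by (rule abs_summable_summable, rule summable_on_comparison_test[OF summable_on_cmult_right[OF sm, of "kn k"]])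
      (use convection_term_norm in auto)
  have ReX: "cnj (X (k - j)) = vdot ((- \<i> * kdot (u j) k) *s w (k - j)) a" for j
  proof -
    have "kdot (u (- j)) k = cnj (kdot (u j) k)" by (simp add: u kdot_vcnj)
    then show ?thesis by (simp add: X_def vdot_simps cnj_vdot)
  qed
  have bl: "bounded_linear (\<lambda>b. vdot b a)"
    by (rule bounded_linear_intro[where K = "norm a"]) (simp_all only: vdot_simps norm_vdot_le)
  have cX: "((\<lambda>j. cnj (X (k - j))) has_sum vdot (convection u w k) a) UNIV"
    unfolding ReX convection_def
    using has_sum_bounded_linear[OF bl has_sum_infsum[OF hsum]] by (simp add: o_def)
  then have "((\<lambda>j. cnj (cnj (X (k - j)))) has_sum cnj (vdot (convection u w k) a)) UNIV"
    by (simp only: has_sum_cnj_iff)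
  then have "((\<lambda>j. X (k - j)) has_sum cnj (vdot (convection u w k) a)) UNIV" by simp
  then have hX: "(X has_sum cnj (vdot (convection u w k) a)) UNIV"
    using has_sum_reindex_bij_betw[OF bij, of X] by simp
  have "((\<lambda>m. X (- m)) has_sum cnj (vdot (convection u w k) a)) UNIV"
    using has_sum_reindex_bij_betw[OF bijm, of X] hX by simp
  then have "((\<lambda>m. cnj (X (- m))) has_sum vdot (convection u w k) a) UNIV"
    using has_sum_cnj_iff[where f = "\<lambda>m. X (- m)" and a = "cnj (vdot (convection u w k) a)"] by simp
  from has_sum_add[OF hX this]
  have "infsum (\<lambda>m. vdot (Bop u (vmode k a) m) (w m)) UNIV =
     cnj (vdot (convection u w k) a) + vdot (convection u w k) a"
    unfolding term_eq by (rule infsumI)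
  then show ?thesis by (simp add: l2v_def inner_eq_Re_vdot)
qed

section \<open>Norms and coefficients\<close>

text \<open>Since \<open>infsum\<close> takes the value 0 on families that are not summable, a bound
  on it proves nothing by itself. Finiteness is therefore established for \<open>lsum\<close> and
  carried over by this lemma and the next.\<close>

lemma lsum_eq_infsum:
  assumes "f summable_on UNIV" "\<And>k. 0 \<le> f k"
  shows "lsum f = ennreal (infsum f UNIV)"
proof -
  have "(\<lambda>k. norm (f k)) summable_on UNIV" using assms by simp
  then have abs: "Infinite_Set_Sum.abs_summable_on f UNIV" by (rule abs_summable_equivalent[THEN iffD1])
  then have "infsetsum f UNIV = infsum f UNIV" by (rule infsetsum_infsum)
  with abs show ?thesis using assms nn_integral_conv_infsetsum[of f UNIV] by simp
qed

lemma summable_on_of_lsum_finite: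
  assumes "lsum f < \<infinity>" "\<And>k. 0 \<le> f k"
  shows "f summable_on UNIV"
proof -
  have "integrable (count_space UNIV) f"
    using assms by (intro integrableI_nonneg) auto
  then have "Infinite_Set_Sum.abs_summable_on f UNIV" by (simp add: Infinite_Set_Sum.abs_summable_on_def)
  then have "(\<lambda>k. norm (f k)) summable_on UNIV" by (rule abs_summable_equivalent[THEN iffD2])
  then show ?thesis using assms by simp
qed

lemma VsNorm_square:
  assumes "Vs s w"
  shows "ennreal ((VsNorm s w)\<^sup>2) = lsum (\<lambda>k. kn k powr (2 * s) * (norm (w k))\<^sup>2)"
proof -
  have "(\<lambda>k. (norm (w k))\<^sup>2 * kn k powr (2 * s)) summable_on UNIV" using assms by (simp add: Vs_def)
  from lsum_eq_infsum[OF this] show ?thesis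
    by (simp add: VsNorm_def infsum_nonneg mult.commute)
qed

lemma Vs_zero_lsum:
  assumes "Vs 0 w"
  shows "ennreal ((VsNorm 0 w)\<^sup>2) = lsum (\<lambda>k. (norm (w k))\<^sup>2)"
proof -
  \<comment> \<open>At k = 0 the weight is \<open>0 powr 0\<close>, which is 0 and not 1; the zero
    mean makes both sides agree there.\<close>
  have "w 0 = 0" using assms by (simp add: Vs_def)
  then have "kn k powr (2 * 0) * (norm (w k))\<^sup>2 = (norm (w k))\<^sup>2" for k by (cases "k = 0") auto
  then show ?thesis unfolding VsNorm_square[OF assms] by (simp only:)
qed

lemma Hs_zero_lsum:
  assumes "Hs 0 f"
  shows "ennreal ((HsNorm 0 f)\<^sup>2) = lsum (\<lambda>k. (cmod (f k))\<^sup>2)"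
proof -
  have "(\<lambda>k. (cmod (f k))\<^sup>2 * kn k powr (2 * 0)) summable_on UNIV" using assms by (simp add: Hs_def)
  from lsum_eq_infsum[OF this]
  have "ennreal ((HsNorm 0 f)\<^sup>2) = lsum (\<lambda>k. (cmod (f k))\<^sup>2 * kn k powr (2 * 0))"
    by (simp add: HsNorm_def infsum_nonneg)
  moreover have "f 0 = 0" using assms by (simp add: Hs_def)
  then have "(cmod (f k))\<^sup>2 * kn k powr (2 * 0) = (cmod (f k))\<^sup>2" for k by (cases "k = 0") auto
  ultimately show ?thesis by (simp only:)
qed

section \<open>From almost every time to every time, by weak continuity\<close>

lemma continuous_AE_le:
  fixes f :: "real \<Rightarrow> real"
  assumes T: "0 < T" and f: "continuous_on {0..T} f" and ae: "AE t in lebesgue_on {0..T}. f t \<le> c"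
    and t0: "t0 \<in> {0..T}"
  shows "f t0 \<le> c"
proof (rule ccontr)
  assume "\<not> f t0 \<le> c"
  then have "0 < f t0 - c" by simp
  then obtain d where d: "0 < d" "\<And>t. t \<in> {0..T} \<Longrightarrow> dist t t0 < d \<Longrightarrow> dist (f t) (f t0) < f t0 - c"
    using f t0 unfolding continuous_on_iff by metis
  define a b where "a = max 0 (t0 - d/2)" and "b = min T (t0 + d/2)"
  have ab: "a < b" "{a..b} \<subseteq> {0..T}" using T t0 d by (auto simp: a_def b_def)
  have gt: "c < f t" if "t \<in> {a..b}" for t
  proof -
    have "t \<in> {0..T}" "dist t t0 < d" using that ab d by (auto simp: a_def b_def dist_real_def)
    then show ?thesis using d(2)[of t] by (auto simp: dist_real_def abs_less_iff)
  qed
  have "AE t in lebesgue. t \<in> {0..T} \<longrightarrow> f t \<le> c"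
    using ae by (subst (asm) AE_restrict_space_iff) auto
  then have "AE t in lebesgue. t \<notin> {a..b}"
    by eventually_elim (use gt ab in fastforce)
  then have "{a..b} \<in> null_sets lebesgue" by (subst AE_iff_null_sets) auto
  then have "emeasure lebesgue {a..b} = 0" by (simp add: null_setsD1)
  then show False using ab by simp
qed

lemma continuous_on_of_inner:
  fixes f :: "real \<Rightarrow> 'a::euclidean_space"
  assumes "\<And>a. continuous_on S (\<lambda>t. inner (f t) a)"
  shows "continuous_on S f"
proof -
  have "continuous_on S (\<lambda>t. \<Sum>b\<in>Basis. inner (f t) b *\<^sub>R b)"
    by (intro continuous_intros assms)
  then show ?thesis by (simp add: euclidean_representation)
qed

text \<open>A test field needs a coefficient orthogonal to k, so an arbitrary vector a is first
  projected. Nothing is lost, because the coefficient of v is itself orthogonal to k.\<close>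

lemma CwV_coefficient_continuous:
  assumes "CwV T v"
  shows "continuous_on {0..T} (\<lambda>t. v t k)"
proof (cases "k = 0")
  case True
  then have "\<forall>t\<in>{0..T}. 0 = v t k" using assms by (simp add: CwV_def Vs_def)
  then show ?thesis by (intro continuous_on_eq[OF continuous_on_const[of _ 0]]) auto
next
  case False
  have V: "Vs 0 (v t)" if "t \<in> {0..T}" for t using assms that by (simp add: CwV_def)
  show ?thesis
  proof (rule continuous_on_of_inner)
    fix a
    have "continuous_on {0..T} (\<lambda>t. l2v (v t) (vmode k (perp_proj k a)))"
      using assms Vs_vmode[OF False kdot_perp_proj[OF False]] by (auto simp: CwV_def)
    then have "continuous_on {0..T} (\<lambda>t. l2v (v t) (vmode k (perp_proj k a)) / ((2 * pi) ^ 3 * 2))"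
      by (intro continuous_intros) auto
    moreover have "l2v (v t) (vmode k (perp_proj k a)) / ((2 * pi) ^ 3 * 2) = inner (v t k) a"
      if "t \<in> {0..T}" for t
      using V[OF that] False by (subst l2v_vmode) (auto simp: Vs_def inner_perp_proj)
    ultimately show "continuous_on {0..T} (\<lambda>t. inner (v t k) a)" by (rule continuous_on_eq)
  qed
qed

lemma CwH_coefficient_continuous:
  assumes "CwH T f"
  shows "continuous_on {0..T} (\<lambda>t. f t k)"
proof (cases "k = 0")
  case True
  then have "\<forall>t\<in>{0..T}. 0 = f t k" using assms by (simp add: CwH_def Hs_def)
  then show ?thesis by (intro continuous_on_eq[OF continuous_on_const[of _ 0]]) auto
next
  case False
  have V: "Hs 0 (f t)" if "t \<in> {0..T}" for t using assms that by (simp add: CwH_def)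
  show ?thesis
  proof (rule continuous_on_of_inner)
    fix a
    have "continuous_on {0..T} (\<lambda>t. l2s (f t) (smode k a))"
      using assms Hs_smode[OF False] by (auto simp: CwH_def)
    then have "continuous_on {0..T} (\<lambda>t. l2s (f t) (smode k a) / ((2 * pi) ^ 3 * 2))"
      by (intro continuous_intros) auto
    moreover have "l2s (f t) (smode k a) / ((2 * pi) ^ 3 * 2) = inner (f t k) a"
      if "t \<in> {0..T}" for t
      using V[OF that] False by (subst l2s_smode) (auto simp: Hs_def)
    ultimately show "continuous_on {0..T} (\<lambda>t. inner (f t k) a)" by (rule continuous_on_eq)
  qed
qed

text \<open>Weak continuity makes the full norm only lower semicontinuous in time. Sums over
  finitely many modes are continuous, so they satisfy the bound at every time, and the full sum is
  their supremum.\<close>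

lemma weak_bound_everywhere:
  assumes T: "0 < T" and v: "LinfV 0 T v" "CwV T v"
  obtains A0 where "0 \<le> A0" and "\<And>t. t \<in> {0..T} \<Longrightarrow> lsum (\<lambda>k. (norm (v t k))\<^sup>2) \<le> ennreal A0"
proof -
  obtain M where M: "AE t in lebesgue_on {0..T}. VsNorm 0 (v t) \<le> M"
    and V: "AE t in lebesgue_on {0..T}. Vs 0 (v t)"
    using v by (auto simp: LinfV_def)
  have fin: "(\<Sum>k\<in>K. (norm (v t k))\<^sup>2) \<le> M\<^sup>2" if K: "finite K" and t: "t \<in> {0..T}" for K t
  proof (rule continuous_AE_le[OF T _ _ t])
    show "continuous_on {0..T} (\<lambda>t. \<Sum>k\<in>K. (norm (v t k))\<^sup>2)"
      by (intro continuous_intros CwV_coefficient_continuous v)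
    show "AE t in lebesgue_on {0..T}. (\<Sum>k\<in>K. (norm (v t k))\<^sup>2) \<le> M\<^sup>2"
      using M V
    proof eventually_elim
      case (elim t)
      have "ennreal (\<Sum>k\<in>K. (norm (v t k))\<^sup>2) = (\<Sum>k\<in>K. ennreal ((norm (v t k))\<^sup>2))" by simp
      also have "\<dots> = (\<integral>\<^sup>+ k. ennreal ((norm (v t k))\<^sup>2) * indicator K k \<partial>count_space UNIV)"
        using K by (subst nn_integral_count_space'[of K]) auto
      also have "\<dots> \<le> lsum (\<lambda>k. (norm (v t k))\<^sup>2)"
        by (rule nn_integral_mono) (simp add: indicator_def)
      also have "\<dots> = ennreal ((VsNorm 0 (v t))\<^sup>2)" by (rule Vs_zero_lsum[symmetric]) fact
      also have "\<dots> \<le> ennreal (M\<^sup>2)"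
        using elim by (intro ennreal_leI power_mono) (auto simp: VsNorm_def infsum_nonneg)
      finally show ?case by simp
    qed
  qed
  have "lsum (\<lambda>k. (norm (v t k))\<^sup>2) \<le> ennreal (M\<^sup>2)" if t: "t \<in> {0..T}" for t
  proof -
    have sm: "(\<lambda>k. (norm (v t k))\<^sup>2) summable_on UNIV"
      using fin[OF _ t] by (intro nonneg_bdd_above_summable_on) (auto intro!: bdd_aboveI[of _ "M\<^sup>2"])
    have "infsum (\<lambda>k. (norm (v t k))\<^sup>2) UNIV \<le> M\<^sup>2"
      by (rule infsum_le_finite_sums[OF sm]) (use fin t in auto)
    then show ?thesis using sm by (simp add: lsum_eq_infsum ennreal_leI)
  qed
  then show ?thesis using that[of "M\<^sup>2"] by auto
qed

section \<open>Continuity in time of the convection coefficients\<close>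

lemma convolution_summable:
  fixes x :: "wvec \<Rightarrow> real"
  assumes x: "lsum (\<lambda>k. (x k)\<^sup>2) \<le> ennreal A0" "\<And>k. 0 \<le> x k" and A0: "0 \<le> A0"
  shows "(\<lambda>j. x j * x (k - j)) summable_on S" and "infsum (\<lambda>j. x j * x (k - j)) S \<le> A0"
proof -
  have "lsum (\<lambda>k. (x k)\<^sup>2) < \<infinity>" using x(1) by (simp add: le_less_trans)
  then have s1: "(\<lambda>j. (x j)\<^sup>2) summable_on UNIV" by (rule summable_on_of_lsum_finite) simp
  have i1: "infsum (\<lambda>j. (x j)\<^sup>2) UNIV \<le> A0" using x(1) A0 lsum_eq_infsum[OF s1] by simp
  have bij: "bij_betw (\<lambda>j. k - j) UNIV (UNIV :: wvec set)"
    by (rule bij_betw_byWitness[where f' = "\<lambda>j. k - j"]) auto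
  have s2: "(\<lambda>j. (x (k - j))\<^sup>2) summable_on UNIV"
    using summable_on_reindex_bij_betw[OF bij, of "\<lambda>j. (x j)\<^sup>2"] s1 by simp
  have i2: "infsum (\<lambda>j. (x (k - j))\<^sup>2) UNIV = infsum (\<lambda>j. (x j)\<^sup>2) UNIV"
    by (rule infsum_reindex_bij_betw[OF bij])
  have s3: "(\<lambda>j. (1/2) * ((x j)\<^sup>2 + (x (k - j))\<^sup>2)) summable_on UNIV"
    by (intro summable_on_cmult_right summable_on_add s1 s2)
  have le: "x j * x (k - j) \<le> (1/2) * ((x j)\<^sup>2 + (x (k - j))\<^sup>2)" for j
    using sum_squares_bound[of "x j" "x (k - j)"] by simp
  have s4: "(\<lambda>j. x j * x (k - j)) summable_on UNIV"
    by (rule summable_on_comparison_test[OF s3]) (use le x in auto)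
  then show s5: "(\<lambda>j. x j * x (k - j)) summable_on S" by (rule summable_on_subset_banach) simp
  have "infsum (\<lambda>j. x j * x (k - j)) S \<le> infsum (\<lambda>j. (1/2) * ((x j)\<^sup>2 + (x (k - j))\<^sup>2)) UNIV"
    by (rule infsum_mono_neutral[OF s5 s3]) (use le in auto)
  also have "\<dots> = infsum (\<lambda>j. (x j)\<^sup>2) UNIV"
    by (simp only: infsum_cmult_right' infsum_add[OF s1 s2] i2) simp
  finally show "infsum (\<lambda>j. x j * x (k - j)) S \<le> A0" using i1 by simp
qed

lemma LamV_term_norm:
  "norm ((- \<i> * kdot (LamV (- 2 * \<alpha>) w j) k) *s w (k - j)) \<le>
    kn k * (kn j powr (- 2 * \<alpha>) * (norm (w j) * norm (w (k - j))))" for w :: vfield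
  using convection_term_norm[of "LamV (- 2 * \<alpha>) w" j k w] by (simp add: LamV_def mult.assoc)

lemma kn_powr_neg_le_1: "0 < \<alpha> \<Longrightarrow> kn j powr (- 2 * \<alpha>) \<le> 1"
proof (cases "j = 0")
  case False
  assume "0 < \<alpha>"
  then have "kn j powr (- 2 * \<alpha>) \<le> kn j powr 0"
    using kn_ge_1[OF False] by (intro powr_mono) auto
  then show ?thesis using False by simp
qed simp

lemma LamV_product_summable:
  fixes w :: vfield
  assumes "0 < \<alpha>" "0 \<le> A0" "lsum (\<lambda>k. (norm (w k))\<^sup>2) \<le> ennreal A0"
  shows "(\<lambda>j. kn j powr (- 2 * \<alpha>) * (norm (w j) * norm (w (k - j)))) summable_on S"
proof (rule summable_on_comparison_test[OF convolution_summable(1)[of "\<lambda>j. norm (w j)" A0 k S]])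
  fix j
  show "kn j powr (- 2 * \<alpha>) * (norm (w j) * norm (w (k - j))) \<le> norm (w j) * norm (w (k - j))"
    using mult_right_mono[OF kn_powr_neg_le_1[OF assms(1), of j], of "norm (w j) * norm (w (k - j))"] by simp
qed (use assms in auto)

lemma convection_norm_le:
  fixes w :: vfield
  assumes "0 < \<alpha>" "0 \<le> A0" "lsum (\<lambda>k. (norm (w k))\<^sup>2) \<le> ennreal A0"
  shows "ennreal (norm (convection (LamV (- 2 * \<alpha>) w) w k)) \<le> conv_bound \<alpha> (\<lambda>k. norm (w k)) k"
proof -
  let ?g = "\<lambda>j. kn k * (kn j powr (- 2 * \<alpha>) * (norm (w j) * norm (w (k - j))))"
  have sg: "?g summable_on UNIV" by (intro summable_on_cmult_right LamV_product_summable[OF assms])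
  have sh: "(\<lambda>j. norm ((- \<i> * kdot (LamV (- 2 * \<alpha>) w j) k) *s w (k - j))) summable_on UNIV"
    by (rule summable_on_comparison_test[OF sg]) (use LamV_term_norm in auto)
  have "norm (convection (LamV (- 2 * \<alpha>) w) w k) \<le> infsum ?g UNIV"
    unfolding convection_def
    by (rule norm_infsum_le[OF has_sum_infsum[OF abs_summable_summable[OF sh]] has_sum_infsum[OF sg] LamV_term_norm])
  then have "ennreal (norm (convection (LamV (- 2 * \<alpha>) w) w k)) \<le> lsum ?g"
    using lsum_eq_infsum[OF sg] by (simp add: ennreal_leI)
  then show ?thesis by (simp add: conv_bound_def mult.assoc)
qed

text \<open>Each term of the convolution is continuous, and the tail |j| > n is at most |k|
  n^(-2\<alpha>) A0 uniformly in time, because there the smoothing of u gives a small factor. Here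
  \<open>0 < \<alpha>\<close> is essential; the uniform limit is continuous.\<close>

lemma convection_continuous:
  fixes v :: "real \<Rightarrow> vfield"
  assumes \<alpha>: "0 < \<alpha>" and A0: "0 \<le> A0" and v: "\<And>t. t \<in> S \<Longrightarrow> lsum (\<lambda>k. (norm (v t k))\<^sup>2) \<le> ennreal A0"
    and cont: "\<And>k. continuous_on S (\<lambda>t. v t k)"
  shows "continuous_on S (\<lambda>t. convection (LamV (- 2 * \<alpha>) (v t)) (v t) k)"
proof -
  define h where "h t j = (- \<i> * kdot (LamV (- 2 * \<alpha>) (v t) j) k) *s v t (k - j)" for t j
  define F where "F n t = (\<Sum>j | kn j \<le> real n. h t j)" for n t
  have ch: "continuous_on S (\<lambda>t. h t j)" for j
    unfolding h_def LamV_def kdot_def vector_scalar_mult_def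
    by (intro continuous_intros cont continuous_on_vec_lambda)
  have tail: "norm (convection (LamV (- 2 * \<alpha>) (v t)) (v t) k - F n t) \<le> kn k * (real n powr (- 2 * \<alpha>) * A0)"
    if t: "t \<in> S" and n: "1 \<le> n" for t n
  proof -
    let ?x = "\<lambda>j. norm (v t j)" and ?B = "{j. \<not> kn j \<le> real n}"
    have sg: "(\<lambda>j. kn k * (kn j powr (- 2 * \<alpha>) * (?x j * ?x (k - j)))) summable_on UNIV"
      by (intro summable_on_cmult_right LamV_product_summable[OF \<alpha> A0 v[OF t]])
    have sh: "(\<lambda>j. norm (h t j)) summable_on UNIV"
      by (rule summable_on_comparison_test[OF sg]) (use LamV_term_norm in \<open>auto simp: h_def\<close>)
    have shB: "h t summable_on ?B"
      using abs_summable_summable[OF sh] by (rule summable_on_subset_banach) simp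
    have "convection (LamV (- 2 * \<alpha>) (v t)) (v t) k = infsum (h t) ({j. kn j \<le> real n} \<union> ?B)"
      unfolding convection_def h_def by (rule arg_cong2[where f = infsum]) auto
    also have "\<dots> = F n t + infsum (h t) ?B"
      unfolding F_def using shB by (subst infsum_Un_disjoint) auto
    finally have "norm (convection (LamV (- 2 * \<alpha>) (v t)) (v t) k - F n t) = norm (infsum (h t) ?B)"
      by simp
    also have "\<dots> \<le> infsum (\<lambda>j. (kn k * real n powr (- 2 * \<alpha>)) * (?x j * ?x (k - j))) ?B"
    proof (rule norm_infsum_le[OF has_sum_infsum[OF shB] has_sum_infsum])
      show "(\<lambda>j. (kn k * real n powr (- 2 * \<alpha>)) * (?x j * ?x (k - j))) summable_on ?B"
        by (intro summable_on_cmult_right convolution_summable(1)[OF v[OF t]]) (use A0 in auto)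
      fix j assume "j \<in> ?B"
      then have "kn j powr (- 2 * \<alpha>) \<le> real n powr (- 2 * \<alpha>)"
        using \<alpha> n by (intro powr_mono2') auto
      then have "kn k * (kn j powr (- 2 * \<alpha>) * (?x j * ?x (k - j))) \<le>
          kn k * (real n powr (- 2 * \<alpha>) * (?x j * ?x (k - j)))"
        by (intro mult_left_mono mult_right_mono) auto
      then show "norm (h t j) \<le> (kn k * real n powr (- 2 * \<alpha>)) * (?x j * ?x (k - j))"
        using LamV_term_norm[of \<alpha> "v t" j k] by (simp add: h_def mult.assoc)
    qed
    also have "\<dots> = (kn k * real n powr (- 2 * \<alpha>)) * infsum (\<lambda>j. ?x j * ?x (k - j)) ?B"
      by (rule infsum_cmult_right')
    also have "\<dots> \<le> (kn k * real n powr (- 2 * \<alpha>)) * A0"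
      by (intro mult_left_mono convolution_summable(2)[OF v[OF t]]) (use A0 in auto)
    finally show ?thesis by (simp add: mult.assoc)
  qed
  have lim: "(\<lambda>n. kn k * (real n powr (- 2 * \<alpha>) * A0)) \<longlonglongrightarrow> 0"
  proof -
    have "(\<lambda>n. real n powr (- (2 * \<alpha>))) \<longlonglongrightarrow> 0"
      by (rule tendsto_neg_powr[OF _ filterlim_real_sequentially]) (use \<alpha> in auto)
    from tendsto_mult_left[OF tendsto_mult_right[OF this, of A0], of "kn k"] show ?thesis by simp
  qed
  show ?thesis
  proof (rule uniform_limit_theorem[of _ F sequentially])
    show "\<forall>\<^sub>F n in sequentially. continuous_on S (F n)"
      unfolding F_def by (intro always_eventually allI continuous_intros ch)
    show "uniform_limit S F (\<lambda>t. convection (LamV (- 2 * \<alpha>) (v t)) (v t) k) sequentially"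
    proof (rule uniform_limitI)
      fix e :: real assume "0 < e"
      from order_tendstoD(2)[OF lim this] eventually_ge_at_top[of 1]
      show "\<forall>\<^sub>F n in sequentially. \<forall>t\<in>S. dist (F n t) (convection (LamV (- 2 * \<alpha>) (v t)) (v t) k) < e"
      proof eventually_elim
        case (elim n)
        then show ?case using tail[of _ n] by (fastforce simp: dist_norm norm_minus_commute intro: le_less_trans)
      qed
    qed
  qed simp
qed

text \<open>The integrands of the weak formulation have a known form only for times in the interval,
  since v is arbitrary outside. The function f is their continuous representative, which also
  supplies integrability.\<close>

lemma LBINT_eq_integral:
  fixes f g :: "real \<Rightarrow> real"
  assumes "0 \<le> t" "continuous_on {0..t} f" "\<And>s. s \<in> {0..t} \<Longrightarrow> g s = f s"
  shows "(LBINT s=0..t. g s) = integral {0..t} f"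
proof -
  have "(LBINT s=0..t. g s) = (LBINT s=0..t. f s)"
    using assms by (intro interval_integral_cong) (auto simp: einterval_def zero_ereal_def)
  also have "\<dots> = integral {0..t} f"
    using interval_integral_eq_integral[OF assms(1) borel_integrable_atLeastAtMost'[OF assms(2)]]
    by (simp add: zero_ereal_def)
  finally show ?thesis .
qed

section \<open>Regularity of weak solutions\<close>

text \<open>Testing with the modes at k and -k turns every pairing into an expression in the k-th
  coefficient, and continuity of \<open>G\<close> then makes this coefficient continuously
  differentiable.\<close>

lemma mode_equation:
  assumes T: "0 < T" and \<alpha>: "0 < \<alpha>" and k: "k \<noteq> 0"
    and weak: "weak_solution \<nu> \<alpha> \<beta> T v0 \<theta>0 v \<theta>" and v0: "kdot (v0 k) k = 0" "\<And>m. v0 (- m) = vcnj (v0 m)"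
    and A0: "0 \<le> A0" "\<And>t. t \<in> {0..T} \<Longrightarrow> lsum (\<lambda>k. (norm (v t k))\<^sup>2) \<le> ennreal A0"
  defines "G \<equiv> \<lambda>s. perp_proj k (convection (LamV (- 2 * \<alpha>) (v s)) (v s) k
      - (\<nu> * kn k powr (2 * \<beta>)) *\<^sub>R v s k + \<theta> s k *s e3)"
  shows "continuous_on {0..T} G" and "\<And>t. t \<in> {0..T} \<Longrightarrow> v t k = v0 k + integral {0..t} G"
proof -
  let ?N = "\<lambda>s. convection (LamV (- 2 * \<alpha>) (v s)) (v s) k"
  have cw: "CwV T v" "CwH T \<theta>" using weak by (auto simp: weak_solution_def)
  have V: "Vs 0 (v t)" and H: "Hs 0 (\<theta> t)" if "t \<in> {0..T}" for t
    using cw that by (auto simp: CwV_def CwH_def)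
  have cv: "continuous_on {0..T} (\<lambda>s. v s k)" by (rule CwV_coefficient_continuous[OF cw(1)])
  have c\<theta>: "continuous_on {0..T} (\<lambda>s. \<theta> s k *s e3)"
    unfolding vector_scalar_mult_def
    by (intro continuous_on_vec_lambda continuous_intros CwH_coefficient_continuous[OF cw(2)])
  have cN: "continuous_on {0..T} ?N"
    by (rule convection_continuous[OF \<alpha> A0]) (auto intro: CwV_coefficient_continuous[OF cw(1)])
  show cG: "continuous_on {0..T} G"
    unfolding G_def
    by (intro bounded_linear.continuous_on[OF linear_perp_proj] continuous_intros cv c\<theta> cN)
  fix t assume t: "t \<in> {0..T}"
  have sub: "continuous_on {0..t} f" if "continuous_on {0..T} f" for f :: "real \<Rightarrow> 'a::topological_space"
    using that by (rule continuous_on_subset) (use t in auto)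
  have "inner (v t k) a = inner (v0 k + integral {0..t} G) a" for a
  proof -
    \<comment> \<open>Only b is admissible in a divergence-free test field. The projection is
      returned to \<open>G\<close> by self-adjointness, and it does not affect the pairings with the
      coefficients of v and \<open>v0\<close>, so the identity holds for every a.\<close>
    define b where "b = perp_proj k a"
    have b: "kdot b k = 0" by (simp add: b_def kdot_perp_proj k)
    let ?c = "(2 * pi) ^ 3 * 2 :: real"
    have c0: "?c \<noteq> 0" by simp
    have sym: "v s (- m) = vcnj (v s m)" "\<theta> s (- m) = cnj (\<theta> s m)" "v s 0 = 0" "kdot (v s m) m = 0"
      if "s \<in> {0..T}" for s m
      using V[OF that] H[OF that] by (auto simp: Vs_def Hs_def)
    have eq: "l2v (v t) (vmode k b)
        - (LBINT s=0..t. l2v (Bop (LamV (-2 * \<alpha>) (v s)) (vmode k b)) (v s))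
        + \<nu> * (LBINT s=0..t. l2v (LamV \<beta> (v s)) (LamV \<beta> (vmode k b)))
        = l2v v0 (vmode k b) + (LBINT s=0..t. l2v (theta_e3 (\<theta> s)) (vmode k b))"
      using weak Vs_vmode[OF k b] t by (auto simp: weak_solution_def)
    have I1: "(LBINT s=0..t. l2v (Bop (LamV (-2 * \<alpha>) (v s)) (vmode k b)) (v s)) =
        integral {0..t} (\<lambda>s. ?c * inner (?N s) b)"
    proof (rule LBINT_eq_integral)
      show "continuous_on {0..t} (\<lambda>s. ?c * inner (?N s) b)"
        by (intro continuous_intros sub[OF cN])
      fix s assume "s \<in> {0..t}"
      then have s: "s \<in> {0..T}" using t by auto
      have "(\<lambda>j. norm (LamV (- 2 * \<alpha>) (v s) j) * norm (v s (k - j))) summable_on UNIV"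
        using LamV_product_summable[OF \<alpha> A0(1) A0(2)[OF s], of k UNIV] by (simp add: LamV_def mult.assoc)
      moreover have "LamV (- 2 * \<alpha>) (v s) (- m) = vcnj (LamV (- 2 * \<alpha>) (v s) m)" for m
        by (simp add: LamV_def sym[OF s]) (simp add: vcnj_def vec_eq_iff)
      ultimately show "l2v (Bop (LamV (-2 * \<alpha>) (v s)) (vmode k b)) (v s) = ?c * inner (?N s) b"
        using l2v_Bop_vmode[OF k b, of "LamV (- 2 * \<alpha>) (v s)" "v s"] sym[OF s] by simp
    qed (use t in simp)
    have I2: "(LBINT s=0..t. l2v (LamV \<beta> (v s)) (LamV \<beta> (vmode k b))) =
        integral {0..t} (\<lambda>s. ?c * (kn k powr (2 * \<beta>) * inner (v s k) b))"
    proof (rule LBINT_eq_integral)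
      show "continuous_on {0..t} (\<lambda>s. ?c * (kn k powr (2 * \<beta>) * inner (v s k) b))"
        by (intro continuous_intros sub[OF cv])
      fix s assume "s \<in> {0..t}"
      then have s: "s \<in> {0..T}" using t by auto
      show "l2v (LamV \<beta> (v s)) (LamV \<beta> (vmode k b)) = ?c * (kn k powr (2 * \<beta>) * inner (v s k) b)"
        using l2v_LamV_vmode[OF k, of "v s" \<beta> b] sym[OF s] by simp
    qed (use t in simp)
    have I3: "(LBINT s=0..t. l2v (theta_e3 (\<theta> s)) (vmode k b)) =
        integral {0..t} (\<lambda>s. ?c * inner (\<theta> s k *s e3) b)"
    proof (rule LBINT_eq_integral)
      show "continuous_on {0..t} (\<lambda>s. ?c * inner (\<theta> s k *s e3) b)"
        by (intro continuous_intros sub[OF c\<theta>])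
      fix s assume "s \<in> {0..t}"
      then have s: "s \<in> {0..T}" using t by auto
      show "l2v (theta_e3 (\<theta> s)) (vmode k b) = ?c * inner (\<theta> s k *s e3) b"
        using l2v_theta_e3_vmode[OF k, of "\<theta> s" b] sym[OF s] by simp
    qed (use t in simp)
    have e1: "l2v (v t) (vmode k b) = ?c * inner (v t k) b"
      using l2v_vmode[OF k, of "v t" b] sym[OF t] by simp
    have e2: "l2v v0 (vmode k b) = ?c * inner (v0 k) b"
      using l2v_vmode[OF k, of v0 b] v0(2) by simp
    have "?c * (inner (v t k) b - integral {0..t} (\<lambda>s. inner (?N s) b) +
        \<nu> * (kn k powr (2 * \<beta>) * integral {0..t} (\<lambda>s. inner (v s k) b))) =
        ?c * (inner (v0 k) b + integral {0..t} (\<lambda>s. inner (\<theta> s k *s e3) b))"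
      using eq unfolding I1 I2 I3 e1 e2 integral_mult_right by (simp only: algebra_simps)
    then have "inner (v t k) b - integral {0..t} (\<lambda>s. inner (?N s) b) +
        \<nu> * (kn k powr (2 * \<beta>) * integral {0..t} (\<lambda>s. inner (v s k) b)) =
        inner (v0 k) b + integral {0..t} (\<lambda>s. inner (\<theta> s k *s e3) b)"
      by (simp only: mult_left_cancel[OF c0])
    then have eq2: "inner (v t k) b = inner (v0 k) b + (integral {0..t} (\<lambda>s. inner (?N s) b) -
        \<nu> * (kn k powr (2 * \<beta>) * integral {0..t} (\<lambda>s. inner (v s k) b)) + integral {0..t} (\<lambda>s. inner (\<theta> s k *s e3) b))"
      by linarith
    have "integral {0..t} (\<lambda>s. inner (G s) a) = integral {0..t} (\<lambda>s. inner (?N s) b -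
        \<nu> * (kn k powr (2 * \<beta>) * inner (v s k) b) + inner (\<theta> s k *s e3) b)"
      unfolding G_def b_def inner_perp_proj_swap[OF k]
      by (simp add: inner_add_left inner_diff_left mult.assoc)
    also have "\<dots> = integral {0..t} (\<lambda>s. inner (?N s) b) -
        \<nu> * (kn k powr (2 * \<beta>) * integral {0..t} (\<lambda>s. inner (v s k) b)) + integral {0..t} (\<lambda>s. inner (\<theta> s k *s e3) b)"
    proof -
      have i: "(\<lambda>s. inner (?N s) b) integrable_on {0..t}" "(\<lambda>s. inner (v s k) b) integrable_on {0..t}"
          "(\<lambda>s. inner (\<theta> s k *s e3) b) integrable_on {0..t}"
        by (intro integrable_continuous_real continuous_intros sub cN cv c\<theta>)+
      show ?thesis
        by (subst integral_add, intro integrable_diff i integrable_on_mult_right, rule i,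
            subst integral_diff, rule i, intro integrable_on_mult_right i) (simp add: integral_mult_right)
    qed
    finally have "inner (v t k) b = inner (v0 k) b + integral {0..t} (\<lambda>s. inner (G s) a)"
      using eq2 by simp
    moreover have "integral {0..t} (\<lambda>s. inner (G s) a) = inner (integral {0..t} G) a"
      using integral_linear[OF integrable_continuous_real[OF sub[OF cG]] bounded_linear_inner_left, of a]
      by (simp add: o_def)
    moreover have "inner (v t k) b = inner (v t k) a" "inner (v0 k) b = inner (v0 k) a"
      using v0 sym[OF t] by (simp_all add: b_def inner_perp_proj)
    ultimately show ?thesis by (simp add: inner_add_left)
  qed
  then show "v t k = v0 k + integral {0..t} G" using vector_eq_rdot by blast
qed

text \<open>The fundamental theorem of calculus applies to the squared modulus of a single
  coefficient, so no summation over modes and no regularity beyond V^0 is involved. The viscous term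
  is kept exactly; Cauchy-Schwarz bounds transport and forcing, and the projection drops out because
  the coefficient of v is orthogonal to k.\<close>

lemma mode_energy:
  assumes T: "0 < T" and \<alpha>: "0 < \<alpha>" and \<nu>: "0 < \<nu>" and t: "t \<in> {0..T}"
    and weak: "weak_solution \<nu> \<alpha> \<beta> T v0 \<theta>0 v \<theta>" and v0: "\<And>m. kdot (v0 m) m = 0" "\<And>m. v0 (- m) = vcnj (v0 m)"
    and A0: "0 \<le> A0" "\<And>t. t \<in> {0..T} \<Longrightarrow> lsum (\<lambda>k. (norm (v t k))\<^sup>2) \<le> ennreal A0"
  shows "ennreal ((norm (v t k))\<^sup>2) + ennreal (2 * \<nu> * kn k powr (2 * \<beta>)) *
      (\<integral>\<^sup>+ s. indicator {0..t} s * ennreal ((norm (v s k))\<^sup>2) \<partial>lebesgue_on {0..T})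
    \<le> ennreal ((norm (v 0 k))\<^sup>2) + (\<integral>\<^sup>+ s. indicator {0..t} s * (ennreal (2 * norm (v s k)) *
        (conv_bound \<alpha> (\<lambda>k. norm (v s k)) k + ennreal (norm e3 * cmod (\<theta> s k)))) \<partial>lebesgue_on {0..T})"
proof (cases "k = 0")
  case True
  have z: "v s 0 = 0" if "s \<in> {0..T}" for s
    using weak that by (auto simp: weak_solution_def CwV_def Vs_def)
  have "(\<integral>\<^sup>+ s. indicator {0..t} s * ennreal ((norm (v s 0))\<^sup>2) \<partial>lebesgue_on {0..T}) =
      (\<integral>\<^sup>+ s. 0 \<partial>lebesgue_on {0..T})"
    by (rule nn_integral_cong) (simp add: z)
  moreover have "v t 0 = 0" using t by (rule z)
  ultimately show ?thesis using True by simp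
next
  case k: False
  let ?N = "\<lambda>s. convection (LamV (- 2 * \<alpha>) (v s)) (v s) k"
  let ?P = "2 * \<nu> * kn k powr (2 * \<beta>)"
  define G where "G = (\<lambda>s. perp_proj k (?N s - (\<nu> * kn k powr (2 * \<beta>)) *\<^sub>R v s k + \<theta> s k *s e3))"
  note me = mode_equation[OF T \<alpha> k weak v0(1) v0(2) A0, folded G_def]
  have cw: "CwV T v" "CwH T \<theta>" using weak by (auto simp: weak_solution_def)
  have sub: "continuous_on {0..t} f" if "continuous_on {0..T} f" for f :: "real \<Rightarrow> 'a::topological_space"
    using that by (rule continuous_on_subset) (use t in auto)
  have cv: "continuous_on {0..t} (\<lambda>s. v s k)" by (rule sub[OF CwV_coefficient_continuous[OF cw(1)]])
  have c\<theta>: "continuous_on {0..t} (\<lambda>s. \<theta> s k)" by (rule sub[OF CwH_coefficient_continuous[OF cw(2)]])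
  have cN: "continuous_on {0..t} ?N"
    by (rule sub, rule convection_continuous[OF \<alpha> A0]) (auto intro: CwV_coefficient_continuous[OF cw(1)])
  have deriv: "((\<lambda>s. inner (v s k) (v s k)) has_vector_derivative 2 * inner (v s k) (G s)) (at s within {0..t})"
    if s: "s \<in> {0..t}" for s
  proof -
    have "((\<lambda>s. v0 k + integral {0..s} G) has_vector_derivative G s) (at s within {0..t})"
      using has_vector_derivative_add[OF has_vector_derivative_const
        integral_has_vector_derivative[OF sub[OF me(1)] s]] by simp
    then have "((\<lambda>s. v s k) has_vector_derivative G s) (at s within {0..t})"
      by (rule has_vector_derivative_transform[rotated 2]) (use me(2) s t in auto)
    then have d: "((\<lambda>s. v s k) has_derivative (\<lambda>h. h *\<^sub>R G s)) (at s within {0..t})"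
      by (simp add: has_vector_derivative_def)
    show ?thesis
      unfolding has_vector_derivative_def
      using has_derivative_inner[OF d d] by (simp add: inner_commute algebra_simps)
  qed
  have "((\<lambda>s. 2 * inner (v s k) (G s)) has_integral (inner (v t k) (v t k) - inner (v 0 k) (v 0 k))) {0..t}"
    using t by (intro fundamental_theorem_of_calculus deriv) auto
  then have ftc: "integral {0..t} (\<lambda>s. 2 * inner (v s k) (G s)) = (norm (v t k))\<^sup>2 - (norm (v 0 k))\<^sup>2"
    by (simp only: integral_unique power2_norm_eq_inner)
  let ?f = "\<lambda>s. 2 * norm (v s k) * (norm (?N s) + norm e3 * cmod (\<theta> s k))"
  let ?g = "\<lambda>s. (norm (v s k))\<^sup>2"
  have cf: "continuous_on {0..t} ?f" and cg: "continuous_on {0..t} ?g"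
    by (intro continuous_intros cv cN c\<theta>)+
  have "integral {0..t} (\<lambda>s. 2 * inner (v s k) (G s)) \<le> integral {0..t} (\<lambda>s. ?f s - ?P * ?g s)"
  proof (rule integral_le)
    show "(\<lambda>s. 2 * inner (v s k) (G s)) integrable_on {0..t}"
      by (intro integrable_continuous_real continuous_intros cv sub[OF me(1)])
    show "(\<lambda>s. ?f s - ?P * ?g s) integrable_on {0..t}"
      by (intro integrable_continuous_real continuous_intros cf cg cv cN c\<theta>)
    fix s assume "s \<in> {0..t}"
    then have s: "s \<in> {0..T}" using t by auto
    have "kdot (v s k) k = 0" using cw(1) s by (simp add: CwV_def Vs_def)
    then have "inner (v s k) (G s) = inner (v s k) (?N s - (\<nu> * kn k powr (2 * \<beta>)) *\<^sub>R v s k + \<theta> s k *s e3)"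
      unfolding G_def by (rule inner_perp_proj)
    also have "\<dots> = inner (v s k) (?N s + \<theta> s k *s e3) - \<nu> * kn k powr (2 * \<beta>) * (norm (v s k))\<^sup>2"
      by (simp add: inner_add_right inner_diff_right power2_norm_eq_inner)
    also have "inner (v s k) (?N s + \<theta> s k *s e3) \<le> norm (v s k) * norm (?N s + \<theta> s k *s e3)"
      by (rule norm_cauchy_schwarz)
    also have "\<dots> \<le> norm (v s k) * (norm (?N s) + norm e3 * cmod (\<theta> s k))"
      using norm_triangle_ineq[of "?N s" "\<theta> s k *s e3"]
      by (intro mult_left_mono) (auto simp: norm_vector_scalar_mult mult.commute)
    finally show "2 * inner (v s k) (G s) \<le> ?f s - ?P * ?g s" by simp
  qed
  also have "\<dots> = integral {0..t} ?f - ?P * integral {0..t} ?g"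
    using integrable_continuous_real[OF cf] integrable_continuous_real[OF cg]
    by (subst integral_diff) (auto simp: integral_mult_right intro: integrable_on_mult_right)
  finally have ineq: "(norm (v t k))\<^sup>2 + ?P * integral {0..t} ?g \<le> (norm (v 0 k))\<^sup>2 + integral {0..t} ?f"
    unfolding ftc by simp
  have g0: "0 \<le> integral {0..t} ?g"
    by (rule integral_nonneg[OF integrable_continuous_real[OF cg]]) simp
  have f0: "0 \<le> integral {0..t} ?f"
    by (rule integral_nonneg[OF integrable_continuous_real[OF cf]]) simp
  have P0: "0 \<le> ?P" using \<nu> by simp
  have "ennreal ((norm (v t k))\<^sup>2) + ennreal ?P *
      (\<integral>\<^sup>+ s. indicator {0..t} s * ennreal (?g s) \<partial>lebesgue_on {0..T}) =
      ennreal ((norm (v t k))\<^sup>2 + ?P * integral {0..t} ?g)"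
  proof -
    have "(\<integral>\<^sup>+ s. indicator {0..t} s * ennreal (?g s) \<partial>lebesgue_on {0..T}) = ennreal (integral {0..t} ?g)"
      by (rule nn_integral_lebesgue_on_indicator) (use t cg in auto)
    moreover have "ennreal ((norm (v t k))\<^sup>2 + ?P * integral {0..t} ?g) =
        ennreal ((norm (v t k))\<^sup>2) + ennreal (?P * integral {0..t} ?g)"
      by (rule ennreal_plus[OF zero_le_power2 mult_nonneg_nonneg[OF P0 g0]])
    ultimately show ?thesis by (simp only: ennreal_mult'[OF P0])
  qed
  also have "\<dots> \<le> ennreal ((norm (v 0 k))\<^sup>2 + integral {0..t} ?f)" by (rule ennreal_leI[OF ineq])
  also have "\<dots> = ennreal ((norm (v 0 k))\<^sup>2) +
      (\<integral>\<^sup>+ s. indicator {0..t} s * ennreal (?f s) \<partial>lebesgue_on {0..T})"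
    using t cf f0 by (subst nn_integral_lebesgue_on_indicator) auto
  also have "\<dots> \<le> ennreal ((norm (v 0 k))\<^sup>2) + (\<integral>\<^sup>+ s. indicator {0..t} s * (ennreal (2 * norm (v s k)) *
        (conv_bound \<alpha> (\<lambda>k. norm (v s k)) k + ennreal (norm e3 * cmod (\<theta> s k)))) \<partial>lebesgue_on {0..T})"
  proof (intro add_left_mono nn_integral_mono mult_left_mono)
    fix s assume "s \<in> space (lebesgue_on {0..T})"
    then have s: "s \<in> {0..T}" by simp
    have "ennreal (?f s) = ennreal (2 * norm (v s k)) * (ennreal (norm (?N s)) + ennreal (norm e3 * cmod (\<theta> s k)))"
      by (simp add: ennreal_mult')
    also have "\<dots> \<le> ennreal (2 * norm (v s k)) *
        (conv_bound \<alpha> (\<lambda>k. norm (v s k)) k + ennreal (norm e3 * cmod (\<theta> s k)))"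
      by (intro mult_left_mono add_right_mono convection_norm_le[OF \<alpha> A0(1) A0(2)[OF s]]) simp
    finally show "ennreal (?f s) \<le> ennreal (2 * norm (v s k)) *
        (conv_bound \<alpha> (\<lambda>k. norm (v s k)) k + ennreal (norm e3 * cmod (\<theta> s k)))" .
  qed simp
  finally show ?thesis .
qed

lemma VsNorm_tendsto_dominated:
  fixes v :: "real \<Rightarrow> vfield" and q :: "wvec \<Rightarrow> ennreal"
  assumes V: "\<And>t. t \<in> S \<Longrightarrow> Vs s (v t)" and cont: "\<And>k. continuous_on S (\<lambda>t. v t k)"
    and q: "(\<integral>\<^sup>+ k. q k \<partial>count_space UNIV) < \<infinity>"
      "\<And>t k. t \<in> S \<Longrightarrow> ennreal (kn k powr (2 * s) * (norm (v t k))\<^sup>2) \<le> q k"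
    and t: "t \<in> S"
  shows "((\<lambda>\<tau>. VsNorm s (v \<tau> - v t)) \<longlongrightarrow> 0) (at t within S)"
  unfolding tendsto_at_iff_sequentially o_def
proof (intro allI impI)
  fix X :: "nat \<Rightarrow> real" assume X: "\<forall>i. X i \<in> S - {t}" and lim: "X \<longlonglongrightarrow> t"
  let ?d = "\<lambda>n k. kn k powr (2 * s) * (norm (v (X n) k - v t k))\<^sup>2"
  \<comment> \<open>From (a + b)^2 <= 2 a^2 + 2 b^2, with q bounding the weighted squares at both
    times.\<close>
  have dom: "ennreal (?d n k) \<le> 4 * q k" for n k
  proof -
    let ?a = "norm (v (X n) k)" and ?b = "norm (v t k)" and ?w = "kn k powr (2 * s)"
    have "(norm (v (X n) k - v t k))\<^sup>2 \<le> (?a + ?b)\<^sup>2"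
      by (intro power_mono norm_triangle_ineq4) simp
    also have "\<dots> \<le> 2 * ?a\<^sup>2 + 2 * ?b\<^sup>2"
      using sum_squares_bound[of ?a ?b] by (simp add: power2_sum)
    finally have "?d n k \<le> ?w * (2 * ?a\<^sup>2 + 2 * ?b\<^sup>2)" by (rule mult_left_mono) simp
    then have "ennreal (?d n k) \<le> ennreal (2 * (?w * ?a\<^sup>2) + 2 * (?w * ?b\<^sup>2))"
      by (intro ennreal_leI) (simp add: algebra_simps)
    also have "\<dots> = 2 * ennreal (?w * ?a\<^sup>2) + 2 * ennreal (?w * ?b\<^sup>2)"
      by (simp add: ennreal_mult')
    also have "\<dots> \<le> 2 * q k + 2 * q k"
      using X t by (intro add_mono mult_left_mono q) auto
    also have "\<dots> = (2 + 2) * q k" by (simp only: distrib_right)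
    also have "\<dots> = 4 * q k" by simp
    finally show ?thesis .
  qed
  have "(\<lambda>n. \<integral>\<^sup>+ k. ennreal (?d n k) \<partial>count_space UNIV) \<longlonglongrightarrow> (\<integral>\<^sup>+ k. ennreal 0 \<partial>(count_space UNIV :: wvec measure))"
  proof (rule nn_integral_dominated_convergence[where w = "\<lambda>k. 4 * q k"])
    show "(\<integral>\<^sup>+ k. 4 * q k \<partial>count_space UNIV) < \<infinity>"
      using q(1) by (simp add: nn_integral_cmult ennreal_mult_less_top)
    show "AE k in count_space UNIV. (\<lambda>n. ennreal (?d n k)) \<longlonglongrightarrow> ennreal 0"
    proof (intro AE_I2 tendsto_ennrealI)
      fix k
      have "((\<lambda>\<tau>. v \<tau> k) \<longlongrightarrow> v t k) (at t within S)"
        using cont t by (simp add: continuous_on_def)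
      then have "(\<lambda>n. v (X n) k) \<longlonglongrightarrow> v t k"
        using X lim unfolding tendsto_at_iff_sequentially o_def by blast
      then have "(\<lambda>n. kn k powr (2 * s) * (norm (v (X n) k - v t k))\<^sup>2) \<longlonglongrightarrow>
          kn k powr (2 * s) * (norm (v t k - v t k))\<^sup>2"
        by (intro tendsto_intros)
      then show "(\<lambda>n. ?d n k) \<longlonglongrightarrow> 0" by simp
    qed
  qed (use dom in auto)
  then have l: "(\<lambda>n. lsum (?d n)) \<longlonglongrightarrow> ennreal 0" by simp
  \<comment> \<open>Domination by 4 q gives summability, without which the \<open>infsum\<close>
    inside \<open>VsNorm\<close> could not be identified with the sum that tends to zero.\<close>
  have "VsNorm s (v (X n) - v t) = sqrt (enn2real (lsum (?d n)))" for n
  proof -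
    have "lsum (?d n) \<le> (\<integral>\<^sup>+ k. 4 * q k \<partial>count_space UNIV)" by (intro nn_integral_mono dom)
    also have "\<dots> < \<infinity>" using q(1) by (simp add: nn_integral_cmult ennreal_mult_less_top)
    finally have sm: "?d n summable_on UNIV" by (rule summable_on_of_lsum_finite) simp
    show ?thesis
      using lsum_eq_infsum[OF sm] by (simp add: VsNorm_def infsum_nonneg mult.commute)
  qed
  moreover have "(\<lambda>n. sqrt (enn2real (lsum (?d n)))) \<longlonglongrightarrow> sqrt 0"
    by (intro tendsto_real_sqrt tendsto_enn2real[OF l]) simp
  ultimately show "(\<lambda>n. VsNorm s (v (X n) - v t)) \<longlonglongrightarrow> 0" by simp
qed

lemma weak_solution_regularity:
  assumes \<nu>: "0 < \<nu>" and T: "0 < T" and \<beta>: "1/2 < \<beta>" "\<beta> < 5/4" and \<alpha>\<beta>: "\<alpha> + \<beta> = 5/4"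
    and v0: "Vs \<beta> v0" and weak: "weak_solution \<nu> \<alpha> \<beta> T v0 \<theta>0 v \<theta>"
  shows "CV \<beta> T v \<and> L2V (2 * \<beta>) T v"
proof -
  let ?L = "lebesgue_on {0..T}"
  have \<alpha>: "0 < \<alpha>" using \<beta> \<alpha>\<beta> by simp
  have w: "LinfV 0 T v" "L2V \<beta> T v" "CwV T v" "LinfH 0 T \<theta>" "CwH T \<theta>"
    using weak by (auto simp: weak_solution_def)
  have V: "Vs 0 (v t)" if "t \<in> {0..T}" for t using w(3) that by (simp add: CwV_def)
  obtain A0 where A0: "0 \<le> A0" "\<And>t. t \<in> {0..T} \<Longrightarrow> lsum (\<lambda>k. (norm (v t k))\<^sup>2) \<le> ennreal A0"
    using weak_bound_everywhere[OF T w(1,3)] by blast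
  have v0': "\<And>m. kdot (v0 m) m = 0" "\<And>m. v0 (- m) = vcnj (v0 m)" "v0 0 = 0"
    using v0 by (auto simp: Vs_def)
  \<comment> \<open>The definition of a weak solution does not prescribe the value at time 0
    separately; it follows from the mode equation at t = 0, the zero mode being null on both sides.
    This is how the regularity of \<open>v0\<close> reaches the energy estimate.\<close>
  have init: "v 0 k = v0 k" for k
  proof (cases "k = 0")
    case True
    then show ?thesis using V[of 0] T v0' by (simp add: Vs_def)
  next
    case False
    then show ?thesis using mode_equation(2)[OF T \<alpha> False weak v0'(1,2) A0, of 0] T by simp
  qed
  have vm[measurable]: "(\<lambda>t. v t k) \<in> borel_measurable ?L" for k
    using w(1) by (simp add: LinfV_def measV_def)
  have \<theta>m[measurable]: "(\<lambda>t. \<theta> t k) \<in> borel_measurable ?L" for k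
    using w(4) by (simp add: LinfH_def measS_def)
  obtain M where M: "AE t in ?L. HsNorm 0 (\<theta> t) \<le> M" "AE t in ?L. Hs 0 (\<theta> t)"
    using w(4) by (auto simp: LinfH_def)
  have hb: "AE t in ?L. lsum (\<lambda>k. (cmod (\<theta> t k))\<^sup>2) \<le> ennreal (M\<^sup>2)"
    using M
  proof eventually_elim
    case (elim t)
    have "0 \<le> HsNorm 0 (\<theta> t)" by (simp add: HsNorm_def infsum_nonneg)
    then show ?case using elim unfolding Hs_zero_lsum[OF elim(2), symmetric]
      by (intro ennreal_leI power_mono) auto
  qed
  have B: "(\<integral>\<^sup>+ t. lsum (\<lambda>k. kn k powr (2 * \<beta>) * (norm (v t k))\<^sup>2) \<partial>?L) < \<infinity>"
  proof -
    have "AE t in ?L. Vs \<beta> (v t)" using w(2) by (simp add: L2V_def)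
    then have "AE t in ?L. lsum (\<lambda>k. kn k powr (2 * \<beta>) * (norm (v t k))\<^sup>2) = ennreal ((VsNorm \<beta> (v t))\<^sup>2)"
      by eventually_elim (rule VsNorm_square[symmetric])
    then have "(\<integral>\<^sup>+ t. lsum (\<lambda>k. kn k powr (2 * \<beta>) * (norm (v t k))\<^sup>2) \<partial>?L) =
        (\<integral>\<^sup>+ t. ennreal ((VsNorm \<beta> (v t))\<^sup>2) \<partial>?L)" by (rule nn_integral_cong_AE)
    then show ?thesis using w(2) by (simp add: L2V_def)
  qed
  have i0: "lsum (\<lambda>k. kn k powr (2 * \<beta>) * (norm (v 0 k))\<^sup>2) < \<infinity>"
    unfolding init VsNorm_square[OF v0, symmetric] by simp
  obtain q where q: "(\<integral>\<^sup>+ k. q k \<partial>count_space UNIV) < \<infinity>"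
      "\<And>t k. t \<in> {0..T} \<Longrightarrow> ennreal (kn k powr (2 * \<beta>) * (norm (v t k))\<^sup>2) \<le> q k"
    and D: "(\<integral>\<^sup>+ t. lsum (\<lambda>k. kn k powr (4 * \<beta>) * (norm (v t k))\<^sup>2) \<partial>?L) < \<infinity>"
  proof (rule energy_regularity[where x = "\<lambda>t k. norm (v t k)" and h = "\<lambda>t k. cmod (\<theta> t k)"
        and c = "norm e3" and \<Theta> = "M\<^sup>2", OF \<beta> \<alpha>\<beta> \<nu> A0(1) norm_ge_zero T])
    show "norm (v t (- k)) = norm (v t k)" "norm (v t 0) = 0" if "t \<in> {0..T}" for t k
      using V[OF that] by (simp_all add: Vs_def)
  qed (use A0 hb B i0 mode_energy[OF T \<alpha> \<nu> _ weak v0'(1,2) A0] in auto)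
  have Vb: "Vs \<beta> (v t)" if t: "t \<in> {0..T}" for t
  proof -
    have "lsum (\<lambda>k. kn k powr (2 * \<beta>) * (norm (v t k))\<^sup>2) \<le> (\<integral>\<^sup>+ k. q k \<partial>count_space UNIV)"
      by (intro nn_integral_mono q t)
    then have "(\<lambda>k. kn k powr (2 * \<beta>) * (norm (v t k))\<^sup>2) summable_on UNIV"
      using q(1) by (intro summable_on_of_lsum_finite) auto
    then show ?thesis using V[OF t] by (simp add: Vs_def mult.commute)
  qed
  have "CV \<beta> T v"
    unfolding CV_def
    by (intro conjI ballI Vb VsNorm_tendsto_dominated[OF Vb CwV_coefficient_continuous[OF w(3)] q])
  moreover have "L2V (2 * \<beta>) T v"
  proof -
    have D': "(\<integral>\<^sup>+ t. lsum (\<lambda>k. kn k powr (2 * (2 * \<beta>)) * (norm (v t k))\<^sup>2) \<partial>?L) < \<infinity>"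
      using D by simp
    have "AE t in ?L. lsum (\<lambda>k. kn k powr (2 * (2 * \<beta>)) * (norm (v t k))\<^sup>2) \<noteq> \<infinity>"
      by (rule nn_integral_PInf_AE) (use D' in \<open>auto simp: less_top\<close>)
    \<comment> \<open>Zero mean, reality and vanishing divergence come from \<open>Vs 0\<close>,
      known at every time of the interval; only summability is an almost-everywhere
      statement.\<close>
    moreover have "AE t in ?L. t \<in> {0..T}" by (rule AE_I2) simp
    ultimately have ae: "AE t in ?L. Vs (2 * \<beta>) (v t)"
    proof eventually_elim
      case (elim t)
      then have "(\<lambda>k. kn k powr (2 * (2 * \<beta>)) * (norm (v t k))\<^sup>2) summable_on UNIV"
        by (intro summable_on_of_lsum_finite) (auto simp: less_top)
      then show ?case using V[OF elim(2)] by (simp add: Vs_def mult.commute)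
    qed
    then have "AE t in ?L. ennreal ((VsNorm (2 * \<beta>) (v t))\<^sup>2) = lsum (\<lambda>k. kn k powr (2 * (2 * \<beta>)) * (norm (v t k))\<^sup>2)"
      by eventually_elim (rule VsNorm_square)
    then have "(\<integral>\<^sup>+ t. ennreal ((VsNorm (2 * \<beta>) (v t))\<^sup>2) \<partial>?L) < \<infinity>"
      using D' by (subst nn_integral_cong_AE) auto
    then show ?thesis using w(1) ae by (simp add: L2V_def LinfV_def)
  qed
  ultimately show ?thesis by simp
qed

theorem theorem9:
  fixes \<nu> T \<alpha> \<beta> :: real
    and v0 :: vfield and \<theta>0 :: sfield
    and v :: "real \<Rightarrow> vfield" and \<theta> :: "real \<Rightarrow> sfield"
    and vn :: "nat \<Rightarrow> real \<Rightarrow> vfield" and \<theta>n :: "nat \<Rightarrow> real \<Rightarrow> sfield"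
    and r :: "nat \<Rightarrow> nat"
  assumes "\<nu> > 0" and "T > 0"
    and "1/2 < \<beta>" and "\<beta> < 5/4" and "\<alpha> + \<beta> = 5/4"
    and "Vs \<beta> v0" and "Hs 0 \<theta>0"
    and galerkin: "\<And>n. galerkin_solution \<nu> \<alpha> \<beta> T v0 \<theta>0 n (vn n) (\<theta>n n)"
    and subseq: "strict_mono r"
    and weak_L2: "\<And>g. L2V \<beta> T g \<Longrightarrow>
          (\<lambda>n. integral\<^sup>L (lebesgue_on {0..T}) (\<lambda>t. Vinner \<beta> (vn (r n) t) (g t)))
          \<longlonglongrightarrow> integral\<^sup>L (lebesgue_on {0..T}) (\<lambda>t. Vinner \<beta> (v t) (g t))"
    and weakstar_v: "\<And>g. L1V 0 T g \<Longrightarrow>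
          (\<lambda>n. integral\<^sup>L (lebesgue_on {0..T}) (\<lambda>t. Vinner 0 (vn (r n) t) (g t)))
          \<longlonglongrightarrow> integral\<^sup>L (lebesgue_on {0..T}) (\<lambda>t. Vinner 0 (v t) (g t))"
    and strong_L2: "(\<lambda>n. \<integral>\<^sup>+ t. ennreal ((VsNorm 0 (vn (r n) t - v t))\<^sup>2) \<partial>lebesgue_on {0..T})
          \<longlonglongrightarrow> 0"
    and weakstar_theta: "\<And>g. L1H 0 T g \<Longrightarrow>
          (\<lambda>n. integral\<^sup>L (lebesgue_on {0..T}) (\<lambda>t. Hinner 0 (\<theta>n (r n) t) (g t)))
          \<longlonglongrightarrow> integral\<^sup>L (lebesgue_on {0..T}) (\<lambda>t. Hinner 0 (\<theta> t) (g t))"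
    and weak: "weak_solution \<nu> \<alpha> \<beta> T v0 \<theta>0 v \<theta>"
  shows "CV \<beta> T v \<and> L2V (2 * \<beta>) T v"
proof (rule weak_solution_regularity)
qed fact+

end
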